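(* In the setting described in the context (true parameter $\xi_0\in\Xi$, sampling $h_n\to0$, $T_n=nh_n\to\infty$), assume: (A1) There exist constants $C>0$ and $\alpha\in(0,2]$ such that for all $n$, $\sup_{1\le i\le n}\sum_{j=1}^n|\mathrm{Cov}(\Delta_i^nZ,\Delta_j^nZ)|\le C h_n^\alpha$. (A2) There exist constants $\beta\in(0,2]$ and $c_K>0$ such that $K(0)-K(t)=c_Kt^\beta+o(t^\beta)$ as $t\downarrow0$. (B1) For every $t\ge0$, the map $\xi\mapsto\mu_\xi(t)$ is continuous on $\overline{\Xi}$. (B2) For every $t\ge0$, the map $\xi\mapsto\mu_\xi(t)$ is twice continuously differentiable on $\overline{\Xi}$. (B3) There exists $C>0$ such that $\sup_{\xi\in\overline{\Xi}}\sup_{t\ge0}|\partial_t\mu_\xi(t)|\le C$ (the time derivative being assumed to exist). (B4) There exist a deterministic sequence $a_n\to\infty$ and a nonnegative continuous function $Q:\overline{\Xi}\times\overline{\Xi}\to[0,\infty)$ such that $$\sup_{\xi\in\overline{\Xi}}\left|\frac1{a_n}\sum_{i=1}^n\bigl(\mu_\xi(t_{i-1})-\mu_{\xi_0}(t_{i-1})\bigr)^2-Q(\xi,\xi_0)\right|\to0,$$ and, for $\xi\in\overline{\Xi}$, $Q(\xi,\xi_0)=0$ if and only if $\xi=\xi_0$. (B5) There exist a deterministic sequence $b_n\to\infty$ and a measurable function $M:[0,\infty)\to[0,\infty)$ such that $\sup_{\xi\in\overline{\Xi}}|\partial_\xi\mu_\xi(t)|\le M(t)$ for all $t\ge0$ and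 $\frac1{b_n}\sum_{i=1}^nM(t_{i-1})^2=O(1)$. (B6) There exists a positive definite matrix $I(\xi_0)$ such that $$\frac1{a_n}\sum_{i=1}^n\partial_\xi\mu_{\xi_0}(t_{i-1})\,\partial_\xi\mu_{\xi_0}(t_{i-1})^\top\to I(\xi_0).$$ (B7) There exists a positive definite matrix $\Gamma(\xi_0)$ such that $$\frac1{a_nh_n^\beta}\sum_{i,j=1}^n\partial_\xi\mu_{\xi_0}(t_{i-1})\,\partial_\xi\mu_{\xi_0}(t_{j-1})^\top\,\mathrm{Cov}(\Delta_i^nZ,\Delta_j^nZ)\to\Gamma(\xi_0).$$ (B8) There exist a bounded convex neighborhood $U\subset\Xi$ of $\xi_0$, a measurable function $N:[0,\infty)\to[0,\infty)$, a constant $\rho\in(0,1]$ and a function $L:[0,\infty)\to[0,\infty)$ such that, for all $t\ge0$ and $\xi,\eta\in U$, $$|\partial_\xi^2\mu_\xi(t)|\le N(t),\qquad |\partial_\xi^2\mu_\xi(t)-\partial_\xi^2\mu_\eta(t)|\le L(t)|\xi-\eta|^\rho,$$ and $\frac1{a_n}\sum_{i=1}^nN(t_{i-1})^2=O(1)$, $\frac1{a_n}\sum_{i=1}^nL(t_{i-1})^2=O(1)$. Assume moreover that $b_n=O(a_n)$ and that, as $n\to\infty$, $$a_nh_n^{2-(\alpha\wedge\beta)}\to\infty,\qquad \frac{nh_n^2}{a_n}\to0,\qquad nh_n^{4-\beta}\to0.$$ Then, as $n\to\infty$, $$\sqrt{a_nh_n^{2-\beta}}\,(\widehat{\xi}_n-\xi_0)\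 \xrightarrow{\ d\ }\ \mathcal{N}\bigl(0,\;I(\xi_0)^{-1}\Gamma(\xi_0)I(\xi_0)^{-1}\bigr).$$
   Context: Let $\Xi\subset\mathbb{R}^p$ be an open bounded convex set with closure $\overline{\Xi}$, and let $\{\mu_\xi:[0,\infty)\to\mathbb{R}\mid\xi\in\overline{\Xi}\}$ be a family of deterministic functions (drifts) with $\int_0^t|\mu_\xi(s)|\,ds<\infty$ for all $t>0$. Let $Z=(Z_t)_{t\ge0}$ be a centered stationary Gaussian process with covariance kernel $K$, i.e. $\mathbb{E}[Z_tZ_s]=K(|t-s|)$. For a true parameter $\xi_0\in\Xi$, the observed process is $$X_t=Z_t+\int_0^t\mu_{\xi_0}(s)\,ds,\qquad t\ge0.$$ For each $n$, $X$ is observed at $t_i=ih_n$, $i=0,1,\dots,n$, where $h_n>0$, $h_n\to0$ and $T_n:=nh_n\to\infty$ as $n\to\infty$. For $Y=X,Z$ write $\Delta_i^nY=Y_{t_i}-Y_{t_{i-1}}$, $i=1,\dots,n$. The contrast function is $H_n(\xi)=\sum_{i=1}^n\bigl(\Delta_i^nX-\mu_\xi(t_{i-1})h_n\bigr)^2$, and the estimator is any (measurable) minimizer $\widehat{\xi}_n\in\arg\min_{\xi\in\overline{\Xi}}H_n(\xi)$. $\partial_\xi$ denotes the gradient in $\xi$ (a column vector), $\partial_\xi^2$ the Hessian in $\xi$, $|\cdot|$ the Euclidean (or a matrix) norm, $\alpha\wedge\beta=\min(\alpha,\beta)$, and $\xrightarrow{d}$ convergence in distribution. *)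

theory Defs
  imports "HOL-Probability.Probability" "HOL-Library.Landau_Symbols"
begin

section \<open>Matrices\<close>

definition outer :: "real ^ 'p \<Rightarrow> real ^ 'p \<Rightarrow> real ^ 'p ^ 'p" where
  "outer u v = (\<chi> i j. u $ i * v $ j)"

definition pos_def_matrix :: "real ^ 'p ^ 'p \<Rightarrow> bool" where
  "pos_def_matrix A \<longleftrightarrow> transpose A = A \<and> (\<forall>x. x \<noteq> 0 \<longrightarrow> 0 < x \<bullet> (A *v x))"


section \<open>Normal laws and Gaussian processes\<close>

text \<open>Standard deviation 0 is allowed and gives the point mass at \<open>m\<close>, so that degenerate
  linear combinations of a Gaussian process count as Gaussian.\<close>

definition normal_law :: "real \<Rightarrow> real \<Rightarrow> real measure" where
  "normal_law m \<sigma> =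
     (if \<sigma> = 0 then return borel m else density lborel (\<lambda>x. ennreal (normal_density m \<sigma> x)))"

definition gaussian_rv :: "'w measure \<Rightarrow> ('w \<Rightarrow> real) \<Rightarrow> bool" where
  "gaussian_rv P Y \<longleftrightarrow>
     Y \<in> borel_measurable P \<and> (\<exists>m \<sigma>. 0 \<le> \<sigma> \<and> distr P borel Y = normal_law m \<sigma>)"

definition gaussian_process :: "'w measure \<Rightarrow> 't set \<Rightarrow> ('t \<Rightarrow> 'w \<Rightarrow> real) \<Rightarrow> bool" where
  "gaussian_process P T Z \<longleftrightarrow>
     (\<forall>J c. finite J \<and> J \<subseteq> T \<longrightarrow> gaussian_rv P (\<lambda>\<omega>. \<Sum>t\<in>J. c t * Z t \<omega>))"

text \<open>Stationarity is the requirement that the covariance of \<open>Z t\<close> and \<open>Z s\<close> depends on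
  \<open>\<bar>t - s\<bar>\<close> only; for centered Gaussian processes this is the same as strict stationarity.\<close>

definition centered_stationary_gaussian_process ::
    "'w measure \<Rightarrow> (real \<Rightarrow> 'w \<Rightarrow> real) \<Rightarrow> (real \<Rightarrow> real) \<Rightarrow> bool" where
  "centered_stationary_gaussian_process P Z K \<longleftrightarrow>
     gaussian_process P {0..} Z \<and>
     (\<forall>t\<ge>0. integral\<^sup>L P (Z t) = 0) \<and>
     (\<forall>t\<ge>0. \<forall>s\<ge>0. integral\<^sup>L P (\<lambda>\<omega>. Z t \<omega> * Z s \<omega>) = K \<bar>t - s\<bar>)"

definition covariance :: "'w measure \<Rightarrow> ('w \<Rightarrow> real) \<Rightarrow> ('w \<Rightarrow> real) \<Rightarrow> real" where
  "covariance P X Y =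
     integral\<^sup>L P (\<lambda>\<omega>. (X \<omega> - integral\<^sup>L P X) * (Y \<omega> - integral\<^sup>L P Y))"

text \<open>The law with mean \<open>m\<close> and covariance matrix \<open>S\<close>, given by its Lebesgue density. This is
  meaningful for positive definite \<open>S\<close> only.\<close>

definition multivariate_normal :: "real ^ 'p \<Rightarrow> real ^ 'p ^ 'p \<Rightarrow> (real ^ 'p) measure" where
  "multivariate_normal m S =
     density lborel
       (\<lambda>x. ennreal (exp (- ((x - m) \<bullet> (matrix_inv S *v (x - m))) / 2)
                      / sqrt ((2 * pi) ^ CARD('p) * det S)))"

definition converges_in_distribution ::
    "'w measure \<Rightarrow> (nat \<Rightarrow> 'w \<Rightarrow> 'b :: topological_space) \<Rightarrow> 'b measure \<Rightarrow> bool" where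
  "converges_in_distribution P Y \<nu> \<longleftrightarrow>
     (\<forall>n. Y n \<in> borel_measurable P) \<and>
     (\<forall>f :: 'b \<Rightarrow> real. continuous_on UNIV f \<and> bounded (range f) \<longrightarrow>
        (\<lambda>n. integral\<^sup>L P (\<lambda>\<omega>. f (Y n \<omega>))) \<longlonglongrightarrow> integral\<^sup>L \<nu> f)"


section \<open>High-frequency observations and the contrast function\<close>

definition grid :: "(nat \<Rightarrow> real) \<Rightarrow> nat \<Rightarrow> nat \<Rightarrow> real" where
  "grid h n i = real i * h n"

text \<open>Used for \<open>1 \<le> i \<le> n\<close> only, so that \<open>i - 1\<close> does not truncate.\<close>

definition increment ::
    "(nat \<Rightarrow> real) \<Rightarrow> (real \<Rightarrow> 'w \<Rightarrow> real) \<Rightarrow> nat \<Rightarrow> nat \<Rightarrow> 'w \<Rightarrow> real" where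
  "increment h Y n i \<omega> = Y (grid h n i) \<omega> - Y (grid h n (i - 1)) \<omega>"

definition contrast ::
    "(nat \<Rightarrow> real) \<Rightarrow> (real \<Rightarrow> 'w \<Rightarrow> real) \<Rightarrow> ('x \<Rightarrow> real \<Rightarrow> real) \<Rightarrow> nat \<Rightarrow> 'w \<Rightarrow> 'x \<Rightarrow> real" where
  "contrast h X \<mu> n \<omega> \<xi> =
     (\<Sum>i=1..n. (increment h X n i \<omega> - \<mu> \<xi> (grid h n (i - 1)) * h n)\<^sup>2)"


section \<open>Twice continuous differentiability\<close>

text \<open>\<open>g\<close> is the gradient and \<open>H\<close> the Hessian of \<open>f\<close> on \<open>S\<close>. Derivatives are taken within
  \<open>S\<close>, so at boundary points of \<open>S\<close> they are one-sided. If \<open>S\<close> is the closure of a nonempty open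
  convex set, \<open>g\<close> and \<open>H\<close> are uniquely determined on \<open>S\<close>.\<close>

definition twice_continuously_differentiable_on ::
    "(real ^ 'p) set \<Rightarrow> (real ^ 'p \<Rightarrow> real) \<Rightarrow> (real ^ 'p \<Rightarrow> real ^ 'p) \<Rightarrow>
     (real ^ 'p \<Rightarrow> real ^ 'p ^ 'p) \<Rightarrow> bool" where
  "twice_continuously_differentiable_on S f g H \<longleftrightarrow>
     (\<forall>x\<in>S. (f has_derivative (\<lambda>v. g x \<bullet> v)) (at x within S)) \<and>
     (\<forall>x\<in>S. (g has_derivative (\<lambda>v. H x *v v)) (at x within S)) \<and>
     continuous_on S g \<and> continuous_on S H"

end

theory Submission
  imports Defs
begin

text \<open>The contrast estimator is a least squares estimator for a regression with deterministic
  regressors \<open>\<mu>\<^sub>\<xi>(t\<^sub>i)\<close> and dependent Gaussian noise \<open>\<Delta>\<^sub>iZ\<close>, up to an Euler error of order \<open>h\<^sup>2\<close> per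
  observation. At the minimiser the gradient of the contrast vanishes. Expanding this normal
  equation around the true parameter, with \<open>\<theta> = \<xi>hat - \<xi>\<^sub>0\<close> and
  \<open>S\<^sub>n = \<Sum>\<^sub>i \<partial>\<mu>(t\<^sub>i) \<Delta>\<^sub>iZ\<close> taken at \<open>\<xi>\<^sub>0\<close>, gives
  \<open>a\<^sub>n h\<^sub>n I\<^sub>0 \<theta> = S\<^sub>n + o(a\<^sub>n h\<^sub>n) |\<theta>| + O(h\<^sub>n\<^sup>2 (n a\<^sub>n)\<^bsup>1/2\<^esup>)\<close> (\<open>normal_equation_expansion\<close>, \<open>expansion\<close>).
  The vector \<open>S\<^sub>n\<close> is exactly Gaussian, with covariance asymptotic to \<open>a\<^sub>n h\<^sub>n\<^bsup>\<beta>\<^esup> \<Gamma>\<^sub>0\<close>.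
  Dividing by \<open>(a\<^sub>n h\<^sub>n\<^bsup>\<beta>\<^esup>)\<^bsup>1/2\<^esup>\<close> turns the left side into \<open>I\<^sub>0\<close> applied to the normalised error and
  the last term into \<open>O((n h\<^sub>n\<^bsup>4 - \<beta>\<^esup>)\<^bsup>1/2\<^esup>)\<close>, so the claim follows by a Slutsky argument
  (\<open>asymptotic_normality\<close>).

  The expansion requires consistency (\<open>consistent\<close>) and uniform control of noise sums
  \<open>\<Sum>\<^sub>i c\<^sub>i(\<xi>) \<Delta>\<^sub>iZ\<close> over a set of parameters (\<open>noise_uniformly_small\<close>). At a fixed \<open>\<xi>\<close> such a
  sum has standard deviation of order \<open>(a\<^sub>n h\<^sub>n\<^bsup>\<alpha>\<^esup>)\<^bsup>1/2\<^esup> = o(a\<^sub>n h\<^sub>n)\<close>. Being Gaussian, its increments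
  have moments of all orders controlled by their variance, so Kolmogorov's chaining argument
  (\<open>chaining_convex\<close>) makes the bound uniform, without loss of order, when the coefficients are
  Hoelder continuous in \<open>\<xi>\<close> with constants whose squares sum to \<open>O(a\<^sub>n)\<close>. In the expansion the noise weighted with
  \<open>\<partial>\<mu>\<^sub>\<xi> - \<partial>\<mu>\<close> is estimated by \<open>|\<theta>|\<close> times the supremum of the noise weighted with the Hessian. The
  factor \<open>|\<theta>|\<close> matters: when \<open>\<alpha> < \<beta>\<close>, this sum need not be small compared with \<open>S\<^sub>n\<close>, but it
  is always small compared with the linear term \<open>a\<^sub>n h\<^sub>n I\<^sub>0 \<theta>\<close>.

  Convergence in law in several dimensions is reduced to the expectations of the waves
  \<open>cos (u \<bullet> x + c)\<close> (\<open>converges_in_distribution_if_waves\<close>). They are explicit for Gaussian vectors,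
  and also for the limit law, once a linear substitution has turned its density into a product of
  standard normal densities (\<open>multivariate_normal_wave\<close>).\<close>

section \<open>Convergence in distribution from expectations of plane waves\<close>

text \<open>The real trigonometric polynomials. Being closed under products, they contain every
  polynomial in the bounded functions \<open>x \<mapsto> sin (x \<bullet> b / L)\<close>, and this is what links the
  Stone-Weierstrass theorem to characteristic functions.\<close>

inductive trig_poly :: "('a::euclidean_space \<Rightarrow> real) \<Rightarrow> bool" where
  wave: "trig_poly (\<lambda>x. cos (u \<bullet> x + c))"
| scale: "trig_poly f \<Longrightarrow> trig_poly (\<lambda>x. r * f x)"
| add: "trig_poly f \<Longrightarrow> trig_poly g \<Longrightarrow> trig_poly (\<lambda>x. f x + g x)"

lemma trig_poly_const: "trig_poly (\<lambda>x. r)"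
  using trig_poly.scale[OF trig_poly.wave[of 0 0], of r] by simp

lemma trig_poly_wave_mult:
  assumes "trig_poly g"
  shows "trig_poly (\<lambda>x. cos (u \<bullet> x + c) * g x)"
  using assms
proof induction
  case (wave v d)
  have "(\<lambda>x. cos (u \<bullet> x + c) * cos (v \<bullet> x + d)) =
        (\<lambda>x. (1/2) * (cos ((u - v) \<bullet> x + (c - d)) + cos ((u + v) \<bullet> x + (c + d))))"
  proof
    fix x
    have *: "(u - v) \<bullet> x + (c - d) = (u \<bullet> x + c) - (v \<bullet> x + d)"
      "(u + v) \<bullet> x + (c + d) = (u \<bullet> x + c) + (v \<bullet> x + d)"
      by (simp_all add: inner_add_left inner_diff_left)
    show "cos (u \<bullet> x + c) * cos (v \<bullet> x + d) =
        (1/2) * (cos ((u - v) \<bullet> x + (c - d)) + cos ((u + v) \<bullet> x + (c + d)))"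
      unfolding * cos_times_cos by simp
  qed
  then show ?case
    using trig_poly.scale[OF trig_poly.add[OF trig_poly.wave[of "u - v" "c - d"]
        trig_poly.wave[of "u + v" "c + d"]], of "1/2"] by simp
next
  case (scale f r)
  then show ?case using trig_poly.scale[OF scale.IH, of r] by (simp add: ac_simps)
next
  case (add f1 f2)
  then show ?case using trig_poly.add[OF add.IH] by (simp add: distrib_left)
qed

lemma trig_poly_mult:
  assumes "trig_poly f" "trig_poly g"
  shows "trig_poly (\<lambda>x. f x * g x)"
  using assms(1)
proof induction
  case (wave u c)
  then show ?case by (rule trig_poly_wave_mult[OF assms(2)])
next
  case (scale f r)
  then show ?case using trig_poly.scale[OF scale.IH, of r] by (simp add: ac_simps)
next
  case (add f1 f2)
  then show ?case using trig_poly.add[OF add.IH] by (simp add: distrib_right)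
qed

lemma trig_poly_sum:
  assumes "finite I" "\<And>i. i \<in> I \<Longrightarrow> trig_poly (f i)"
  shows "trig_poly (\<lambda>x. \<Sum>i\<in>I. f i x)"
  using assms by (induction rule: finite_induct) (auto intro: trig_poly.add trig_poly_const)

lemma trig_poly_sin: "trig_poly (\<lambda>x. sin (x \<bullet> b / L))"
proof -
  have "sin (x \<bullet> b / L) = cos ((- (1/L) *\<^sub>R b) \<bullet> x + pi/2)" for x
    by (simp add: sin_cos_eq inner_commute)
  then show ?thesis using trig_poly.wave[of "- (1/L) *\<^sub>R b" "pi/2"] by simp
qed

lemma trig_poly_continuous: "trig_poly f \<Longrightarrow> continuous_on UNIV f"
  by (induction rule: trig_poly.induct) (auto intro!: continuous_intros)

lemma trig_poly_real_polynomial_sin: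
  assumes "real_polynomial_function p"
  shows "trig_poly (\<lambda>x::'a::euclidean_space. p (\<Sum>b\<in>Basis. sin (x \<bullet> b / L) *\<^sub>R b))"
  using assms
proof induction
  case (linear f)
  have "f (\<Sum>b\<in>Basis. sin (x \<bullet> b / L) *\<^sub>R b) = (\<Sum>b\<in>Basis. f b * sin (x \<bullet> b / L))" for x :: 'a
    by (simp only: linear_sum[OF bounded_linear.linear[OF linear]]
        linear_cmul[OF bounded_linear.linear[OF linear]] real_scaleR_def mult.commute)
  then show ?case
    by (auto intro!: trig_poly_sum trig_poly.scale trig_poly_sin)
qed (auto intro: trig_poly_const trig_poly.add trig_poly_mult)

text \<open>Substituting \<open>x = L arcsin y\<close> turns a continuous function on a cube into one on the
  unit cube. A polynomial \<open>p\<close> approximating the latter is bounded on the unit cube, and then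
  \<open>p \<circ> sin (\<cdot> / L)\<close> is bounded by the same constant on the whole space, not just near the
  cube where it approximates.\<close>

lemma trig_poly_approx:
  fixes f :: "'a::euclidean_space \<Rightarrow> real"
  assumes cont: "continuous_on UNIV f" and B: "\<And>x. \<bar>f x\<bar> \<le> B" and "0 < L" "0 < e"
  obtains g where "trig_poly g" "\<And>x. \<bar>g x\<bar> \<le> B + e"
    "\<And>x. (\<And>b. b \<in> Basis \<Longrightarrow> \<bar>x \<bullet> b\<bar> \<le> L) \<Longrightarrow> \<bar>f x - g x\<bar> \<le> e"
proof -
  define R where "R = 2 * L / pi"
  have "R > 0" using \<open>0 < L\<close> by (simp add: R_def)
  define F where "F = (\<lambda>y::'a. f (\<Sum>b\<in>Basis. (R * arcsin (y \<bullet> b)) *\<^sub>R b))"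
  define sv where "sv = (\<lambda>x::'a. \<Sum>b\<in>Basis. sin (x \<bullet> b / R) *\<^sub>R b)"
  define C where "C = cbox (\<Sum>b\<in>Basis. - b) (\<Sum>b\<in>Basis. b :: 'a)"
  have inC: "y \<in> C \<longleftrightarrow> (\<forall>b\<in>Basis. -1 \<le> y \<bullet> b \<and> y \<bullet> b \<le> 1)" for y
    unfolding C_def mem_box
    by (intro ball_cong refl)
      (simp add: inner_sum_left inner_Basis sum.delta sum_negf if_distrib cong: if_cong)
  have "continuous_on C F"
    unfolding F_def
    by (rule continuous_on_compose2[OF cont]) (auto simp: inC intro!: continuous_intros)
  then obtain p where p: "real_polynomial_function p" "\<And>y. y \<in> C \<Longrightarrow> \<bar>F y - p y\<bar> < e"
    using Stone_Weierstrass_real_polynomial_function[of C F e] \<open>0 < e\<close> by (auto simp: C_def)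
  have sv_in: "sv x \<in> C" for x
    by (simp add: inC sv_def inner_sum_left inner_Basis if_distrib sum.delta cong: if_cong)
  show ?thesis
  proof
    show "trig_poly (\<lambda>x. p (sv x))"
      unfolding sv_def by (rule trig_poly_real_polynomial_sin[OF p(1)])
    show "\<bar>p (sv x)\<bar> \<le> B + e" for x
    proof -
      have "\<bar>F (sv x)\<bar> \<le> B" unfolding F_def by (rule B)
      then show ?thesis using p(2)[OF sv_in[of x]] by linarith
    qed
    show "\<bar>f x - p (sv x)\<bar> \<le> e" if x: "\<And>b. b \<in> Basis \<Longrightarrow> \<bar>x \<bullet> b\<bar> \<le> L" for x
    proof -
      have "R * arcsin (sv x \<bullet> b) = x \<bullet> b" if b: "b \<in> Basis" for b
      proof -
        have "\<bar>x \<bullet> b / R\<bar> \<le> pi / 2"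
        proof -
          have "\<bar>x \<bullet> b\<bar> / R \<le> L / R" using x[OF b] \<open>R > 0\<close> by (intro divide_right_mono) auto
          also have "L / R = pi / 2" using \<open>0 < L\<close> by (simp add: R_def)
          finally show ?thesis using \<open>R > 0\<close> by (simp add: abs_divide)
        qed
        then have "arcsin (sin (x \<bullet> b / R)) = x \<bullet> b / R"
          by (intro arcsin_sin; linarith)
        moreover have "sv x \<bullet> b = sin (x \<bullet> b / R)"
          using b by (simp add: sv_def inner_sum_left inner_Basis if_distrib sum.delta cong: if_cong)
        ultimately show ?thesis using \<open>R > 0\<close> by simp
      qed
      then have "F (sv x) = f x"
        unfolding F_def by (simp add: euclidean_representation)
      then show ?thesis using p(2)[OF sv_in[of x]] by simp
    qed
  qed
qed

lemma integral_diff_le_off_small_set: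
  fixes W :: "'w \<Rightarrow> 'a::euclidean_space"
  assumes "prob_space M" and [measurable]: "W \<in> borel_measurable M"
    and f: "continuous_on UNIV f" "\<And>x. \<bar>f x\<bar> \<le> B"
    and g: "continuous_on UNIV g" "\<And>x. \<bar>g x\<bar> \<le> B'"
    and fg: "\<And>x. norm x \<le> L \<Longrightarrow> \<bar>f x - g x\<bar> \<le> e" and "0 \<le> e"
    and tail: "measure M {\<omega>\<in>space M. norm (W \<omega>) > L} \<le> e"
  shows "\<bar>(\<integral>\<omega>. f (W \<omega>) \<partial>M) - (\<integral>\<omega>. g (W \<omega>) \<partial>M)\<bar> \<le> e * (1 + B + B')"
proof -
  interpret prob_space M by fact
  have [measurable]: "f \<in> borel_measurable borel" "g \<in> borel_measurable borel"
    using f(1) g(1) by (auto intro: borel_measurable_continuous_onI)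
  define T where "T = {\<omega>\<in>space M. norm (W \<omega>) > L}"
  have [measurable]: "T \<in> sets M" unfolding T_def by measurable
  have "0 \<le> B" "0 \<le> B'" using f(2)[of 0] g(2)[of 0] by auto
  have i1: "integrable M (\<lambda>\<omega>. f (W \<omega>))" by (rule integrable_const_bound[of _ B]) (auto simp: f)
  have i2: "integrable M (\<lambda>\<omega>. g (W \<omega>))" by (rule integrable_const_bound[of _ B']) (auto simp: g)
  have "\<bar>(\<integral>\<omega>. f (W \<omega>) \<partial>M) - (\<integral>\<omega>. g (W \<omega>) \<partial>M)\<bar> = \<bar>\<integral>\<omega>. f (W \<omega>) - g (W \<omega>) \<partial>M\<bar>"
    using i1 i2 by simp
  also have "\<dots> \<le> (\<integral>\<omega>. \<bar>f (W \<omega>) - g (W \<omega>)\<bar> \<partial>M)"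
    by (rule integral_abs_bound)
  also have "\<dots> \<le> (\<integral>\<omega>. e + (B + B') * indicator T \<omega> \<partial>M)"
  proof (rule integral_mono)
    show "integrable M (\<lambda>\<omega>. \<bar>f (W \<omega>) - g (W \<omega>)\<bar>)" using i1 i2 by auto
    show "integrable M (\<lambda>\<omega>. e + (B + B') * indicat_real T \<omega>)"
      by (intro Bochner_Integration.integrable_add integrable_const
          integrable_mult_right integrable_real_indicator) (auto simp: emeasure_eq_measure)
    fix \<omega> assume \<omega>: "\<omega> \<in> space M"
    show "\<bar>f (W \<omega>) - g (W \<omega>)\<bar> \<le> e + (B + B') * indicat_real T \<omega>"
    proof (cases "\<omega> \<in> T")
      case True
      then show ?thesis using f(2)[of "W \<omega>"] g(2)[of "W \<omega>"] \<open>0 \<le> e\<close> by simp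
    next
      case False
      then show ?thesis using fg[of "W \<omega>"] \<omega> by (simp add: T_def)
    qed
  qed
  also have "\<dots> = e + (B + B') * measure M T"
    by (subst Bochner_Integration.integral_add)
      (auto simp: emeasure_eq_measure prob_space)
  also have "\<dots> \<le> e + (B + B') * e"
    using tail \<open>0 \<le> B\<close> \<open>0 \<le> B'\<close> by (intro add_left_mono mult_left_mono) (auto simp: T_def)
  finally show ?thesis by (simp add: algebra_simps)
qed

lemma trig_poly_bounded: "trig_poly g \<Longrightarrow> \<exists>B. \<forall>x. \<bar>g x\<bar> \<le> B"
proof (induction rule: trig_poly.induct)
  case (wave u c)
  show ?case by (rule exI[of _ 1]) auto
next
  case (scale f r)
  then obtain B where "\<forall>x. \<bar>f x\<bar> \<le> B" by auto
  then show ?case by (intro exI[of _ "\<bar>r\<bar> * B"]) (auto simp: abs_mult intro: mult_left_mono)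
next
  case (add f g)
  then obtain B C where "\<forall>x. \<bar>f x\<bar> \<le> B" "\<forall>x. \<bar>g x\<bar> \<le> C" by auto
  then show ?case by (intro exI[of _ "B + C"] allI order_trans[OF abs_triangle_ineq] add_mono) auto
qed

lemma trig_poly_integrable:
  assumes "trig_poly g" "prob_space M" and [measurable]: "W \<in> borel_measurable M"
  shows "integrable M (\<lambda>\<omega>. g (W \<omega>))"
proof -
  interpret prob_space M by fact
  have [measurable]: "g \<in> borel_measurable borel"
    using trig_poly_continuous[OF assms(1)] by (auto intro: borel_measurable_continuous_onI)
  obtain B where "\<forall>x. \<bar>g x\<bar> \<le> B" using trig_poly_bounded[OF assms(1)] by auto
  then show ?thesis by (intro integrable_const_bound[of _ B]) auto
qed

lemma trig_poly_expectation_tendsto: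
  fixes Y :: "nat \<Rightarrow> 'w \<Rightarrow> 'a::euclidean_space"
  assumes "trig_poly g" "prob_space P" "prob_space \<nu>" "sets \<nu> = sets borel"
    and meas: "\<And>n. Y n \<in> borel_measurable P"
    and conv: "\<And>u c. (\<lambda>n. \<integral>\<omega>. cos (u \<bullet> Y n \<omega> + c) \<partial>P) \<longlonglongrightarrow> (\<integral>x. cos (u \<bullet> x + c) \<partial>\<nu>)"
  shows "(\<lambda>n. \<integral>\<omega>. g (Y n \<omega>) \<partial>P) \<longlonglongrightarrow> (\<integral>x. g x \<partial>\<nu>)"
  using assms(1)
proof induction
  case (wave u c)
  show ?case by (rule conv)
next
  case (scale f r)
  then show ?case by (auto intro!: tendsto_intros)
next
  case (add f g)
  have [measurable]: "(\<lambda>x. x) \<in> borel_measurable \<nu>" using assms(4) by measurable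
  have "integrable P (\<lambda>\<omega>. f (Y n \<omega>))" "integrable P (\<lambda>\<omega>. g (Y n \<omega>))" for n
    using add meas assms(2) by (auto intro: trig_poly_integrable)
  moreover have "integrable \<nu> f" "integrable \<nu> g"
    using trig_poly_integrable[OF add(1) assms(3), of "\<lambda>x. x"]
      trig_poly_integrable[OF add(2) assms(3), of "\<lambda>x. x"] by auto
  ultimately show ?case using add.IH by (auto intro!: tendsto_intros)
qed

lemma prob_space_norm_tail:
  fixes W :: "'w \<Rightarrow> 'a::euclidean_space"
  assumes "prob_space M" and [measurable]: "W \<in> borel_measurable M" and "0 < e"
  obtains L where "measure M {\<omega>\<in>space M. norm (W \<omega>) > L} \<le> e"
proof -
  interpret prob_space M by fact
  let ?A = "\<lambda>n::nat. {\<omega>\<in>space M. norm (W \<omega>) > real n}"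
  have "(\<lambda>n. measure M (?A n)) \<longlonglongrightarrow> measure M (\<Inter>n. ?A n)"
    by (rule finite_Lim_measure_decseq) (auto simp: decseq_def)
  moreover have "(\<Inter>n. ?A n) = {}"
    using reals_Archimedean2 by (auto, meson less_imp_not_less)
  ultimately have "(\<lambda>n. measure M (?A n)) \<longlonglongrightarrow> 0" by simp
  from order_tendstoD(2)[OF this \<open>0 < e\<close>] obtain n where "measure M (?A n) < e"
    by (auto simp: eventually_sequentially)
  then show ?thesis by (intro that[of "real n"]) simp
qed

text \<open>A continuity theorem of Levy type in several dimensions. Tightness confines the mass to
  a cube, up to a small amount; inside the cube a bounded continuous function is uniformly
  close to a trigonometric polynomial, and outside it both stay bounded.\<close>

theorem converges_in_distribution_if_waves:
  fixes Y :: "nat \<Rightarrow> 'w \<Rightarrow> 'a::euclidean_space"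
  assumes P: "prob_space P" and \<nu>: "prob_space \<nu>" "sets \<nu> = sets borel"
    and meas: "\<And>n. Y n \<in> borel_measurable P"
    and conv: "\<And>u c. (\<lambda>n. \<integral>\<omega>. cos (u \<bullet> Y n \<omega> + c) \<partial>P) \<longlonglongrightarrow> (\<integral>x. cos (u \<bullet> x + c) \<partial>\<nu>)"
    and tight: "\<And>e. 0 < e \<Longrightarrow>
      \<exists>L. \<forall>\<^sub>F n in sequentially. measure P {\<omega>\<in>space P. norm (Y n \<omega>) > L} \<le> e"
  shows "converges_in_distribution P Y \<nu>"
  unfolding converges_in_distribution_def
proof (intro conjI allI impI)
  fix n show "Y n \<in> borel_measurable P" by (rule meas)
next
  fix f :: "'a \<Rightarrow> real" assume f: "continuous_on UNIV f \<and> bounded (range f)"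
  then obtain B where B: "\<And>x. \<bar>f x\<bar> \<le> B" by (auto simp: bounded_iff)
  have "0 \<le> B" using B[of 0] by linarith
  have id: "(\<lambda>x. x) \<in> borel_measurable \<nu>" using \<nu>(2) by measurable
  have meas_\<nu>: "measure \<nu> {x\<in>space \<nu>. norm x > L} = measure \<nu> {x. norm x > L}" for L
    using sets_eq_imp_space_eq[OF \<nu>(2)] by simp
  show "(\<lambda>n. \<integral>\<omega>. f (Y n \<omega>) \<partial>P) \<longlonglongrightarrow> integral\<^sup>L \<nu> f"
  proof (rule tendstoI)
    fix r :: real assume "0 < r"
    define e where "e = min 1 (r / (4 * (2 + 2 * B)))"
    have e: "0 < e" "e \<le> 1" using \<open>0 < r\<close> \<open>0 \<le> B\<close> by (auto simp: e_def)
    have "e * (2 + 2 * B) \<le> r / (4 * (2 + 2 * B)) * (2 + 2 * B)"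
      using \<open>0 \<le> B\<close> by (intro mult_right_mono) (auto simp: e_def)
    also have "\<dots> = r / 4" using \<open>0 \<le> B\<close> by (simp add: divide_simps)
    finally have "e * (2 + 2 * B) \<le> r / 4" .
    obtain L1 where L1: "\<forall>\<^sub>F n in sequentially. measure P {\<omega>\<in>space P. norm (Y n \<omega>) > L1} \<le> e"
      using tight[OF e(1)] by auto
    obtain L2 where L2: "measure \<nu> {x\<in>space \<nu>. norm x > L2} \<le> e"
      using prob_space_norm_tail[OF \<nu>(1) id e(1)] by auto
    define L where "L = max 1 (max L1 L2)"
    have "0 < L" by (simp add: L_def)
    obtain g where g: "trig_poly g" "\<And>x. \<bar>g x\<bar> \<le> B + e"
      "\<And>x. (\<And>b. b \<in> Basis \<Longrightarrow> \<bar>x \<bullet> b\<bar> \<le> L) \<Longrightarrow> \<bar>f x - g x\<bar> \<le> e"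
      using trig_poly_approx[of f B L e, OF _ B _ e(1)] f \<open>0 < L\<close> by blast
    have g3: "\<bar>f x - g x\<bar> \<le> e" if "norm x \<le> L" for x
      using that by (intro g(3) order_trans[OF Basis_le_norm])
    have gB: "\<bar>g x\<bar> \<le> B + 1" for x using g(2)[of x] e by simp
    have L\<nu>: "measure \<nu> {x\<in>space \<nu>. norm x > L} \<le> e"
    proof -
      interpret prob_space \<nu> by fact
      have "{x\<in>space \<nu>. norm x > L} \<subseteq> {x\<in>space \<nu>. norm x > L2}" by (auto simp: L_def)
      moreover have "{x\<in>space \<nu>. norm x > L2} \<in> sets \<nu>" using id by measurable
      ultimately show ?thesis using L2 by (rule order_trans[OF finite_measure_mono])
    qed
    have d\<nu>: "\<bar>integral\<^sup>L \<nu> f - integral\<^sup>L \<nu> g\<bar> \<le> e * (2 + 2 * B)"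
      using integral_diff_le_off_small_set[OF \<nu>(1) id, of f B g "B + 1" L e] f B gB g3 L\<nu> e(1)
        trig_poly_continuous[OF g(1)] by (simp add: algebra_simps)
    have "\<forall>\<^sub>F n in sequentially. dist (\<integral>\<omega>. g (Y n \<omega>) \<partial>P) (integral\<^sup>L \<nu> g) < r / 4"
      using tendstoD[OF trig_poly_expectation_tendsto[OF g(1) P \<nu> meas conv], of "r/4"] \<open>0 < r\<close> by simp
    then show "\<forall>\<^sub>F n in sequentially. dist (\<integral>\<omega>. f (Y n \<omega>) \<partial>P) (integral\<^sup>L \<nu> f) < r"
      using L1
    proof eventually_elim
      fix n assume n: "dist (\<integral>\<omega>. g (Y n \<omega>) \<partial>P) (integral\<^sup>L \<nu> g) < r / 4"
        "measure P {\<omega>\<in>space P. norm (Y n \<omega>) > L1} \<le> e"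
      have LP: "measure P {\<omega>\<in>space P. norm (Y n \<omega>) > L} \<le> e"
      proof -
        interpret prob_space P by fact
        have "{\<omega>\<in>space P. norm (Y n \<omega>) > L} \<subseteq> {\<omega>\<in>space P. norm (Y n \<omega>) > L1}"
          by (auto simp: L_def)
        moreover have "{\<omega>\<in>space P. norm (Y n \<omega>) > L1} \<in> sets P" using meas[of n] by measurable
        ultimately show ?thesis using n(2) by (rule order_trans[OF finite_measure_mono])
      qed
      have "\<bar>(\<integral>\<omega>. f (Y n \<omega>) \<partial>P) - (\<integral>\<omega>. g (Y n \<omega>) \<partial>P)\<bar> \<le> e * (2 + 2 * B)"
        using integral_diff_le_off_small_set[OF P meas, of f B g "B + 1" L e n] f B gB g3 LP e(1)
          trig_poly_continuous[OF g(1)] by (simp add: algebra_simps)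
      then show "dist (\<integral>\<omega>. f (Y n \<omega>) \<partial>P) (integral\<^sup>L \<nu> f) < r"
        using d\<nu> n(1) \<open>e * (2 + 2 * B) \<le> r / 4\<close> \<open>0 < r\<close> unfolding dist_real_def by linarith
    qed
  qed
qed

section \<open>The multivariate normal law\<close>

lemma prod_Basis_cart:
  fixes f :: "real ^ 'n \<Rightarrow> 'a :: comm_monoid_mult"
  shows "(\<Prod>b\<in>Basis. f b) = (\<Prod>i\<in>UNIV. f (axis i 1))"
proof -
  have "(Basis :: (real ^ 'n) set) = range (\<lambda>i. axis i 1)"
    by (auto simp: Basis_vec_def)
  moreover have "inj (\<lambda>i::'n. axis i (1::real))"
    by (auto simp: inj_on_def axis_eq_axis)
  ultimately show ?thesis using prod.reindex[of "\<lambda>i::'n. axis i (1::real)" UNIV f]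
    by (simp add: o_def)
qed

lemma borel_measurable_matrix_vector_mult [measurable]:
  "(\<lambda>x. A *v x) \<in> borel_measurable (borel :: (real ^ 'n) measure)"
  by (intro borel_measurable_continuous_onI linear_continuous_on
      linear_conv_bounded_linear[THEN iffD1] matrix_vector_mul_linear)

text \<open>The linear change of variables formula in measure form. Every matrix is a product of
  diagonal matrices, transpositions, shears and matrices with a zero row, so it is enough that
  this property is multiplicative and holds for the invertible elementary matrices.\<close>

definition scales_lborel :: "real ^ 'n ^ 'n \<Rightarrow> bool" where
  "scales_lborel A \<longleftrightarrow>
     (\<forall>E\<in>sets borel. emeasure lborel E = ennreal \<bar>det A\<bar> * emeasure lborel ((\<lambda>x. A *v x) -` E))"

lemma scales_lborel_mult:
  assumes A: "scales_lborel A" and B: "scales_lborel B"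
  shows "scales_lborel (A ** B)"
  unfolding scales_lborel_def
proof
  fix E :: "(real ^ 'a) set" assume E: "E \<in> sets borel"
  have E': "(\<lambda>x. A *v x) -` E \<in> sets borel"
    using measurable_sets[OF borel_measurable_matrix_vector_mult E] by simp
  have "emeasure lborel E = ennreal \<bar>det A\<bar> * emeasure lborel ((\<lambda>x. A *v x) -` E)"
    using A E by (auto simp: scales_lborel_def)
  also have "emeasure lborel ((\<lambda>x. A *v x) -` E) =
      ennreal \<bar>det B\<bar> * emeasure lborel ((\<lambda>x. B *v x) -` (\<lambda>x. A *v x) -` E)"
    using B E' by (auto simp: scales_lborel_def)
  also have "(\<lambda>x. B *v x) -` (\<lambda>x. A *v x) -` E = (\<lambda>x. (A ** B) *v x) -` E"
    by (auto simp: matrix_vector_mul_assoc)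
  finally show "emeasure lborel E =
      ennreal \<bar>det (A ** B)\<bar> * emeasure lborel ((\<lambda>x. (A ** B) *v x) -` E)"
    by (simp add: det_mul abs_mult ennreal_mult mult.assoc)
qed

lemma scales_lborel_diagonal:
  assumes diag: "\<And>i j. i \<noteq> j \<Longrightarrow> A $ i $ j = 0" and "det A \<noteq> 0"
  shows "scales_lborel A"
  unfolding scales_lborel_def
proof
  fix E :: "(real ^ 'a) set" assume E: "E \<in> sets borel"
  have det: "det A = (\<Prod>i\<in>UNIV. A $ i $ i)" using diag by (rule det_diagonal)
  define c where "c b = b \<bullet> (A *v b)" for b
  have c: "c (axis i 1) = A $ i $ i" for i
    by (simp add: c_def inner_axis' matrix_vector_mul_component inner_axis)
  have act: "A *v x = 0 + (\<Sum>j\<in>Basis. (c j * (x \<bullet> j)) *\<^sub>R j)" for x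
  proof -
    have "(\<Sum>j\<in>Basis. (c j * (x \<bullet> j)) *\<^sub>R j) $ i = (A *v x) $ i" for i
    proof -
      have "(\<Sum>j\<in>Basis. (c j * (x \<bullet> j)) *\<^sub>R j) $ i =
          (\<Sum>j\<in>Basis. (c j * (x \<bullet> j)) *\<^sub>R j) \<bullet> axis i 1"
        by (simp add: inner_axis)
      also have "\<dots> = c (axis i 1) * (x \<bullet> axis i 1)"
        by (simp add: axis_in_Basis_iff)
      also have "\<dots> = (\<Sum>j\<in>UNIV. A $ i $ j * x $ j)"
        using diag by (subst sum.remove[of _ i]) (auto simp: c inner_axis intro!: sum.neutral)
      finally show ?thesis by (simp add: matrix_vector_mult_def)
    qed
    then show ?thesis by (simp add: vec_eq_iff)
  qed
  have "c j \<noteq> 0" if "j \<in> Basis" for j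
    using that \<open>det A \<noteq> 0\<close> by (auto simp: Basis_vec_def c det)
  then have eq: "lborel = density (distr lborel borel (\<lambda>x. A *v x)) (\<lambda>_. (\<Prod>j\<in>Basis. \<bar>c j\<bar>))"
    using lborel_affine_euclidean[of c 0] unfolding act by simp
  have detc: "(\<Prod>j\<in>Basis. \<bar>c j\<bar>) = \<bar>det A\<bar>"
    by (simp add: prod_Basis_cart c det abs_prod)
  show "emeasure lborel E = ennreal \<bar>det A\<bar> * emeasure lborel ((\<lambda>x. A *v x) -` E)"
    using E by (subst eq) (simp add: emeasure_density_const emeasure_distr detc)
qed

lemma scales_lborel_swap:
  fixes m n :: "'n::finite"
  shows "scales_lborel (\<chi> i j. mat 1 $ i $ Transposition.transpose m n j)"
    (is "scales_lborel ?A")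
  unfolding scales_lborel_def
proof
  fix E :: "(real ^ 'n) set" assume E: "E \<in> sets borel"
  let ?t = "Transposition.transpose m n"
  have act: "?A *v x = (\<chi> i. x $ ?t i)" for x :: "real ^ 'n"
  proof -
    have "(\<Sum>j\<in>UNIV. (if i = ?t j then 1 else 0) * x $ j) = x $ ?t i" for i
    proof -
      have "i = ?t j \<longleftrightarrow> j = ?t i" for j by (metis transpose_involutory)
      then show ?thesis by (simp add: if_distrib[of "\<lambda>y. y * _"] sum.delta cong: if_cong)
    qed
    then show ?thesis by (simp add: matrix_vector_mult_def mat_def)
  qed
  have det: "\<bar>det ?A\<bar> = 1"
    by (subst det_permute_columns) (auto simp: permutes_swap_id sign_swap_id abs_mult)
  have "lborel = distr lborel borel (\<lambda>x. ?A *v x)"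
  proof (rule lborel_eqI)
    fix l u :: "real ^ 'n" assume lu: "\<And>b. b \<in> Basis \<Longrightarrow> l \<bullet> b \<le> u \<bullet> b"
    have le: "l $ i \<le> u $ i" for i
      using lu[of "axis i 1"] by (simp add: inner_axis)
    have box: "(\<lambda>x. ?A *v x) -` box l u = box (?A *v l) (?A *v u)"
      unfolding act
      by (auto simp: mem_box_cart) (metis transpose_involutory)+
    have "emeasure (distr lborel borel (\<lambda>x. ?A *v x)) (box l u) = emeasure lborel (box (?A *v l) (?A *v u))"
      by (subst emeasure_distr) (auto simp: box)
    also have "\<dots> = (\<Prod>b\<in>Basis. (?A *v u - ?A *v l) \<bullet> b)"
      by (rule emeasure_lborel_box)
        (auto simp: act Basis_vec_def inner_axis le)
    also have "(\<Prod>b\<in>Basis. (?A *v u - ?A *v l) \<bullet> b) = (\<Prod>i\<in>UNIV. (u - l) $ ?t i)"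
      by (simp add: prod_Basis_cart inner_axis act)
    also have "\<dots> = (\<Prod>i\<in>UNIV. (u - l) $ i)"
      using prod.permute[OF permutes_swap_id[of m UNIV n], of "\<lambda>i. (u - l) $ i"] by (simp add: o_def)
    also have "\<dots> = (\<Prod>b\<in>Basis. (u - l) \<bullet> b)"
      by (simp add: prod_Basis_cart inner_axis)
    finally show "emeasure (distr lborel borel (\<lambda>x. ?A *v x)) (box l u) = (\<Prod>b\<in>Basis. (u - l) \<bullet> b)" .
  qed simp
  then have "emeasure lborel E = emeasure (distr lborel borel (\<lambda>x. ?A *v x)) E" by simp
  then show "emeasure lborel E = ennreal \<bar>det ?A\<bar> * emeasure lborel ((\<lambda>x. ?A *v x) -` E)"
    using E by (simp add: emeasure_distr det)
qed

text \<open>Fubini: in the direction of the changed coordinate a shear acts as a translation.\<close>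

lemma scales_lborel_shear:
  fixes m n :: "'n::finite"
  assumes "m \<noteq> n"
  shows "scales_lborel (\<chi> i j. if i = m \<and> j = n then c else of_bool (i = j))"
    (is "scales_lborel ?A")
  unfolding scales_lborel_def
proof
  fix E :: "(real ^ 'n) set" assume E: "E \<in> sets borel"
  have "?A = (\<chi> k. if k = m then row m (mat 1) + c *s row n (mat 1) else row k (mat 1))"
    using assms by (auto simp: vec_eq_iff row_def mat_def)
  then have det: "det ?A = 1" by (simp only: det_row_operation[OF assms]) simp
  have act: "?A *v x = x + (c * x $ n) *\<^sub>R axis m 1" for x
  proof -
    have "(\<Sum>j\<in>UNIV. (if i = m \<and> j = n then c else of_bool (i = j)) * x $ j) =
        x $ i + (if i = m then c * x $ n else 0)" for i
    proof -
      have "(\<Sum>j\<in>UNIV. (if i = m \<and> j = n then c else of_bool (i = j)) * x $ j) =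
          (\<Sum>j\<in>UNIV. (if j = i then x $ j else 0) + (if j = n then (if i = m then c * x $ j else 0) else 0))"
        using assms by (intro sum.cong) auto
      then show ?thesis by (simp add: sum.distrib)
    qed
    then show ?thesis by (auto simp: matrix_vector_mult_def vec_eq_iff axis_def)
  qed
  interpret product_sigma_finite "\<lambda>_::real ^ 'n. lborel :: real measure" by standard
  define V where "V g = (\<Sum>b\<in>Basis. g b *\<^sub>R b)" for g :: "real ^ 'n \<Rightarrow> real"
  let ?M = "\<lambda>I. \<Pi>\<^sub>M b\<in>I. (lborel :: real measure)"
  define b0 where "b0 = (axis m 1 :: real ^ 'n)"
  define b1 where "b1 = (axis n 1 :: real ^ 'n)"
  have b: "b0 \<in> Basis" "b1 \<in> Basis" "b0 \<noteq> b1"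
    using assms by (auto simp: b0_def b1_def axis_in_Basis_iff axis_eq_axis)
  have Basis_eq: "Basis = insert b0 (Basis - {b0})" using b(1) by auto
  have upd: "V (g(b0 := y)) = V g + (y - g b0) *\<^sub>R b0" for g y
    unfolding V_def by (simp add: sum.remove[OF finite_Basis b(1)] algebra_simps)
  have actV: "?A *v V (g(b0 := y)) = V (g(b0 := c * g b1 + 1 * y))" for g y
  proof -
    have "V (g(b0 := y)) $ n = V (g(b0 := y)) \<bullet> b1" by (simp add: b1_def inner_axis)
    also have "\<dots> = g b1"
      using b unfolding V_def by (simp del: fun_upd_apply) simp
    finally show ?thesis
      unfolding act b0_def[symmetric] by (simp add: upd algebra_simps)
  qed
  have Vm [measurable]: "V \<in> ?M Basis \<rightarrow>\<^sub>M borel" unfolding V_def by measurable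
  have lb: "lborel = distr (?M Basis) borel V"
    unfolding V_def by (rule lborel_eq)
  have mE: "(\<lambda>x. indicator E (?A *v x) :: ennreal) \<in> borel_measurable borel" using E by measurable
  have mE': "(\<lambda>x. indicator E x :: ennreal) \<in> borel_measurable borel" using E by measurable
  have "emeasure lborel ((\<lambda>x. ?A *v x) -` E) = (\<integral>\<^sup>+x. indicator E (?A *v x) \<partial>lborel)"
  proof -
    have "(\<lambda>x. indicator E (?A *v x) :: ennreal) = indicator ((\<lambda>x. ?A *v x) -` E)"
      by (auto split: split_indicator)
    then show ?thesis
      using measurable_sets[OF borel_measurable_matrix_vector_mult E, of ?A] by simp
  qed
  also have "\<dots> = (\<integral>\<^sup>+g. indicator E (?A *v V g) \<partial>?M Basis)"
    by (subst lb) (use mE in \<open>simp add: nn_integral_distr\<close>)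
  also have "\<dots> = (\<integral>\<^sup>+g. (\<integral>\<^sup>+y. indicator E (?A *v V (g(b0 := y))) \<partial>lborel) \<partial>?M (Basis - {b0}))"
    by (subst Basis_eq, subst product_nn_integral_insert)
      (use measurable_compose[OF Vm mE] Basis_eq in \<open>auto simp: insert_absorb b\<close>)
  also have "\<dots> = (\<integral>\<^sup>+g. (\<integral>\<^sup>+y. indicator E (V (g(b0 := y))) \<partial>lborel) \<partial>?M (Basis - {b0}))"
  proof (rule nn_integral_cong)
    fix g assume g: "g \<in> space (?M (Basis - {b0}))"
    have "(\<lambda>y. V (g(b0 := y))) \<in> borel_measurable borel"
      unfolding upd by measurable
    then have "(\<lambda>y. indicator E (V (g(b0 := y))) :: ennreal) \<in> borel_measurable borel"
      using mE' by (rule measurable_compose)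
    from nn_integral_real_affine[OF this, of 1 "c * g b1"]
    show "(\<integral>\<^sup>+y. indicator E (?A *v V (g(b0 := y))) \<partial>lborel) = (\<integral>\<^sup>+y. indicator E (V (g(b0 := y))) \<partial>lborel)"
      by (simp only: actV) simp
  qed
  also have "\<dots> = (\<integral>\<^sup>+g. indicator E (V g) \<partial>?M Basis)"
    by (subst (2) Basis_eq, subst product_nn_integral_insert)
      (use measurable_compose[OF Vm mE'] Basis_eq in \<open>auto simp: insert_absorb b\<close>)
  also have "\<dots> = (\<integral>\<^sup>+x. indicator E x \<partial>lborel)"
    by (subst lb) (use mE' in \<open>simp add: nn_integral_distr\<close>)
  finally show "emeasure lborel E = ennreal \<bar>det ?A\<bar> * emeasure lborel ((\<lambda>x. ?A *v x) -` E)"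
    using E by (simp add: det)
qed

lemma lborel_linear_image:
  fixes A :: "real ^ 'n ^ 'n"
  assumes "det A \<noteq> 0"
  shows "lborel = density (distr lborel borel (\<lambda>x. A *v x)) (\<lambda>_. ennreal \<bar>det A\<bar>)"
proof -
  have "det A \<noteq> 0 \<longrightarrow> scales_lborel A"
  proof (rule induct_matrix_elementary)
    fix A B :: "real ^ 'n ^ 'n"
    assume "det A \<noteq> 0 \<longrightarrow> scales_lborel A" "det B \<noteq> 0 \<longrightarrow> scales_lborel B"
    then show "det (A ** B) \<noteq> 0 \<longrightarrow> scales_lborel (A ** B)"
      by (auto simp: det_mul intro: scales_lborel_mult)
  qed (auto intro: scales_lborel_diagonal scales_lborel_swap scales_lborel_shear det_zero_row)
  with assms have "scales_lborel A" by simp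
  then show ?thesis
    by (intro measure_eqI) (auto simp: emeasure_density_const emeasure_distr scales_lborel_def)
qed

text \<open>Take a set of maximal size that is orthonormal for the form \<open>x \<bullet> (T *v y)\<close>. It is
  linearly independent, and if it did not span, a Gram-Schmidt step would enlarge it. The columns
  of \<open>A\<close> are its elements.\<close>

lemma orthonormal_basis_of_form:
  fixes T :: "real ^ 'n ^ 'n"
  assumes T: "pos_def_matrix T"
  obtains A :: "real ^ 'n ^ 'n" where "transpose A ** T ** A = mat 1"
proof -
  have sym: "x \<bullet> (T *v y) = y \<bullet> (T *v x)" for x y
  proof -
    have "x v* T = T *v x"
      using T transpose_matrix_vector[of T x] by (simp add: pos_def_matrix_def)
    then show ?thesis using dot_lmul_matrix[of x T y] by (simp add: inner_commute)
  qed
  have pos: "0 < x \<bullet> (T *v x)" if "x \<noteq> 0" for x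
    using T that by (auto simp: pos_def_matrix_def)
  define on where "on B \<longleftrightarrow> (\<forall>x\<in>B. \<forall>y\<in>B. x \<bullet> (T *v y) = of_bool (x = y))" for B :: "(real ^ 'n) set"
  have sumT: "y \<bullet> (T *v (\<Sum>b\<in>C. r b *\<^sub>R b)) = (\<Sum>b\<in>C. r b * (y \<bullet> (T *v b)))" for y r and C :: "(real ^ 'n) set"
    by (simp add: linear_sum[OF matrix_vector_mul_linear] matrix_vector_mult_scaleR inner_sum_right)
  have coeff: "b \<bullet> (T *v (\<Sum>b\<in>C. r b *\<^sub>R b)) = r b" if "on B" "finite C" "C \<subseteq> B" "b \<in> C" for b B C r
  proof -
    have "(\<Sum>b'\<in>C. r b' * (b \<bullet> (T *v b'))) = (\<Sum>b'\<in>C. if b = b' then r b' else 0)"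
      using that by (intro sum.cong) (auto simp: on_def subset_eq)
    then show ?thesis using that by (simp add: sumT)
  qed
  have indep: "independent B" if "on B" for B
  proof
    assume "dependent B"
    then obtain C r b where C: "finite C" "C \<subseteq> B" "b \<in> C" "r b \<noteq> 0" "(\<Sum>b\<in>C. r b *\<^sub>R b) = 0"
      unfolding dependent_explicit by blast
    have "b \<bullet> (T *v 0) = r b" using coeff[OF that C(1-3), of r] unfolding C(5) .
    then show False using C(4) by simp
  qed
  have card_le: "finite B \<and> card B \<le> CARD('n)" if "on B" for B
    using independent_bound[OF indep[OF that]] by simp
  have "\<exists>B. on B \<and> (\<forall>B'. on B' \<longrightarrow> card B' \<le> card B)"
  proof -
    have "on {}" by (simp add: on_def)
    then show ?thesis
      using ex_has_greatest_nat[of on "{}" card "Suc CARD('n)"] card_le by (simp add: less_Suc_eq_le)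
  qed
  then obtain B where B: "on B" and max: "\<And>B'. on B' \<Longrightarrow> card B' \<le> card B" by blast
  have fin: "finite B" using card_le[OF B] by simp
  have "span B = UNIV"
  proof (rule ccontr)
    assume "span B \<noteq> UNIV"
    then obtain x where x: "x \<notin> span B" by auto
    define y where "y = x - (\<Sum>b\<in>B. (b \<bullet> (T *v x)) *\<^sub>R b)"
    have sp: "(\<Sum>b\<in>B. (b \<bullet> (T *v x)) *\<^sub>R b) \<in> span B"
      by (intro span_sum span_scale span_base)
    have y_span: "y \<notin> span B"
      using x span_add[OF _ sp, of y] by (auto simp: y_def)
    then have "y \<noteq> 0" using span_zero by auto
    have by0: "b \<bullet> (T *v y) = 0" if "b \<in> B" for b
      using coeff[OF B fin _ that] by (simp add: y_def matrix_vector_mult_diff_distrib inner_diff_right)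
    define z where "z = (1 / sqrt (y \<bullet> (T *v y))) *\<^sub>R y"
    have zz: "z \<bullet> (T *v z) = 1"
      using pos[OF \<open>y \<noteq> 0\<close>] by (simp add: z_def matrix_vector_mult_scaleR)
    have z1: "b \<bullet> (T *v z) = 0" if "b \<in> B" for b
      using by0[OF that] by (simp add: z_def matrix_vector_mult_scaleR)
    have z2: "z \<bullet> (T *v b) = 0" if "b \<in> B" for b
      using z1[OF that] sym[of z b] by simp
    have zB: "z \<notin> B" using z1[of z] zz by auto
    have "on (insert z B)"
      unfolding on_def
    proof (intro ballI)
      fix x y assume "x \<in> insert z B" "y \<in> insert z B"
      then consider "x = z" "y = z" | "x = z" "y \<in> B" | "x \<in> B" "y = z" | "x \<in> B" "y \<in> B" by blast
      then show "x \<bullet> (T *v y) = of_bool (x = y)"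
      proof cases
        case 1 then show ?thesis using zz by simp
      next
        case 2 then have "x \<noteq> y" using zB by auto
        then show ?thesis using 2 z2 by simp
      next
        case 3 then have "x \<noteq> y" using zB by auto
        then show ?thesis using 3 z1 by simp
      next
        case 4 then show ?thesis using B unfolding on_def by blast
      qed
    qed
    then show False using max[of "insert z B"] zB fin by simp
  qed
  then have "card B = CARD('n)"
    using dim_eq_card_independent[OF indep[OF B]] dim_span[of B] by (simp add: dim_UNIV)
  then obtain f :: "'n \<Rightarrow> real ^ 'n" where f: "bij_betw f UNIV B"
    using finite_same_card_bij[of "UNIV :: 'n set" B] fin by auto
  define A :: "real ^ 'n ^ 'n" where "A = (\<chi> i j. f j $ i)"
  have "(transpose A ** (T ** A)) $ i $ j = f i \<bullet> (T *v f j)" for i j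
    by (simp add: A_def matrix_matrix_mult_def transpose_def inner_vec_def matrix_vector_mult_def)
  moreover have "f i \<bullet> (T *v f j) = of_bool (i = j)" for i j
  proof -
    have "f i \<in> B" "f j \<in> B" "f i = f j \<longleftrightarrow> i = j"
      using f by (auto simp: bij_betw_def inj_eq)
    then show ?thesis using B unfolding on_def by simp
  qed
  ultimately have "transpose A ** (T ** A) = mat 1"
    by (simp add: vec_eq_iff mat_def)
  then have "transpose A ** T ** A = mat 1"
    by (simp only: matrix_mul_assoc)
  then show ?thesis by (rule that)
qed

lemma pos_def_matrix_inv:
  fixes S :: "real ^ 'n ^ 'n"
  assumes S: "pos_def_matrix S"
  shows "S ** matrix_inv S = mat 1" "matrix_inv S ** S = mat 1" "pos_def_matrix (matrix_inv S)"
proof -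
  have "x = 0" if "S *v x = 0" for x
  proof -
    have "\<not> 0 < x \<bullet> (S *v x)" using that by simp
    then show ?thesis using S unfolding pos_def_matrix_def by blast
  qed
  then obtain S' where "S' ** S = mat 1"
    using matrix_left_invertible_ker[of S] by auto
  moreover from this have "S ** S' = mat 1"
    by (rule matrix_left_right_inverse[THEN iffD1])
  ultimately have "S ** S' = mat 1 \<and> S' ** S = mat 1" by simp
  then have inv: "S ** matrix_inv S = mat 1 \<and> matrix_inv S ** S = mat 1"
    unfolding matrix_inv_def by (rule someI)
  then show 1: "S ** matrix_inv S = mat 1" "matrix_inv S ** S = mat 1" by auto
  have symS: "transpose S = S" using S by (simp add: pos_def_matrix_def)
  have tr: "transpose (matrix_inv S) ** S = mat 1"
    using arg_cong[OF 1(1), of transpose] unfolding matrix_transpose_mul symS transpose_mat .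
  have "transpose (matrix_inv S) = transpose (matrix_inv S) ** (S ** matrix_inv S)"
    unfolding 1(1) matrix_mul_rid ..
  also have "\<dots> = matrix_inv S"
    unfolding matrix_mul_assoc tr matrix_mul_lid ..
  finally have sym: "transpose (matrix_inv S) = matrix_inv S" .
  have "0 < x \<bullet> (matrix_inv S *v x)" if "x \<noteq> 0" for x
  proof -
    define y where "y = matrix_inv S *v x"
    have Sy: "S *v y = x" unfolding y_def matrix_vector_mul_assoc 1(1) by simp
    have "y \<noteq> 0" using that Sy by auto
    then have "0 < y \<bullet> (S *v y)" using S unfolding pos_def_matrix_def by blast
    then show ?thesis unfolding Sy y_def[symmetric] by (simp only: inner_commute)
  qed
  then show "pos_def_matrix (matrix_inv S)" using sym unfolding pos_def_matrix_def by blast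
qed

text \<open>The factorisation \<open>S = A A\<^sup>T\<close> comes from an orthonormal basis of the quadratic form of the
  inverse of \<open>S\<close>, so that the substitution \<open>x = A y\<close> turns the exponent of the density into
  \<open>- \<bar>y\<bar>\<^sup>2 / 2\<close>.\<close>

lemma pos_def_matrix_factor:
  fixes S :: "real ^ 'n ^ 'n"
  assumes S: "pos_def_matrix S"
  obtains A :: "real ^ 'n ^ 'n" where "\<And>y. (A *v y) \<bullet> (matrix_inv S *v (A *v y)) = (norm y)\<^sup>2"
    "\<And>u. u \<bullet> (S *v u) = (norm (transpose A *v u))\<^sup>2" "det S = (det A)\<^sup>2" "det A \<noteq> 0"
proof -
  define T where "T = matrix_inv S"
  have ST: "S ** T = mat 1" "T ** S = mat 1" and T: "pos_def_matrix T"
    using pos_def_matrix_inv[OF S] by (auto simp: T_def)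
  obtain A :: "real ^ 'n ^ 'n" where A: "transpose A ** T ** A = mat 1"
    by (rule orthonormal_basis_of_form[OF T])
  have A': "A ** (transpose A ** T) = mat 1"
    using matrix_left_right_inverse[of "transpose A ** T" A] A by (rule iffD1)
  have "A ** transpose A = A ** transpose A ** (T ** S)" unfolding ST matrix_mul_rid ..
  also have "\<dots> = A ** (transpose A ** T) ** S" unfolding matrix_mul_assoc ..
  finally have S_eq: "A ** transpose A = S" unfolding A' matrix_mul_lid .
  have adj: "(B *v x) \<bullet> y = x \<bullet> (transpose B *v y)" for B :: "real ^ 'n ^ 'n" and x y
    using dot_lmul_matrix[of y B x] by (simp add: inner_commute)
  have "(A *v y) \<bullet> (T *v (A *v y)) = (norm y)\<^sup>2" for y
    by (simp add: adj matrix_vector_mul_assoc matrix_mul_assoc A power2_norm_eq_inner)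
  moreover have "u \<bullet> (S *v u) = (norm (transpose A *v u))\<^sup>2" for u
  proof -
    have "u \<bullet> (S *v u) = (A *v (transpose A *v u)) \<bullet> u"
      unfolding S_eq[symmetric] matrix_vector_mul_assoc[symmetric] by (rule inner_commute)
    also have "\<dots> = (transpose A *v u) \<bullet> (transpose A *v u)" by (rule adj)
    finally show ?thesis unfolding power2_norm_eq_inner .
  qed
  moreover have "det S = (det A)\<^sup>2"
    by (simp add: S_eq[symmetric] det_mul det_transpose power2_eq_square)
  moreover have "det A \<noteq> 0"
    using arg_cong[OF A, of det] by (auto simp: det_mul)
  ultimately show ?thesis using that[of A] by (simp add: T_def)
qed

lemma sum_Basis_power2: "(\<Sum>b\<in>Basis. (y \<bullet> b)\<^sup>2) = (norm y)\<^sup>2"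
  unfolding power2_norm_eq_inner by (subst euclidean_inner[of y y]) (simp add: power2_eq_square)

text \<open>The density and the complex wave both factor over the coordinates, so Fubini reduces the
  integral to the characteristic function of the standard normal law on the line.\<close>

lemma integral_std_normal_wave:
  fixes v :: "'a::euclidean_space"
  shows "(\<integral>y. exp (- (norm y)\<^sup>2 / 2) / sqrt ((2 * pi) ^ DIM('a)) * cos (v \<bullet> y + c) \<partial>lborel) =
    cos c * exp (- (norm v)\<^sup>2 / 2)"
proof -
  interpret product_sigma_finite "\<lambda>_::'a. lborel :: real measure" by standard
  let ?\<phi> = "std_normal_density"
  define F where "F b x = complex_of_real (?\<phi> x) * iexp ((v \<bullet> b) * x)" for b :: 'a and x
  have F_int: "integrable lborel (F b)" for b
  proof -
    have "norm (F b x) = norm (?\<phi> x)" for x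
      by (simp add: F_def norm_mult)
    moreover have "F b \<in> borel_measurable lborel" unfolding F_def by measurable
    moreover have "integrable lborel ?\<phi>" by (rule integrable_normal_density) simp
    ultimately show ?thesis
      by (intro Bochner_Integration.integrable_bound[of lborel "?\<phi>" "F b"]) simp_all
  qed
  have F_val: "integral\<^sup>L lborel (F b) = exp (- (v \<bullet> b)\<^sup>2 / 2)" for b
  proof -
    have "integral\<^sup>L lborel (F b) = char std_normal_distribution (v \<bullet> b)"
      unfolding char_def F_def
      by (subst integral_density) (auto simp: scaleR_conv_of_real)
    then show ?thesis by (simp add: char_std_normal_distribution)
  qed
  define G where "G y = (\<Prod>b\<in>Basis. F b (y \<bullet> b))" for y :: 'a
  have G_eq: "G y = complex_of_real (exp (- (norm y)\<^sup>2 / 2) / sqrt ((2 * pi) ^ DIM('a))) * iexp (v \<bullet> y)" for y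
  proof -
    have "(\<Prod>b\<in>Basis. ?\<phi> (y \<bullet> b)) = exp (\<Sum>b\<in>Basis. - (y \<bullet> b)\<^sup>2 / 2) / sqrt ((2 * pi) ^ DIM('a))"
      by (simp add: normal_density_def prod_dividef prod.distrib exp_sum real_sqrt_power real_sqrt_mult power_mult_distrib)
    also have "(\<Sum>b\<in>Basis. - (y \<bullet> b)\<^sup>2 / 2) = - (norm y)\<^sup>2 / 2"
      by (simp add: sum_negf sum_divide_distrib[symmetric] sum_Basis_power2)
    moreover have "(\<Prod>b\<in>Basis. iexp ((v \<bullet> b) * (y \<bullet> b))) = iexp (v \<bullet> y)"
      by (simp add: exp_sum[symmetric] sum_distrib_left[symmetric] euclidean_inner[of v y] of_real_sum[symmetric])
    ultimately show ?thesis
      by (simp add: G_def F_def prod.distrib of_real_prod[symmetric])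
  qed
  have eqPi: "(\<lambda>g. G (\<Sum>b\<in>Basis. g b *\<^sub>R b)) = (\<lambda>g. \<Prod>b\<in>Basis. F b (g b))"
    by (simp add: G_def)
  have Gm: "G \<in> borel_measurable borel" unfolding G_def F_def by measurable
  have G_int: "integrable lborel G"
    by (subst lborel_eq, subst integrable_distr_eq)
      (use Gm F_int in \<open>auto simp: eqPi intro!: product_integrable_prod\<close>)
  have "integral\<^sup>L lborel G = (\<Prod>b\<in>Basis. integral\<^sup>L lborel (F b))"
    by (subst lborel_eq, subst integral_distr)
      (use Gm F_int in \<open>auto simp: eqPi product_integral_prod\<close>)
  also have "\<dots> = complex_of_real (\<Prod>b\<in>Basis. exp (- (v \<bullet> b)\<^sup>2 / 2))"
    by (simp add: F_val)
  also have "(\<Prod>b\<in>Basis. exp (- (v \<bullet> b)\<^sup>2 / 2)) = exp (- (norm v)\<^sup>2 / 2)"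
    by (simp add: exp_sum[symmetric] sum_negf sum_divide_distrib[symmetric] sum_Basis_power2)
  finally have G_val: "integral\<^sup>L lborel G = exp (- (norm v)\<^sup>2 / 2)" .
  have "exp (- (norm y)\<^sup>2 / 2) / sqrt ((2 * pi) ^ DIM('a)) * cos (v \<bullet> y + c) = Re (iexp c * G y)" for y
    by (simp add: G_eq cos_add Re_exp Im_exp algebra_simps)
  then have "(\<integral>y. exp (- (norm y)\<^sup>2 / 2) / sqrt ((2 * pi) ^ DIM('a)) * cos (v \<bullet> y + c) \<partial>lborel) =
      (\<integral>y. Re (iexp c * G y) \<partial>lborel)" by simp
  also have "\<dots> = Re (\<integral>y. iexp c * G y \<partial>lborel)"
    using G_int by (intro integral_Re) simp
  also have "(\<integral>y. iexp c * G y \<partial>lborel) = iexp c * exp (- (norm v)\<^sup>2 / 2)"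
    using G_int by (simp add: G_val)
  finally show ?thesis by (simp add: Re_exp)
qed

theorem multivariate_normal_wave:
  fixes S :: "real ^ 'n ^ 'n"
  assumes S: "pos_def_matrix S"
  shows "(\<integral>x. cos (u \<bullet> x + c) \<partial>multivariate_normal 0 S) = cos c * exp (- (u \<bullet> (S *v u)) / 2)"
proof -
  obtain A where A: "\<And>y. (A *v y) \<bullet> (matrix_inv S *v (A *v y)) = (norm y)\<^sup>2"
    "\<And>u. u \<bullet> (S *v u) = (norm (transpose A *v u))\<^sup>2" "det S = (det A)\<^sup>2" "det A \<noteq> 0"
    using pos_def_matrix_factor[OF S] by blast
  define d where "d x = exp (- (x \<bullet> (matrix_inv S *v x)) / 2) / sqrt ((2 * pi) ^ CARD('n) * det S)"
    for x :: "real ^ 'n"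
  have [measurable]: "d \<in> borel_measurable borel" unfolding d_def by measurable
  have d_nonneg: "0 \<le> d x" for x by (simp add: d_def A(3))
  have "(\<integral>x. cos (u \<bullet> x + c) \<partial>multivariate_normal 0 S) = (\<integral>x. d x * cos (u \<bullet> x + c) \<partial>lborel)"
    unfolding multivariate_normal_def diff_zero d_def[symmetric]
    by (subst integral_density) (auto simp: d_nonneg)
  also have "\<dots> = (\<integral>x. d x * cos (u \<bullet> x + c)
      \<partial>density (distr lborel borel (\<lambda>x. A *v x)) (\<lambda>_. ennreal \<bar>det A\<bar>))"
    using lborel_linear_image[OF A(4)] by simp
  also have "\<dots> = (\<integral>y. \<bar>det A\<bar> * (d (A *v y) * cos (u \<bullet> (A *v y) + c)) \<partial>lborel)"
    by (subst integral_density) (auto simp: integral_distr)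
  also have "\<dots> = (\<integral>y. exp (- (norm y)\<^sup>2 / 2) / sqrt ((2 * pi) ^ DIM(real ^ 'n)) *
      cos ((transpose A *v u) \<bullet> y + c) \<partial>lborel)"
  proof (rule Bochner_Integration.integral_cong)
    fix y
    have "u \<bullet> (A *v y) = (transpose A *v u) \<bullet> y"
      using dot_lmul_matrix[of u A y] by simp
    moreover have "sqrt ((2 * pi) ^ CARD('n) * det S) = sqrt ((2 * pi) ^ CARD('n)) * \<bar>det A\<bar>"
      by (simp add: A(3) real_sqrt_mult)
    ultimately show "\<bar>det A\<bar> * (d (A *v y) * cos (u \<bullet> (A *v y) + c)) =
        exp (- (norm y)\<^sup>2 / 2) / sqrt ((2 * pi) ^ DIM(real ^ 'n)) * cos ((transpose A *v u) \<bullet> y + c)"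
      using A(4) by (simp add: d_def A(1))
  qed simp
  also have "\<dots> = cos c * exp (- (u \<bullet> (S *v u)) / 2)"
    by (simp only: integral_std_normal_wave A(2))
  finally show ?thesis .
qed

lemma prob_space_multivariate_normal:
  assumes "pos_def_matrix S"
  shows "prob_space (multivariate_normal 0 S)"
proof -
  let ?\<nu> = "multivariate_normal 0 S"
  have 1: "(\<integral>x. (1::real) \<partial>?\<nu>) = 1"
    using multivariate_normal_wave[OF assms, of 0 0] by simp
  then have "integrable ?\<nu> (\<lambda>_. 1::real)"
    using not_integrable_integral_eq by fastforce
  then have "finite_measure ?\<nu>"
    by (intro finite_measureI) (auto simp: integrable_iff_bounded)
  then interpret finite_measure ?\<nu> .
  show ?thesis
    using 1 by (intro prob_spaceI) (simp add: emeasure_eq_measure)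
qed

section \<open>Centered Gaussian families\<close>

lemma integral_normal_law:
  fixes f :: "real \<Rightarrow> 'b::{banach, second_countable_topology}"
  assumes "0 \<le> \<sigma>" and [measurable]: "f \<in> borel_measurable borel"
  shows "integral\<^sup>L (normal_law m \<sigma>) f =
    (if \<sigma> = 0 then f m else (\<integral>x. normal_density m \<sigma> x *\<^sub>R f x \<partial>lborel))"
  using assms(1) by (auto simp: normal_law_def integral_return integral_density)

text \<open>Even central moments of a Gaussian variable are multiples of powers of its variance. This
  is what makes moments of arbitrarily high order available for chaining.\<close>

lemma gaussian_rv_even_power:
  assumes "gaussian_rv P Y"
  obtains m where "integrable P (\<lambda>\<omega>. (Y \<omega> - m) ^ (2 * k))"
    "(\<integral>\<omega>. Y \<omega> \<partial>P) = m"
    "(\<integral>\<omega>. (Y \<omega> - m) ^ (2 * k) \<partial>P) =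
      fact (2 * k) / (2 ^ k * fact k) * (\<integral>\<omega>. (Y \<omega> - m)\<^sup>2 \<partial>P) ^ k"
proof -
  obtain m \<sigma> where Y[measurable]: "Y \<in> borel_measurable P" and \<sigma>: "0 \<le> \<sigma>"
    and d: "distr P borel Y = normal_law m \<sigma>"
    using assms by (auto simp: gaussian_rv_def)
  have int: "(\<integral>\<omega>. f (Y \<omega>) \<partial>P) =
      (if \<sigma> = 0 then f m else (\<integral>x. normal_density m \<sigma> x * f x \<partial>lborel))"
    if [measurable]: "f \<in> borel_measurable borel" for f :: "real \<Rightarrow> real"
    using integral_distr[OF Y, of f] integral_normal_law[OF \<sigma>, of f m]
    by (cases "\<sigma> = 0") (simp_all add: d)
  have mom: "(\<integral>\<omega>. (Y \<omega> - m) ^ (2 * k) \<partial>P) = fact (2 * k) / (2 ^ k * fact k) * (\<sigma>\<^sup>2) ^ k" for k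
  proof (cases "\<sigma> = 0")
    case True
    then show ?thesis using int[of "\<lambda>x. (x - m) ^ (2 * k)"] by (cases k) auto
  next
    case False
    then have "0 < \<sigma>" using \<sigma> by simp
    show ?thesis
      using int[of "\<lambda>x. (x - m) ^ (2 * k)"] integral_normal_moment_even[OF \<open>0 < \<sigma>\<close>, of m k] False
      by (simp add: power_divide field_simps)
  qed
  have 2: "(\<integral>\<omega>. (Y \<omega> - m)\<^sup>2 \<partial>P) = \<sigma>\<^sup>2" using mom[of 1] by (simp add: fact_numeral)
  have 3: "(\<integral>\<omega>. Y \<omega> \<partial>P) = m"
    using int[of "\<lambda>x. x"] integral_normal_moment_nz_1[of \<sigma> m] \<sigma> by (cases "\<sigma> = 0") auto
  have 4: "integrable P (\<lambda>\<omega>. (Y \<omega> - m) ^ (2 * k))"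
  proof -
    have "integrable (normal_law m \<sigma>) (\<lambda>x. (x - m) ^ (2 * k))"
    proof (cases "\<sigma> = 0")
      case True
      then show ?thesis
        by (auto simp: normal_law_def integrable_iff_bounded nn_integral_return)
    next
      case False
      then show ?thesis
        using \<sigma> integrable_normal_moment[of \<sigma> m "2 * k"]
        by (auto simp: normal_law_def integrable_density)
    qed
    then show ?thesis using integrable_distr_eq[OF Y, of "\<lambda>x. (x - m) ^ (2 * k)"] by (simp add: d)
  qed
  show ?thesis using that[OF 4 3] mom[of k] 2 by simp
qed

lemma gaussian_rv_wave:
  assumes "gaussian_rv P Y" "(\<integral>\<omega>. Y \<omega> \<partial>P) = 0"
  shows "(\<integral>\<omega>. cos (Y \<omega> + c) \<partial>P) = cos c * exp (- (\<integral>\<omega>. (Y \<omega>)\<^sup>2 \<partial>P) / 2)"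
proof -
  obtain m \<sigma> where Y[measurable]: "Y \<in> borel_measurable P" and \<sigma>: "0 \<le> \<sigma>"
    and d: "distr P borel Y = normal_law m \<sigma>"
    using assms by (auto simp: gaussian_rv_def)
  have int: "(\<integral>\<omega>. f (Y \<omega>) \<partial>P) =
      (if \<sigma> = 0 then f m else (\<integral>x. normal_density m \<sigma> x * f x \<partial>lborel))"
    if [measurable]: "f \<in> borel_measurable borel" for f :: "real \<Rightarrow> real"
    using integral_distr[OF Y, of f] integral_normal_law[OF \<sigma>, of f m]
    by (cases "\<sigma> = 0") (simp_all add: d)
  have m: "m = 0"
    using int[of "\<lambda>x. x"] integral_normal_moment_nz_1[of \<sigma> m] \<sigma> assms(2) by (cases "\<sigma> = 0") auto
  show ?thesis
  proof (cases "\<sigma> = 0")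
    case True
    then show ?thesis using int[of "\<lambda>x. cos (x + c)"] int[of "\<lambda>x. x\<^sup>2"] by (simp add: m)
  next
    case False
    then have pos: "0 < \<sigma>" using \<sigma> by simp
    have sq: "(\<integral>\<omega>. (Y \<omega>)\<^sup>2 \<partial>P) = \<sigma>\<^sup>2"
      using int[of "\<lambda>x. x\<^sup>2"] integral_normal_moment_even[OF pos, of 0 1] False
      by (simp add: m fact_numeral)
    have I: "integrable lborel (\<lambda>y. std_normal_density y *\<^sub>R iexp (\<sigma> * y))"
    proof (rule Bochner_Integration.integrable_bound)
      show "integrable lborel std_normal_density" by (rule integrable_normal_density) simp
    qed (auto)
    have ch: "(\<integral>y. std_normal_density y *\<^sub>R iexp (\<sigma> * y) \<partial>lborel) = exp (- \<sigma>\<^sup>2 / 2)"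
    proof -
      have "(\<integral>y. std_normal_density y *\<^sub>R iexp (\<sigma> * y) \<partial>lborel) = char std_normal_distribution \<sigma>"
        unfolding char_def by (subst integral_density) auto
      then show ?thesis by (simp add: char_std_normal_distribution)
    qed
    have "(\<integral>\<omega>. cos (Y \<omega> + c) \<partial>P) = (\<integral>x. normal_density 0 \<sigma> x * cos (x + c) \<partial>lborel)"
      using int[of "\<lambda>x. cos (x + c)"] False by (simp add: m)
    also have "\<dots> = (\<integral>y. \<sigma> * (normal_density 0 \<sigma> (\<sigma> * y) * cos (\<sigma> * y + c)) \<partial>lborel)"
      using lborel_integral_real_affine[of \<sigma> "\<lambda>x. normal_density 0 \<sigma> x * cos (x + c)" 0] pos by simp
    also have "\<dots> = (\<integral>y. Re (iexp c * (std_normal_density y *\<^sub>R iexp (\<sigma> * y))) \<partial>lborel)"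
    proof (rule Bochner_Integration.integral_cong)
      fix y
      have "\<sigma> * normal_density 0 \<sigma> (\<sigma> * y) = std_normal_density y"
        using pos by (simp add: normal_density_def real_sqrt_mult power_mult_distrib)
      then have "\<sigma> * (normal_density 0 \<sigma> (\<sigma> * y) * cos (\<sigma> * y + c)) = std_normal_density y * cos (\<sigma> * y + c)"
        by (simp only: mult.assoc[symmetric])
      also have "\<dots> = Re (iexp c * (std_normal_density y *\<^sub>R iexp (\<sigma> * y)))"
        by (simp add: cos_add Re_exp Im_exp algebra_simps)
      finally show "\<sigma> * (normal_density 0 \<sigma> (\<sigma> * y) * cos (\<sigma> * y + c)) =
        Re (iexp c * (std_normal_density y *\<^sub>R iexp (\<sigma> * y)))" .
    qed simp
    also have "\<dots> = Re (\<integral>y. iexp c * (std_normal_density y *\<^sub>R iexp (\<sigma> * y)) \<partial>lborel)"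
      using I by (intro integral_Re integrable_mult_right)
    also have "(\<integral>y. iexp c * (std_normal_density y *\<^sub>R iexp (\<sigma> * y)) \<partial>lborel) =
        iexp c * exp (- \<sigma>\<^sup>2 / 2)"
      by (simp only: Bochner_Integration.integral_mult_right_zero ch)
    finally show ?thesis by (simp add: sq Re_exp)
  qed
qed

definition gaussian_family :: "'w measure \<Rightarrow> 'i set \<Rightarrow> ('i \<Rightarrow> 'w \<Rightarrow> real) \<Rightarrow> bool" where
  "gaussian_family P I D \<longleftrightarrow> finite I \<and> (\<forall>c. gaussian_rv P (\<lambda>\<omega>. \<Sum>i\<in>I. c i * D i \<omega>)) \<and>
     (\<forall>i\<in>I. integral\<^sup>L P (D i) = 0)"

lemma gaussian_family_single:
  assumes "gaussian_family P I D" "i \<in> I"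
  shows "gaussian_rv P (D i)"
proof -
  have eq: "(\<lambda>\<omega>. \<Sum>j\<in>I. of_bool (j = i) * D j \<omega>) = D i"
    using assms
    by (simp add: gaussian_family_def of_bool_def if_distrib[of "\<lambda>x. x * _"] sum.delta cong: if_cong)
  have "\<forall>c. gaussian_rv P (\<lambda>\<omega>. \<Sum>j\<in>I. c j * D j \<omega>)"
    using assms by (simp add: gaussian_family_def)
  from spec[OF this, of "\<lambda>j. of_bool (j = i)"] show ?thesis unfolding eq .
qed

context
  fixes P :: "'w measure" and I :: "'i set" and D :: "'i \<Rightarrow> 'w \<Rightarrow> real"
  assumes P: "prob_space P" and G: "gaussian_family P I D"
begin

lemma gaussian_family_measurable: "i \<in> I \<Longrightarrow> D i \<in> borel_measurable P"
  using gaussian_family_single[OF G] by (auto simp: gaussian_rv_def)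

lemma gaussian_family_square_integrable:
  assumes "i \<in> I" shows "integrable P (\<lambda>\<omega>. (D i \<omega>)\<^sup>2)"
proof -
  obtain m where "integrable P (\<lambda>\<omega>. (D i \<omega> - m) ^ (2 * 1))" "(\<integral>\<omega>. D i \<omega> \<partial>P) = m"
    using gaussian_rv_even_power[OF gaussian_family_single[OF G assms], of 1] by metis
  then show ?thesis using G assms by (simp add: gaussian_family_def)
qed

lemma gaussian_family_mult_integrable:
  assumes "i \<in> I" "j \<in> I" shows "integrable P (\<lambda>\<omega>. D i \<omega> * D j \<omega>)"
proof (rule Bochner_Integration.integrable_bound)
  show "integrable P (\<lambda>\<omega>. (D i \<omega>)\<^sup>2 + (D j \<omega>)\<^sup>2)"
    using assms gaussian_family_square_integrable by auto
  show "(\<lambda>\<omega>. D i \<omega> * D j \<omega>) \<in> borel_measurable P"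
    using assms gaussian_family_measurable by auto
  have "\<bar>x * y\<bar> \<le> x\<^sup>2 + y\<^sup>2" for x y :: real
  proof -
    have "0 \<le> \<bar>x\<bar> * \<bar>y\<bar>" by simp
    then show ?thesis
      using sum_squares_bound[of "\<bar>x\<bar>" "\<bar>y\<bar>"] unfolding abs_mult power2_abs by linarith
  qed
  then show "AE \<omega> in P. norm (D i \<omega> * D j \<omega>) \<le> norm ((D i \<omega>)\<^sup>2 + (D j \<omega>)\<^sup>2)" by auto
qed

lemma gaussian_family_integrable:
  assumes "i \<in> I" shows "integrable P (D i)"
proof -
  interpret prob_space P by (rule P)
  show ?thesis
    by (rule square_integrable_imp_integrable[OF gaussian_family_measurable[OF assms]
          gaussian_family_square_integrable[OF assms]])
qed

lemma gaussian_family_mean: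
  "(\<integral>\<omega>. (\<Sum>i\<in>I. c i * D i \<omega>) \<partial>P) = 0"
  using G gaussian_family_integrable by (subst Bochner_Integration.integral_sum) (auto simp: gaussian_family_def)

lemma gaussian_family_covariance:
  "i \<in> I \<Longrightarrow> j \<in> I \<Longrightarrow> covariance P (D i) (D j) = (\<integral>\<omega>. D i \<omega> * D j \<omega> \<partial>P)"
  using G by (simp add: gaussian_family_def covariance_def)

lemma gaussian_family_variance:
  "(\<integral>\<omega>. (\<Sum>i\<in>I. c i * D i \<omega>)\<^sup>2 \<partial>P) = (\<Sum>i\<in>I. \<Sum>j\<in>I. c i * c j * covariance P (D i) (D j))"
proof -
  have "(\<integral>\<omega>. (\<Sum>i\<in>I. c i * D i \<omega>)\<^sup>2 \<partial>P) =
      (\<integral>\<omega>. (\<Sum>i\<in>I. \<Sum>j\<in>I. c i * c j * (D i \<omega> * D j \<omega>)) \<partial>P)"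
    by (simp add: power2_eq_square sum_product ac_simps)
  also have "\<dots> = (\<Sum>i\<in>I. \<Sum>j\<in>I. c i * c j * (\<integral>\<omega>. D i \<omega> * D j \<omega> \<partial>P))"
    by (simp add: gaussian_family_mult_integrable)
  finally show ?thesis by (simp add: gaussian_family_covariance)
qed

lemma gaussian_family_wave:
  "(\<integral>\<omega>. cos ((\<Sum>i\<in>I. c i * D i \<omega>) + r) \<partial>P) =
    cos r * exp (- (\<Sum>i\<in>I. \<Sum>j\<in>I. c i * c j * covariance P (D i) (D j)) / 2)"
  using gaussian_rv_wave[of P "\<lambda>\<omega>. \<Sum>i\<in>I. c i * D i \<omega>" r] G gaussian_family_mean[of c]
  by (simp add: gaussian_family_variance[symmetric] gaussian_family_def)

text \<open>Schur's test: a symmetric matrix with absolute row sums at most \<open>R\<close> has operator norm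
  at most \<open>R\<close>.\<close>

lemma gaussian_family_variance_le:
  assumes R: "\<And>i. i \<in> I \<Longrightarrow> (\<Sum>j\<in>I. \<bar>covariance P (D i) (D j)\<bar>) \<le> R"
  shows "(\<integral>\<omega>. (\<Sum>i\<in>I. c i * D i \<omega>)\<^sup>2 \<partial>P) \<le> R * (\<Sum>i\<in>I. (c i)\<^sup>2)"
proof -
  let ?K = "\<lambda>i j. covariance P (D i) (D j)"
  have "(\<Sum>i\<in>I. \<Sum>j\<in>I. c i * c j * ?K i j) \<le> (\<Sum>i\<in>I. \<Sum>j\<in>I. ((c i)\<^sup>2 + (c j)\<^sup>2) / 2 * \<bar>?K i j\<bar>)"
  proof (intro sum_mono)
    fix i j
    have "c i * c j * ?K i j \<le> \<bar>c i * c j\<bar> * \<bar>?K i j\<bar>"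
      by (metis abs_ge_self abs_mult)
    also have "\<dots> \<le> ((c i)\<^sup>2 + (c j)\<^sup>2) / 2 * \<bar>?K i j\<bar>"
      using sum_squares_bound[of "\<bar>c i\<bar>" "\<bar>c j\<bar>"]
      by (intro mult_right_mono) (auto simp: abs_mult)
    finally show "c i * c j * ?K i j \<le> ((c i)\<^sup>2 + (c j)\<^sup>2) / 2 * \<bar>?K i j\<bar>" .
  qed
  also have "\<dots> = (\<Sum>i\<in>I. \<Sum>j\<in>I. (c i)\<^sup>2 / 2 * \<bar>?K i j\<bar>) + (\<Sum>i\<in>I. \<Sum>j\<in>I. (c j)\<^sup>2 / 2 * \<bar>?K i j\<bar>)"
    by (simp add: add_divide_distrib distrib_right sum.distrib)
  also have "(\<Sum>i\<in>I. \<Sum>j\<in>I. (c j)\<^sup>2 / 2 * \<bar>?K i j\<bar>) = (\<Sum>i\<in>I. \<Sum>j\<in>I. (c i)\<^sup>2 / 2 * \<bar>?K i j\<bar>)"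
    by (subst sum.swap) (simp add: covariance_def mult.commute)
  also have "(\<Sum>i\<in>I. \<Sum>j\<in>I. (c i)\<^sup>2 / 2 * \<bar>?K i j\<bar>) + (\<Sum>i\<in>I. \<Sum>j\<in>I. (c i)\<^sup>2 / 2 * \<bar>?K i j\<bar>) =
      (\<Sum>i\<in>I. (c i)\<^sup>2 * (\<Sum>j\<in>I. \<bar>?K i j\<bar>))"
    by (simp add: sum.distrib[symmetric] sum_distrib_left)
  also have "\<dots> \<le> (\<Sum>i\<in>I. (c i)\<^sup>2 * R)"
    by (intro sum_mono mult_left_mono R) auto
  finally show ?thesis
    by (simp add: gaussian_family_variance sum_distrib_left mult.commute)
qed

lemma gaussian_family_moment_le:
  assumes "(\<integral>\<omega>. (\<Sum>i\<in>I. c i * D i \<omega>)\<^sup>2 \<partial>P) \<le> V"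
  shows "integrable P (\<lambda>\<omega>. (\<Sum>i\<in>I. c i * D i \<omega>) ^ (2 * k))"
    "(\<integral>\<omega>. (\<Sum>i\<in>I. c i * D i \<omega>) ^ (2 * k) \<partial>P) \<le> fact (2 * k) / (2 ^ k * fact k) * V ^ k"
proof -
  have "gaussian_rv P (\<lambda>\<omega>. \<Sum>i\<in>I. c i * D i \<omega>)" using G by (simp add: gaussian_family_def)
  then obtain m where
    m: "integrable P (\<lambda>\<omega>. ((\<Sum>i\<in>I. c i * D i \<omega>) - m) ^ (2 * k))"
    "(\<integral>\<omega>. (\<Sum>i\<in>I. c i * D i \<omega>) \<partial>P) = m"
    "(\<integral>\<omega>. ((\<Sum>i\<in>I. c i * D i \<omega>) - m) ^ (2 * k) \<partial>P) =
      fact (2 * k) / (2 ^ k * fact k) * (\<integral>\<omega>. ((\<Sum>i\<in>I. c i * D i \<omega>) - m)\<^sup>2 \<partial>P) ^ k"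
    by (rule gaussian_rv_even_power)
  have m0: "m = 0" using m(2) gaussian_family_mean[of c] by simp
  show "integrable P (\<lambda>\<omega>. (\<Sum>i\<in>I. c i * D i \<omega>) ^ (2 * k))" using m(1) by (simp add: m0)
  have "(\<integral>\<omega>. (\<Sum>i\<in>I. c i * D i \<omega>)\<^sup>2 \<partial>P) ^ k \<le> V ^ k"
    using assms by (intro power_mono) auto
  then show "(\<integral>\<omega>. (\<Sum>i\<in>I. c i * D i \<omega>) ^ (2 * k) \<partial>P) \<le> fact (2 * k) / (2 ^ k * fact k) * V ^ k"
    using m(3) by (auto simp: m0 intro!: mult_left_mono divide_right_mono)
qed

end

lemma gaussian_process_linear_combination:
  assumes G: "gaussian_process P T Z" and "finite I" "\<tau> ` I \<subseteq> T"
  shows "gaussian_rv P (\<lambda>\<omega>. \<Sum>i\<in>I. c i * Z (\<tau> i) \<omega>)"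
proof -
  have "(\<Sum>i\<in>I. c i * Z (\<tau> i) \<omega>) = (\<Sum>t\<in>\<tau> ` I. (\<Sum>i\<in>{i\<in>I. \<tau> i = t}. c i) * Z t \<omega>)" for \<omega>
    using sum.image_gen[OF \<open>finite I\<close>, of "\<lambda>i. c i * Z (\<tau> i) \<omega>" \<tau>]
    by (simp add: sum_distrib_right)
  then show ?thesis using G assms(2,3) by (simp add: gaussian_process_def)
qed

lemma gaussian_family_increments:
  assumes P: "prob_space P" and Z: "centered_stationary_gaussian_process P Z K"
    and h: "0 < h n"
  shows "gaussian_family P {1..n} (increment h Z n)"
  unfolding gaussian_family_def
proof (intro conjI allI ballI)
  have GZ: "gaussian_process P {0..} Z" and mean: "\<And>t. 0 \<le> t \<Longrightarrow> integral\<^sup>L P (Z t) = 0"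
    using Z by (auto simp: centered_stationary_gaussian_process_def)
  have g0: "0 \<le> grid h n i" for i using h by (simp add: grid_def)
  show "finite {1..n}" by simp
  show "gaussian_rv P (\<lambda>\<omega>. \<Sum>i\<in>{1..n}. c i * increment h Z n i \<omega>)" for c
  proof -
    let ?c = "\<lambda>(i, b). if b then c i else - c i"
    let ?\<tau> = "\<lambda>(i, b). if b then grid h n i else grid h n (i - 1)"
    have "(\<Sum>x\<in>{1..n} \<times> (UNIV :: bool set). ?c x * Z (?\<tau> x) \<omega>) =
        (\<Sum>i\<in>{1..n}. c i * increment h Z n i \<omega>)" for \<omega>
      unfolding sum.cartesian_product' by (simp add: UNIV_bool increment_def right_diff_distrib)
    moreover have "?\<tau> ` ({1..n} \<times> (UNIV :: bool set)) \<subseteq> {0..}" using g0 by auto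
    ultimately show ?thesis
      using gaussian_process_linear_combination[OF GZ, of "{1..n} \<times> (UNIV :: bool set)" ?\<tau> ?c]
      by simp
  qed
  show "integral\<^sup>L P (increment h Z n i) = 0" if "i \<in> {1..n}" for i
  proof -
    have F: "gaussian_family P {grid h n i, grid h n (i - 1)} Z"
      using GZ g0 mean by (simp add: gaussian_family_def gaussian_process_def)
    have "integrable P (Z (grid h n i))" "integrable P (Z (grid h n (i - 1)))"
      by (rule gaussian_family_integrable[OF P F], simp)+
    then show ?thesis using mean g0 by (simp add: increment_def[abs_def])
  qed
qed

section \<open>Uniform bounds by chaining\<close>

definition dyadic_point :: "nat \<Rightarrow> ('p \<Rightarrow> nat) \<Rightarrow> real ^ 'p" where
  "dyadic_point k q = (\<chi> j. real (q j) / 2 ^ k)"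

definition dyadic_digits :: "nat \<Rightarrow> real ^ 'p \<Rightarrow> 'p \<Rightarrow> nat" where
  "dyadic_digits k x = (\<lambda>j. nat \<lfloor>2 ^ k * x $ j\<rfloor>)"

lemma dyadic_point_half_dist:
  "norm (dyadic_point (Suc k) q - dyadic_point k (\<lambda>j. q j div 2) :: real ^ 'p) \<le> CARD('p) / 2 ^ Suc k"
proof -
  have "\<bar>(dyadic_point (Suc k) q - dyadic_point k (\<lambda>j. q j div 2) :: real ^ 'p) $ j\<bar> \<le> 1 / 2 ^ Suc k" for j
  proof -
    have "real (q j) = 2 * real (q j div 2) + real (q j mod 2)"
      by (metis mult_div_mod_eq of_nat_add of_nat_mult of_nat_numeral)
    then have "real (q j) / 2 ^ Suc k - real (q j div 2) / 2 ^ k = real (q j mod 2) / 2 ^ Suc k"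
      by (simp add: field_simps)
    moreover have "real (q j mod 2) \<le> 1" using mod_less_divisor[of 2 "q j"] by simp
    ultimately show ?thesis
      by (simp add: dyadic_point_def divide_right_mono del: power_Suc)
  qed
  then have "(\<Sum>j\<in>UNIV. \<bar>(dyadic_point (Suc k) q - dyadic_point k (\<lambda>j. q j div 2) :: real ^ 'p) $ j\<bar>)
      \<le> (\<Sum>j\<in>(UNIV :: 'p set). 1 / 2 ^ Suc k)"
    by (rule sum_mono)
  then show ?thesis
    using norm_le_l1_cart[of "dyadic_point (Suc k) q - dyadic_point k (\<lambda>j. q j div 2) :: real ^ 'p"]
    by simp
qed

text \<open>Halving the digits of level \<open>k + 1\<close> gives those of level \<open>k\<close>, so the successive
  approximations of a point form a chain of links that are indexed by the digits of the finer
  level alone.\<close>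

lemma dyadic_digits_half:
  assumes "0 \<le> x $ j"
  shows "dyadic_digits (Suc k) x j div 2 = dyadic_digits k x j"
proof -
  have "\<lfloor>2 ^ Suc k * x $ j\<rfloor> div 2 = \<lfloor>2 ^ Suc k * x $ j / real_of_int 2\<rfloor>"
    by (rule floor_divide_real_eq_div[symmetric]) simp
  also have "2 ^ Suc k * x $ j / real_of_int 2 = 2 ^ k * x $ j" by simp
  finally have "\<lfloor>2 ^ Suc k * x $ j\<rfloor> div 2 = \<lfloor>2 ^ k * x $ j\<rfloor>" .
  then show ?thesis
    using assms by (simp add: dyadic_digits_def nat_div_distrib[symmetric] del: power_Suc)
qed

lemma dyadic_digits_less:
  assumes "0 \<le> x $ j" "x $ j < 1"
  shows "dyadic_digits k x j < 2 ^ k"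
proof -
  have "2 ^ k * x $ j < 2 ^ k" using assms by simp
  then have "\<lfloor>2 ^ k * x $ j\<rfloor> < 2 ^ k" by (simp add: floor_less_iff)
  then show ?thesis using assms by (simp add: dyadic_digits_def nat_less_iff)
qed

lemma dyadic_point_tendsto:
  assumes "\<And>j. 0 \<le> x $ j"
  shows "(\<lambda>k. dyadic_point k (dyadic_digits k x)) \<longlonglongrightarrow> x"
proof (rule vec_tendstoI)
  fix j
  have d: "\<bar>dyadic_point k (dyadic_digits k x) $ j - x $ j\<bar> \<le> (1 / 2) ^ k" for k
  proof -
    have "0 \<le> \<lfloor>2 ^ k * x $ j\<rfloor>" using assms[of j] by simp
    then have e: "dyadic_point k (dyadic_digits k x) $ j = of_int \<lfloor>2 ^ k * x $ j\<rfloor> / 2 ^ k"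
      by (simp add: dyadic_point_def dyadic_digits_def)
    have "\<bar>of_int \<lfloor>2 ^ k * x $ j\<rfloor> - 2 ^ k * x $ j\<bar> \<le> 1"
      using of_int_floor_le[of "2 ^ k * x $ j"] real_of_int_floor_add_one_gt[of "2 ^ k * x $ j"] by linarith
    then have "\<bar>of_int \<lfloor>2 ^ k * x $ j\<rfloor> - 2 ^ k * x $ j\<bar> / 2 ^ k \<le> 1 / 2 ^ k"
      by (rule divide_right_mono) simp
    moreover have "of_int \<lfloor>2 ^ k * x $ j\<rfloor> / 2 ^ k - x $ j = (of_int \<lfloor>2 ^ k * x $ j\<rfloor> - 2 ^ k * x $ j) / 2 ^ k"
      by (simp add: diff_divide_distrib)
    ultimately show ?thesis unfolding e by (simp add: abs_divide power_one_over)
  qed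
  have "(\<lambda>k. dyadic_point k (dyadic_digits k x) $ j - x $ j) \<longlonglongrightarrow> 0"
  proof (rule Lim_null_comparison)
    show "\<forall>\<^sub>F k in sequentially. norm (dyadic_point k (dyadic_digits k x) $ j - x $ j) \<le> (1 / 2) ^ k"
      using d by simp
    show "(\<lambda>k. (1 / 2 :: real) ^ k) \<longlonglongrightarrow> 0" by (rule LIMSEQ_power_zero) simp
  qed
  then show "(\<lambda>k. dyadic_point k (dyadic_digits k x) $ j) \<longlonglongrightarrow> x $ j"
    by (simp add: LIM_zero_iff)
qed

lemma finite_card_digits:
  "finite {q :: 'p::finite \<Rightarrow> nat. \<forall>j. q j < N}" "card {q :: 'p \<Rightarrow> nat. \<forall>j. q j < N} = N ^ CARD('p)"
proof -
  have "{q :: 'p \<Rightarrow> nat. \<forall>j. q j < N} = PiE UNIV (\<lambda>_. {..<N})" by auto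
  then show "finite {q :: 'p::finite \<Rightarrow> nat. \<forall>j. q j < N}" "card {q :: 'p \<Rightarrow> nat. \<forall>j. q j < N} = N ^ CARD('p)"
    by (auto simp: card_PiE intro!: finite_PiE)
qed

lemma (in prob_space) moment_tail:
  assumes int: "integrable M (\<lambda>\<omega>. (Y \<omega>) ^ (2 * m))" and E: "(\<integral>\<omega>. (Y \<omega>) ^ (2 * m) \<partial>M) \<le> V"
    and meas[measurable]: "Y \<in> borel_measurable M" and t: "0 < t"
  shows "measure M {\<omega>\<in>space M. t < \<bar>Y \<omega>\<bar>} \<le> V / t ^ (2 * m)"
proof -
  have "measure M {\<omega>\<in>space M. t < \<bar>Y \<omega>\<bar>} \<le> measure M {\<omega>\<in>space M. t ^ (2 * m) \<le> (Y \<omega>) ^ (2 * m)}"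
  proof (rule finite_measure_mono)
    have "t ^ (2 * m) \<le> y ^ (2 * m)" if "t < \<bar>y\<bar>" for y
    proof -
      have "t ^ (2 * m) \<le> \<bar>y\<bar> ^ (2 * m)" using that t by (intro power_mono) auto
      then show ?thesis by (simp add: power_mult)
    qed
    then show "{\<omega>\<in>space M. t < \<bar>Y \<omega>\<bar>} \<subseteq> {\<omega>\<in>space M. t ^ (2 * m) \<le> (Y \<omega>) ^ (2 * m)}" by auto
  qed measurable
  also have "\<dots> \<le> (\<integral>\<omega>. (Y \<omega>) ^ (2 * m) \<partial>M) / t ^ (2 * m)"
    using t by (intro integral_Markov_inequality_measure[OF int, of "{}"]) (auto simp: power_mult)
  also have "\<dots> \<le> V / t ^ (2 * m)" using E t by (intro divide_right_mono) auto
  finally show ?thesis .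
qed

text \<open>Kolmogorov's chaining argument. Between the dyadic approximations of levels \<open>k\<close> and
  \<open>k + 1\<close> there are \<open>2\<^bsup>(k + 1) p\<^esup>\<close> links of length \<open>O(2\<^bsup>-k\<^esup>)\<close>. Allowing the increment
  \<open>\<delta> (1 - r) r\<^bsup>k\<^esup>\<close> on each of them, where \<open>r = 2\<^bsup>-\<rho>/2\<^esup>\<close>, costs a probability of order \<open>2\<^bsup>-k\<^esup>\<close>
  as soon as \<open>m \<rho> \<ge> p + 1\<close>.\<close>

lemma chaining_unit_cube:
  fixes G :: "real ^ 'p \<Rightarrow> 'w \<Rightarrow> real" and A \<rho> \<delta> :: real
  assumes P: "prob_space P" and meas[measurable]: "\<And>x. G x \<in> borel_measurable P"
    and cont: "\<And>\<omega>. \<omega> \<in> space P \<Longrightarrow> continuous_on UNIV (\<lambda>x. G x \<omega>)"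
    and int: "\<And>x y. integrable P (\<lambda>\<omega>. (G x \<omega> - G y \<omega>) ^ (2 * m))"
    and mom: "\<And>x y. (\<integral>\<omega>. (G x \<omega> - G y \<omega>) ^ (2 * m) \<partial>P) \<le> A * norm (x - y) powr (2 * real m * \<rho>)"
    and \<rho>: "0 < \<rho>" and m: "CARD('p) + 1 \<le> real m * \<rho>" and "0 < \<delta>" "0 \<le> A"
  shows "\<exists>B\<in>sets P. measure P B \<le>
      CARD('p) powr (2 * real m * \<rho>) / (1 - 2 powr (- \<rho> / 2)) ^ (2 * m) * A / \<delta> ^ (2 * m) \<and>
    (\<forall>\<omega>\<in>space P - B. \<forall>x. (\<forall>j. 0 \<le> x $ j \<and> x $ j < 1) \<longrightarrow> \<bar>G x \<omega> - G 0 \<omega>\<bar> \<le> \<delta>)"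
proof -
  interpret prob_space P by (rule P)
  define r :: real where "r = 2 powr (- \<rho> / 2)"
  have r: "0 < r" "r < 1" using \<rho> powr_less_mono[of "- \<rho> / 2" 0 2] by (auto simp: r_def)
  define \<kappa> where "\<kappa> k = \<delta> * (1 - r) * r ^ k" for k
  have \<kappa>: "0 < \<kappa> k" for k using r \<open>0 < \<delta>\<close> by (simp add: \<kappa>_def)
  define Q where "Q k = {q :: 'p \<Rightarrow> nat. \<forall>j. q j < 2 ^ k}" for k
  define link where "link k q \<omega> = G (dyadic_point (Suc k) q) \<omega> - G (dyadic_point k (\<lambda>j. q j div 2)) \<omega>"
    for k q \<omega>
  define E where "E k q = {\<omega>\<in>space P. \<kappa> k < \<bar>link k q \<omega>\<bar>}" for k q
  define L where "L k = (\<Union>q\<in>Q (Suc k). E k q)" for k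
  define c where "c = CARD('p) powr (2 * real m * \<rho>) / (1 - r) ^ (2 * m) * A / \<delta> ^ (2 * m)"
  have c0: "0 \<le> c" using r \<open>0 < \<delta>\<close> \<open>0 \<le> A\<close> by (simp add: c_def)
  have [measurable]: "link k q \<in> borel_measurable P" for k q unfolding link_def by measurable
  have Em: "E k q \<in> sets P" for k q unfolding E_def by measurable
  have Lm: "L k \<in> sets P" for k
    unfolding L_def using finite_card_digits(1) Em by (intro sets.finite_UN) (auto simp: Q_def)
  have PE: "measure P (E k q) \<le> c * 2 powr (- real (Suc k) * (1 + real CARD('p)))" for k q
  proof -
    define s where "s = 2 * real m * \<rho>"
    have "(\<integral>\<omega>. (link k q \<omega>) ^ (2 * m) \<partial>P) \<le> A * (CARD('p) / 2 ^ Suc k) powr s"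
      unfolding link_def s_def using \<rho> \<open>0 \<le> A\<close>
      by (intro order_trans[OF mom] mult_left_mono powr_mono2 dyadic_point_half_dist) auto
    then have "measure P (E k q) \<le> A * (CARD('p) / 2 ^ Suc k) powr s / \<kappa> k ^ (2 * m)"
      unfolding E_def by (intro moment_tail \<kappa>) (auto simp: link_def intro: int)
    also have "\<kappa> k ^ (2 * m) = \<delta> ^ (2 * m) * (1 - r) ^ (2 * m) * r ^ (k * (2 * m))"
      by (simp only: \<kappa>_def power_mult_distrib power_mult)
    also have "r ^ (k * (2 * m)) = 2 powr (- \<rho> * k * m)"
      using r(1) by (simp add: powr_realpow[symmetric] r_def powr_powr algebra_simps)
    also have "(CARD('p) / 2 ^ Suc k) powr s = CARD('p) powr s * 2 powr (- s * real (Suc k))"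
    proof -
      have "(CARD('p) / 2 ^ Suc k) powr s = CARD('p) powr s / (2 powr real (Suc k)) powr s"
        by (subst powr_divide) (simp_all add: powr_realpow del: power_Suc of_nat_Suc)
      also have "(2 powr real (Suc k)) powr s = 2 powr (s * real (Suc k))"
        by (subst powr_powr) (rule arg_cong[OF mult.commute])
      also have "2 powr (s * real (Suc k)) = inverse (2 powr (- s * real (Suc k)))"
        by (subst powr_minus[symmetric]) (rule arg_cong, simp only: minus_mult_left minus_minus)
      finally show ?thesis by (simp only: divide_inverse inverse_inverse_eq)
    qed
    also have "A * (CARD('p) powr s * 2 powr (- s * real (Suc k))) /
        (\<delta> ^ (2 * m) * (1 - r) ^ (2 * m) * 2 powr (- \<rho> * k * m)) =
        c * 2 powr (- s * real (Suc k) - (- \<rho> * k * m))"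
    proof -
      have "A * (a * t) / (d * q * u) = a / q * A / d * (t / u)" for a t d q u :: real by (simp add: mult_ac)
      then show ?thesis by (simp only: c_def s_def powr_diff)
    qed
    also have "\<dots> \<le> c * 2 powr (- real (Suc k) * (1 + real CARD('p)))"
    proof (intro mult_left_mono c0 powr_mono)
      have "real (Suc k) * (1 + real CARD('p)) \<le> real (Suc k) * (m * \<rho>)"
        using m by (intro mult_left_mono) auto
      also have "\<dots> \<le> s * real (Suc k) - \<rho> * k * m"
        using \<rho> by (simp add: s_def algebra_simps)
      finally show "- s * real (Suc k) - (- \<rho> * k * m) \<le> - real (Suc k) * (1 + real CARD('p))"
        unfolding minus_mult_left[symmetric] by linarith
    qed simp
    finally show ?thesis .
  qed
  have PL: "measure P (L k) \<le> c * (1 / 2) ^ Suc k" for k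
  proof -
    have "measure P (L k) \<le> (\<Sum>q\<in>Q (Suc k). measure P (E k q))"
      unfolding L_def using finite_card_digits(1) Em
      by (intro finite_measure_subadditive_finite) (auto simp: Q_def)
    also have "\<dots> \<le> (\<Sum>q\<in>Q (Suc k). c * 2 powr (- real (Suc k) * (1 + real CARD('p))))"
      by (intro sum_mono PE)
    also have "\<dots> = 2 ^ (Suc k * CARD('p)) * (c * 2 powr (- real (Suc k) * (1 + real CARD('p))))"
      by (simp only: Q_def finite_card_digits(2) power_mult sum_constant of_nat_power of_nat_numeral)
    also have "\<dots> = c * (2 powr (real (Suc k) * real CARD('p)) * 2 powr (- real (Suc k) * (1 + real CARD('p))))"
    proof -
      have "(2::real) ^ (Suc k * CARD('p)) = 2 powr (real (Suc k) * real CARD('p))"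
        by (simp only: powr_realpow[symmetric] of_nat_mult zero_less_numeral)
      then show ?thesis by (simp only: mult_ac)
    qed
    also have "2 powr (real (Suc k) * real CARD('p)) * 2 powr (- real (Suc k) * (1 + real CARD('p))) =
        2 powr (- real (Suc k))"
      by (simp only: powr_add[symmetric]) (simp add: algebra_simps)
    also have "\<dots> = (1 / 2) ^ Suc k"
      by (simp add: powr_minus powr_realpow power_one_over inverse_eq_divide del: power_Suc of_nat_Suc)
    finally show ?thesis .
  qed
  have geo: "(\<lambda>k. c * (1 / 2) ^ Suc k) sums c"
    using sums_mult[OF power_half_series, of c] by simp
  have sL: "summable (\<lambda>k. measure P (L k))"
    using PL by (intro summable_comparison_test[OF _ sums_summable[OF geo]]) auto
  have "measure P (\<Union>k. L k) \<le> (\<Sum>k. measure P (L k))"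
    using Lm sL by (intro finite_measure_subadditive_countably) auto
  also have "\<dots> \<le> (\<Sum>k. c * (1 / 2) ^ Suc k)"
    by (intro suminf_le PL sL sums_summable[OF geo])
  also have "\<dots> = c" using geo by (simp add: sums_iff)
  finally have PB: "measure P (\<Union>k. L k) \<le> c" .
  have path: "\<bar>G x \<omega> - G 0 \<omega>\<bar> \<le> \<delta>"
    if \<omega>: "\<omega> \<in> space P" "\<omega> \<notin> (\<Union>k. L k)" and x: "\<And>j. 0 \<le> x $ j \<and> x $ j < 1" for \<omega> x
  proof -
    define z where "z k = dyadic_point k (dyadic_digits k x)" for k
    have z0: "z 0 = 0"
    proof -
      have "\<lfloor>x $ j\<rfloor> = 0" for j using x[of j] by (simp add: floor_eq_iff)
      then show ?thesis by (simp add: z_def dyadic_point_def dyadic_digits_def vec_eq_iff)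
    qed
    have step: "\<bar>G (z (Suc k)) \<omega> - G (z k) \<omega>\<bar> \<le> \<kappa> k" for k
    proof -
      have q: "dyadic_digits (Suc k) x \<in> Q (Suc k)"
        unfolding Q_def using x by (blast intro: dyadic_digits_less)
      then have "\<omega> \<notin> E k (dyadic_digits (Suc k) x)" using \<omega>(2) by (auto simp: L_def)
      then show ?thesis
        using \<omega>(1) x by (simp add: E_def link_def z_def dyadic_digits_half)
    qed
    have sum: "\<bar>G (z k) \<omega> - G (z 0) \<omega>\<bar> \<le> (\<Sum>i<k. \<kappa> i)" for k
    proof (induction k)
      case (Suc k)
      then show ?case using step[of k] by simp
    qed simp
    have "(\<Sum>i<k. \<kappa> i) \<le> \<delta>" for k
    proof -
      have "(\<Sum>i<k. \<kappa> i) = \<delta> * ((1 - r) * (\<Sum>i<k. r ^ i))"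
        by (simp add: \<kappa>_def sum_distrib_left mult.assoc)
      also have "(1 - r) * (\<Sum>i<k. r ^ i) = 1 - r ^ k"
        by (rule one_diff_power_eq[symmetric])
      also have "\<delta> * (1 - r ^ k) \<le> \<delta>" using r \<open>0 < \<delta>\<close> by simp
      finally show ?thesis .
    qed
    then have bd: "\<bar>G (z k) \<omega> - G 0 \<omega>\<bar> \<le> \<delta>" for k using sum[of k] z0 by (metis order_trans)
    have "z \<longlonglongrightarrow> x" unfolding z_def[abs_def] using x by (intro dyadic_point_tendsto) auto
    then have "(\<lambda>k. G (z k) \<omega>) \<longlonglongrightarrow> G x \<omega>"
      using continuous_on_tendsto_compose[OF cont[OF \<omega>(1)], of z x sequentially] by simp
    then have "(\<lambda>k. \<bar>G (z k) \<omega> - G 0 \<omega>\<bar>) \<longlonglongrightarrow> \<bar>G x \<omega> - G 0 \<omega>\<bar>" by (intro tendsto_intros)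
    then show ?thesis by (rule LIMSEQ_le_const2) (use bd in auto)
  qed
  show ?thesis
    using PB path Lm unfolding c_def r_def
    by (intro bexI[of _ "\<Union>k. L k"] conjI ballI allI impI sets.countable_UN) auto
qed

text \<open>Nearest point projection onto \<open>S\<close> is a contraction, so composing with it extends a process
  indexed by \<open>S\<close> to a cube containing \<open>S\<close> with the same bound on its increments.\<close>

theorem chaining_convex:
  fixes S :: "(real ^ 'p) set" and P :: "'w measure" and \<rho> :: real and m :: nat
  assumes S: "compact S" "convex S" "S \<noteq> {}" and P: "prob_space P"
    and \<rho>: "0 < \<rho>" and m: "CARD('p) + 1 \<le> real m * \<rho>"
  shows "\<exists>c\<ge>0. \<forall>G A \<delta>. 0 < \<delta> \<longrightarrow> 0 \<le> A \<longrightarrow> (\<forall>x\<in>S. G x \<in> borel_measurable P) \<longrightarrow>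
    (\<forall>\<omega>\<in>space P. continuous_on S (\<lambda>x. G x \<omega>)) \<longrightarrow>
    (\<forall>x\<in>S. \<forall>y\<in>S. integrable P (\<lambda>\<omega>. (G x \<omega> - G y \<omega>) ^ (2 * m)) \<and>
       (\<integral>\<omega>. (G x \<omega> - G y \<omega>) ^ (2 * m) \<partial>P) \<le> A * norm (x - y) powr (2 * real m * \<rho>)) \<longrightarrow>
    (\<exists>B\<in>sets P. measure P B \<le> c * A / \<delta> ^ (2 * m) \<and>
       (\<forall>\<omega>\<in>space P - B. \<forall>x\<in>S. \<forall>y\<in>S. \<bar>G x \<omega> - G y \<omega>\<bar> \<le> \<delta>))"
proof -
  obtain b where b: "\<And>x. x \<in> S \<Longrightarrow> norm x \<le> b" using S(1) by (meson bounded_iff compact_imp_bounded)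
  have b0: "0 \<le> b" using S(3) b norm_ge_zero by (metis all_not_in_conv order_trans)
  define R where "R = 2 * b + 1"
  have R: "0 < R" using b0 by (simp add: R_def)
  define l where "l = (\<chi> j. - b :: real ^ 'p)"
  define \<phi> where "\<phi> y = closest_point S (l + R *\<^sub>R y)" for y
  define s where "s = 2 * real m * \<rho>"
  have S': "closed S" using S(1) by (rule compact_imp_closed)
  have \<phi>S: "\<phi> y \<in> S" for y unfolding \<phi>_def by (rule closest_point_in_set[OF S' S(3)])
  have \<phi>_lip: "norm (\<phi> x - \<phi> y) \<le> R * norm (x - y)" for x y
  proof -
    have "dist (\<phi> x) (\<phi> y) \<le> dist (l + R *\<^sub>R x) (l + R *\<^sub>R y)"
      unfolding \<phi>_def by (rule closest_point_lipschitz[OF S(2) S' S(3)])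
    also have "\<dots> = norm (R *\<^sub>R (x - y))" by (simp add: dist_norm scaleR_diff_right)
    finally show ?thesis using R by (simp add: dist_norm)
  qed
  have \<phi>_cont: "continuous_on UNIV \<phi>"
    unfolding \<phi>_def
    by (rule continuous_on_compose2[OF continuous_on_closest_point[OF S(2) S' S(3), of UNIV]])
      (auto intro!: continuous_intros)
  have \<phi>_surj: "\<exists>y. x = \<phi> y \<and> (\<forall>j. 0 \<le> y $ j \<and> y $ j < 1)" if x: "x \<in> S" for x
  proof (intro exI conjI allI)
    let ?y = "(1 / R) *\<^sub>R (x - l)"
    show "x = \<phi> ?y" using R x by (simp add: \<phi>_def closest_point_self)
    fix j
    have "\<bar>x $ j\<bar> \<le> b" using b[OF x] component_le_norm_cart[of x j] by linarith
    then have "0 \<le> x $ j + b" "x $ j + b < R" by (auto simp: R_def)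
    moreover have "?y $ j = (x $ j + b) / R" by (simp add: l_def)
    ultimately show "0 \<le> ?y $ j" "?y $ j < 1" using R by auto
  qed
  define c where "c = CARD('p) powr s / (1 - 2 powr (- \<rho> / 2)) ^ (2 * m) * R powr s * 2 ^ (2 * m)"
  have "0 \<le> c" by (simp add: c_def)
  moreover have "\<exists>B\<in>sets P. measure P B \<le> c * A / \<delta> ^ (2 * m) \<and>
       (\<forall>\<omega>\<in>space P - B. \<forall>x\<in>S. \<forall>y\<in>S. \<bar>G x \<omega> - G y \<omega>\<bar> \<le> \<delta>)"
    if "0 < \<delta>" "0 \<le> A" and meas: "\<forall>x\<in>S. G x \<in> borel_measurable P"
      and cont: "\<forall>\<omega>\<in>space P. continuous_on S (\<lambda>x. G x \<omega>)"
      and mom: "\<forall>x\<in>S. \<forall>y\<in>S. integrable P (\<lambda>\<omega>. (G x \<omega> - G y \<omega>) ^ (2 * m)) \<and>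
       (\<integral>\<omega>. (G x \<omega> - G y \<omega>) ^ (2 * m) \<partial>P) \<le> A * norm (x - y) powr (2 * real m * \<rho>)" for G A \<delta>
  proof -
    have "\<exists>B\<in>sets P. measure P B \<le>
        CARD('p) powr (2 * real m * \<rho>) / (1 - 2 powr (- \<rho> / 2)) ^ (2 * m) * (A * R powr s) / (\<delta> / 2) ^ (2 * m) \<and>
      (\<forall>\<omega>\<in>space P - B. \<forall>x. (\<forall>j. 0 \<le> x $ j \<and> x $ j < 1) \<longrightarrow> \<bar>G (\<phi> x) \<omega> - G (\<phi> 0) \<omega>\<bar> \<le> \<delta> / 2)"
    proof (rule chaining_unit_cube[OF P _ _ _ _ \<rho> m])
      show "G (\<phi> x) \<in> borel_measurable P" for x using meas \<phi>S by blast
      show "continuous_on UNIV (\<lambda>x. G (\<phi> x) \<omega>)" if "\<omega> \<in> space P" for \<omega>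
        using continuous_on_compose2[OF bspec[OF cont that] \<phi>_cont] \<phi>S by auto
      show "integrable P (\<lambda>\<omega>. (G (\<phi> x) \<omega> - G (\<phi> y) \<omega>) ^ (2 * m))" for x y
        using mom \<phi>S by blast
      show "(\<integral>\<omega>. (G (\<phi> x) \<omega> - G (\<phi> y) \<omega>) ^ (2 * m) \<partial>P) \<le> A * R powr s * norm (x - y) powr (2 * real m * \<rho>)" for x y
      proof -
        have "(\<integral>\<omega>. (G (\<phi> x) \<omega> - G (\<phi> y) \<omega>) ^ (2 * m) \<partial>P) \<le> A * norm (\<phi> x - \<phi> y) powr s"
          using mom \<phi>S unfolding s_def by blast
        also have "\<dots> \<le> A * (R * norm (x - y)) powr s"
          using \<open>0 \<le> A\<close> \<rho> \<phi>_lip by (intro mult_left_mono powr_mono2) (auto simp: s_def)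
        also have "\<dots> = A * R powr s * norm (x - y) powr (2 * real m * \<rho>)"
          using R by (simp add: powr_mult s_def)
        finally show ?thesis .
      qed
    qed (use that in auto)
    then obtain B where B: "B \<in> sets P" "measure P B \<le>
        CARD('p) powr (2 * real m * \<rho>) / (1 - 2 powr (- \<rho> / 2)) ^ (2 * m) * (A * R powr s) / (\<delta> / 2) ^ (2 * m)"
      "\<And>\<omega> x. \<omega> \<in> space P - B \<Longrightarrow> (\<forall>j. 0 \<le> x $ j \<and> x $ j < 1) \<Longrightarrow> \<bar>G (\<phi> x) \<omega> - G (\<phi> 0) \<omega>\<bar> \<le> \<delta> / 2"
      by blast
    have "\<bar>G x \<omega> - G y \<omega>\<bar> \<le> \<delta>" if \<omega>: "\<omega> \<in> space P - B" and "x \<in> S" "y \<in> S" for x y \<omega>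
    proof -
      obtain x' where x': "x = \<phi> x'" "\<forall>j. 0 \<le> x' $ j \<and> x' $ j < 1" using \<phi>_surj[OF \<open>x \<in> S\<close>] by blast
      obtain y' where y': "y = \<phi> y'" "\<forall>j. 0 \<le> y' $ j \<and> y' $ j < 1" using \<phi>_surj[OF \<open>y \<in> S\<close>] by blast
      show ?thesis using B(3)[OF \<omega> x'(2)] B(3)[OF \<omega> y'(2)] unfolding x'(1) y'(1) by linarith
    qed
    moreover have "CARD('p) powr (2 * real m * \<rho>) / (1 - 2 powr (- \<rho> / 2)) ^ (2 * m) * (A * R powr s) / (\<delta> / 2) ^ (2 * m)
        = c * A / \<delta> ^ (2 * m)"
      by (simp add: c_def s_def power_divide)
    ultimately show ?thesis using B(1,2) by auto
  qed
  ultimately show ?thesis by blast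
qed

section \<open>Events of high probability and Slutsky's argument\<close>

text \<open>The exceptional sets are only required to be covered by small measurable sets, so that
  suprema over uncountable parameter sets raise no measurability questions.\<close>

definition whp :: "'w measure \<Rightarrow> (nat \<Rightarrow> 'w \<Rightarrow> bool) \<Rightarrow> bool" where
  "whp P E \<longleftrightarrow> (\<forall>e>0. \<forall>\<^sub>F n in sequentially.
     \<exists>B\<in>sets P. measure P B \<le> e \<and> (\<forall>\<omega>\<in>space P - B. E n \<omega>))"

lemma whp_mono:
  assumes E: "whp P E" and EF: "\<forall>\<^sub>F n in sequentially. \<forall>\<omega>\<in>space P. E n \<omega> \<longrightarrow> F n \<omega>"
  shows "whp P F"
  unfolding whp_def
proof (intro allI impI)
  fix e :: real assume "0 < e"
  then have "\<forall>\<^sub>F n in sequentially. \<exists>B\<in>sets P. measure P B \<le> e \<and> (\<forall>\<omega>\<in>space P - B. E n \<omega>)"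
    using E by (simp add: whp_def)
  with EF show "\<forall>\<^sub>F n in sequentially. \<exists>B\<in>sets P. measure P B \<le> e \<and> (\<forall>\<omega>\<in>space P - B. F n \<omega>)"
    by eventually_elim blast
qed

lemma whp_conj:
  assumes P: "prob_space P" and E: "whp P E" and F: "whp P F"
  shows "whp P (\<lambda>n \<omega>. E n \<omega> \<and> F n \<omega>)"
  unfolding whp_def
proof (intro allI impI)
  interpret prob_space P by (rule P)
  fix e :: real assume "0 < e"
  then have "0 < e / 2" by simp
  then have "\<forall>\<^sub>F n in sequentially. \<exists>B\<in>sets P. measure P B \<le> e / 2 \<and> (\<forall>\<omega>\<in>space P - B. E n \<omega>)"
    "\<forall>\<^sub>F n in sequentially. \<exists>B\<in>sets P. measure P B \<le> e / 2 \<and> (\<forall>\<omega>\<in>space P - B. F n \<omega>)"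
    using E F unfolding whp_def by blast+
  then show "\<forall>\<^sub>F n in sequentially. \<exists>B\<in>sets P. measure P B \<le> e \<and> (\<forall>\<omega>\<in>space P - B. E n \<omega> \<and> F n \<omega>)"
  proof eventually_elim
    case (elim n)
    then obtain B C where B: "B \<in> sets P" "measure P B \<le> e / 2" "\<forall>\<omega>\<in>space P - B. E n \<omega>"
      and C: "C \<in> sets P" "measure P C \<le> e / 2" "\<forall>\<omega>\<in>space P - C. F n \<omega>" by blast
    have "measure P (B \<union> C) \<le> e"
      using measure_Un_le[OF B(1) C(1)] B(2) C(2) by linarith
    then show ?case using B C by (intro bexI[of _ "B \<union> C"]) auto
  qed
qed

lemma whp_ball_finite:
  assumes P: "prob_space P" and "finite J" "\<And>j. j \<in> J \<Longrightarrow> whp P (E j)"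
  shows "whp P (\<lambda>n \<omega>. \<forall>j\<in>J. E j n \<omega>)"
  using assms(2,3)
proof (induction rule: finite_induct)
  case empty
  show ?case unfolding whp_def by (auto intro!: always_eventually bexI[of _ "{}"])
next
  case (insert j J)
  have "whp P (\<lambda>n \<omega>. E j n \<omega> \<and> (\<forall>j\<in>J. E j n \<omega>))"
    using insert by (intro whp_conj[OF P]) auto
  then show ?case by simp
qed

lemma whp_if_tail_tendsto_0:
  assumes "\<forall>\<^sub>F n in sequentially. \<exists>B\<in>sets P. measure P B \<le> f n \<and> (\<forall>\<omega>\<in>space P - B. E n \<omega>)"
    and "f \<longlonglongrightarrow> 0"
  shows "whp P E"
  unfolding whp_def
proof (intro allI impI)
  fix e :: real assume "0 < e"
  from assms(1) order_tendstoD(2)[OF assms(2) this]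
  show "\<forall>\<^sub>F n in sequentially. \<exists>B\<in>sets P. measure P B \<le> e \<and> (\<forall>\<omega>\<in>space P - B. E n \<omega>)"
    by eventually_elim (meson less_imp_le order_trans)
qed

lemma integral_diff_le_off_event:
  fixes f g :: "'w \<Rightarrow> real"
  assumes P: "prob_space P" and [measurable]: "f \<in> borel_measurable P" "g \<in> borel_measurable P"
    and f: "\<And>\<omega>. \<bar>f \<omega>\<bar> \<le> 1" and g: "\<And>\<omega>. \<bar>g \<omega>\<bar> \<le> 1" and B[measurable]: "B \<in> sets P"
    and off: "\<And>\<omega>. \<omega> \<in> space P - B \<Longrightarrow> \<bar>f \<omega> - g \<omega>\<bar> \<le> d" and "0 \<le> d"
  shows "\<bar>(\<integral>\<omega>. f \<omega> \<partial>P) - (\<integral>\<omega>. g \<omega> \<partial>P)\<bar> \<le> d + 2 * measure P B"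
proof -
  interpret prob_space P by (rule P)
  have i: "integrable P f" "integrable P g"
    using f g by (auto intro!: integrable_const_bound[of _ 1])
  have "\<bar>(\<integral>\<omega>. f \<omega> \<partial>P) - (\<integral>\<omega>. g \<omega> \<partial>P)\<bar> = \<bar>\<integral>\<omega>. f \<omega> - g \<omega> \<partial>P\<bar>"
    using i by simp
  also have "\<dots> \<le> (\<integral>\<omega>. \<bar>f \<omega> - g \<omega>\<bar> \<partial>P)" by (rule integral_abs_bound)
  also have "\<dots> \<le> (\<integral>\<omega>. d + 2 * indicator B \<omega> \<partial>P)"
  proof (rule integral_mono)
    show "integrable P (\<lambda>\<omega>. \<bar>f \<omega> - g \<omega>\<bar>)" using i by auto
    show "integrable P (\<lambda>\<omega>. d + 2 * indicat_real B \<omega>)"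
      by (intro Bochner_Integration.integrable_add integrable_const
          integrable_mult_right integrable_real_indicator) (auto simp: emeasure_eq_measure)
    fix \<omega> assume \<omega>: "\<omega> \<in> space P"
    show "\<bar>f \<omega> - g \<omega>\<bar> \<le> d + 2 * indicat_real B \<omega>"
    proof (cases "\<omega> \<in> B")
      case True
      then show ?thesis using f[of \<omega>] g[of \<omega>] \<open>0 \<le> d\<close> by simp
    next
      case False
      then show ?thesis using off[of \<omega>] \<omega> by simp
    qed
  qed
  also have "\<dots> = d + 2 * measure P B"
    by (subst Bochner_Integration.integral_add) (auto simp: emeasure_eq_measure prob_space)
  finally show ?thesis .
qed

lemma abs_cos_diff_le: "\<bar>cos x - cos y\<bar> \<le> \<bar>x - y\<bar>" for x y :: real
proof -
  have "\<bar>cos x - cos y\<bar> = 2 * \<bar>sin ((x + y) / 2)\<bar> * \<bar>sin ((y - x) / 2)\<bar>"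
    by (simp add: cos_diff_cos abs_mult)
  also have "\<dots> \<le> 2 * 1 * \<bar>(y - x) / 2\<bar>"
    by (intro mult_mono abs_sin_x_le_abs_x) auto
  finally show ?thesis by simp
qed

text \<open>Slutsky's theorem for a centered Gaussian sequence \<open>W\<close> whose covariance converges to \<open>S\<close>
  and a perturbation \<open>Y\<close> of \<open>W\<close> with relative error tending to zero in probability.\<close>

theorem converges_in_distribution_to_normal:
  fixes Y W :: "nat \<Rightarrow> 'w \<Rightarrow> real ^ 'p"
  assumes P: "prob_space P" and S: "pos_def_matrix S"
    and Y[measurable]: "\<And>n. Y n \<in> borel_measurable P" and W[measurable]: "\<And>n. W n \<in> borel_measurable P"
    and wave: "\<And>n u c. (\<integral>\<omega>. cos (u \<bullet> W n \<omega> + c) \<partial>P) = cos c * exp (- v n u / 2)"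
    and sq_int: "\<And>n u. integrable P (\<lambda>\<omega>. (u \<bullet> W n \<omega>)\<^sup>2)"
    and sq: "\<And>n u. (\<integral>\<omega>. (u \<bullet> W n \<omega>)\<^sup>2 \<partial>P) = v n u"
    and lim: "\<And>u. (\<lambda>n. v n u) \<longlonglongrightarrow> u \<bullet> (S *v u)"
    and close: "\<And>e. 0 < e \<Longrightarrow> whp P (\<lambda>n \<omega>. norm (Y n \<omega> - W n \<omega>) \<le> e * (1 + norm (W n \<omega>)))"
  shows "converges_in_distribution P Y (multivariate_normal 0 S)"
proof -
  interpret prob_space P by (rule P)
  define V where "V n = (\<Sum>j\<in>UNIV. v n (axis j 1))" for n
  define V0 where "V0 = (\<Sum>j\<in>UNIV. axis j 1 \<bullet> (S *v axis j 1))"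
  have Vlim: "V \<longlonglongrightarrow> V0" unfolding V_def V0_def by (intro tendsto_sum lim)
  have norm_sq: "(norm (W n \<omega>))\<^sup>2 = (\<Sum>j\<in>UNIV. (axis j 1 \<bullet> W n \<omega>)\<^sup>2)" for n \<omega>
  proof -
    have "axis j 1 \<bullet> W n \<omega> = W n \<omega> $ j" for j by (simp add: inner_axis')
    then show ?thesis
      unfolding power2_norm_eq_inner by (subst inner_vec_def) (simp add: power2_eq_square)
  qed
  have V_eq: "(\<integral>\<omega>. (norm (W n \<omega>))\<^sup>2 \<partial>P) = V n" for n
    unfolding norm_sq V_def by (subst Bochner_Integration.integral_sum) (auto simp: sq_int sq)
  have int_norm: "integrable P (\<lambda>\<omega>. (norm (W n \<omega>))\<^sup>2)" for n
    unfolding norm_sq by (intro Bochner_Integration.integrable_sum sq_int)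
  have tailW: "\<exists>L>0. \<forall>\<^sub>F n in sequentially. measure P {\<omega>\<in>space P. L < norm (W n \<omega>)} \<le> e" if "0 < e" for e
  proof -
    define L where "L = sqrt ((\<bar>V0\<bar> + 1) / e)"
    have L: "0 < L" "L\<^sup>2 = (\<bar>V0\<bar> + 1) / e" using that by (auto simp: L_def)
    have "\<forall>\<^sub>F n in sequentially. V n < \<bar>V0\<bar> + 1"
      by (rule order_tendstoD(2)[OF Vlim]) simp
    then have "\<forall>\<^sub>F n in sequentially. measure P {\<omega>\<in>space P. L < norm (W n \<omega>)} \<le> e"
    proof eventually_elim
      case (elim n)
      have "measure P {\<omega>\<in>space P. L < norm (W n \<omega>)} \<le> measure P {\<omega>\<in>space P. L\<^sup>2 \<le> (norm (W n \<omega>))\<^sup>2}"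
        using L(1) by (intro finite_measure_mono) (auto intro!: power_mono)
      also have "\<dots> \<le> (\<integral>\<omega>. (norm (W n \<omega>))\<^sup>2 \<partial>P) / L\<^sup>2"
        using L(1) by (intro integral_Markov_inequality_measure[OF int_norm, of "{}"]) auto
      also have "\<dots> \<le> (\<bar>V0\<bar> + 1) / L\<^sup>2"
        using elim by (intro divide_right_mono) (simp_all add: V_eq)
      also have "\<dots> = e" using that by (simp add: L(2) add_nonneg_pos[THEN less_imp_neq[THEN not_sym]])
      finally show ?case .
    qed
    with L show ?thesis by blast
  qed
  \<comment> \<open>Tightness of \<open>W\<close> turns the relative error bound into an absolute one off a small event.\<close>
  have main: "\<exists>L>0. \<forall>d>0. \<forall>\<^sub>F n in sequentially. \<exists>B\<in>sets P. measure P B \<le> e \<and>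
      (\<forall>\<omega>\<in>space P - B. norm (W n \<omega>) \<le> L \<and> norm (Y n \<omega> - W n \<omega>) \<le> d * (1 + L))" if "0 < e" for e
  proof -
    have e2: "0 < e / 2" using that by simp
    obtain L where L: "0 < L" "\<forall>\<^sub>F n in sequentially. measure P {\<omega>\<in>space P. L < norm (W n \<omega>)} \<le> e / 2"
      using tailW[OF e2] by blast
    have "\<forall>\<^sub>F n in sequentially. \<exists>B\<in>sets P. measure P B \<le> e \<and>
      (\<forall>\<omega>\<in>space P - B. norm (W n \<omega>) \<le> L \<and> norm (Y n \<omega> - W n \<omega>) \<le> d * (1 + L))" if "0 < d" for d
    proof -
      have "\<forall>\<^sub>F n in sequentially. \<exists>B\<in>sets P. measure P B \<le> e / 2 \<and>
          (\<forall>\<omega>\<in>space P - B. norm (Y n \<omega> - W n \<omega>) \<le> d * (1 + norm (W n \<omega>)))"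
        using close[OF that] e2 unfolding whp_def by blast
      with L(2) show ?thesis
      proof eventually_elim
        case (elim n)
        then obtain B where B: "B \<in> sets P" "measure P B \<le> e / 2"
          "\<And>\<omega>. \<omega> \<in> space P - B \<Longrightarrow> norm (Y n \<omega> - W n \<omega>) \<le> d * (1 + norm (W n \<omega>))" by blast
        define C where "C = {\<omega>\<in>space P. L < norm (W n \<omega>)}"
        have C: "C \<in> sets P" unfolding C_def by measurable
        have "measure P (B \<union> C) \<le> e"
          using measure_Un_le[OF B(1) C] B(2) elim(1) by (simp add: C_def)
        moreover have "norm (W n \<omega>) \<le> L \<and> norm (Y n \<omega> - W n \<omega>) \<le> d * (1 + L)"
          if \<omega>: "\<omega> \<in> space P - (B \<union> C)" for \<omega>
        proof
          show 1: "norm (W n \<omega>) \<le> L" using \<omega> by (auto simp: C_def)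
          have "norm (Y n \<omega> - W n \<omega>) \<le> d * (1 + norm (W n \<omega>))" using B(3) \<omega> by blast
          also have "\<dots> \<le> d * (1 + L)" using 1 \<open>0 < d\<close> by (intro mult_left_mono) auto
          finally show "norm (Y n \<omega> - W n \<omega>) \<le> d * (1 + L)" .
        qed
        ultimately show ?case using B(1) C by blast
      qed
    qed
    with L(1) show ?thesis by blast
  qed
  show ?thesis
  proof (rule converges_in_distribution_if_waves[OF P prob_space_multivariate_normal[OF S] _ Y])
    show "sets (multivariate_normal 0 S) = sets borel" by (simp add: multivariate_normal_def)
    show "(\<lambda>n. \<integral>\<omega>. cos (u \<bullet> Y n \<omega> + c) \<partial>P) \<longlonglongrightarrow> (\<integral>x. cos (u \<bullet> x + c) \<partial>multivariate_normal 0 S)" for u c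
    proof -
      have "(\<lambda>n. cos c * exp (- v n u / 2)) \<longlonglongrightarrow> cos c * exp (- (u \<bullet> (S *v u)) / 2)"
        by (intro tendsto_intros lim) simp
      then have W_lim: "(\<lambda>n. \<integral>\<omega>. cos (u \<bullet> W n \<omega> + c) \<partial>P) \<longlonglongrightarrow> (\<integral>x. cos (u \<bullet> x + c) \<partial>multivariate_normal 0 S)"
        by (simp only: wave multivariate_normal_wave[OF S])
      have "(\<lambda>n. (\<integral>\<omega>. cos (u \<bullet> Y n \<omega> + c) \<partial>P) - (\<integral>\<omega>. cos (u \<bullet> W n \<omega> + c) \<partial>P)) \<longlonglongrightarrow> 0"
      proof (rule tendstoI)
        fix r :: real assume "0 < r"
        then have r8: "0 < r / 8" by simp
        obtain L where L: "0 < L" "\<And>d. 0 < d \<Longrightarrow> \<forall>\<^sub>F n in sequentially. \<exists>B\<in>sets P. measure P B \<le> r / 8 \<and>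
          (\<forall>\<omega>\<in>space P - B. norm (W n \<omega>) \<le> L \<and> norm (Y n \<omega> - W n \<omega>) \<le> d * (1 + L))"
          using main[OF r8] by blast
        define d where "d = r / (4 * ((norm u + 1) * (1 + L)))"
        have d: "0 < d" using \<open>0 < r\<close> L(1) by (auto simp: d_def intro!: divide_pos_pos mult_pos_pos add_nonneg_pos)
        have dL: "(norm u + 1) * (d * (1 + L)) = r / 4"
        proof -
          have "(norm u + 1) * (1 + L) \<noteq> 0" using L(1) norm_ge_zero[of u] by (simp add: add_nonneg_eq_0_iff)
          then have "((norm u + 1) * (1 + L)) * d = r / 4" unfolding d_def by simp
          then show ?thesis by (simp only: mult_ac)
        qed
        show "\<forall>\<^sub>F n in sequentially. dist ((\<integral>\<omega>. cos (u \<bullet> Y n \<omega> + c) \<partial>P) - (\<integral>\<omega>. cos (u \<bullet> W n \<omega> + c) \<partial>P)) 0 < r"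
          using L(2)[OF d]
        proof eventually_elim
          case (elim n)
          then obtain B where B: "B \<in> sets P" "measure P B \<le> r / 8"
            "\<And>\<omega>. \<omega> \<in> space P - B \<Longrightarrow> norm (Y n \<omega> - W n \<omega>) \<le> d * (1 + L)" by blast
          have "\<bar>(\<integral>\<omega>. cos (u \<bullet> Y n \<omega> + c) \<partial>P) - (\<integral>\<omega>. cos (u \<bullet> W n \<omega> + c) \<partial>P)\<bar> \<le> r / 4 + 2 * measure P B"
          proof (rule integral_diff_le_off_event[OF P _ _ _ _ B(1)])
            show "(\<lambda>\<omega>. cos (u \<bullet> Y n \<omega> + c)) \<in> borel_measurable P" by measurable
            show "(\<lambda>\<omega>. cos (u \<bullet> W n \<omega> + c)) \<in> borel_measurable P" by measurable
            fix \<omega> assume \<omega>: "\<omega> \<in> space P - B"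
            have "\<bar>cos (u \<bullet> Y n \<omega> + c) - cos (u \<bullet> W n \<omega> + c)\<bar> \<le> \<bar>u \<bullet> (Y n \<omega> - W n \<omega>)\<bar>"
              using abs_cos_diff_le[of "u \<bullet> Y n \<omega> + c" "u \<bullet> W n \<omega> + c"] by (simp add: inner_diff_right)
            also have "\<dots> \<le> norm u * norm (Y n \<omega> - W n \<omega>)" by (rule Cauchy_Schwarz_ineq2)
            also have "\<dots> \<le> (norm u + 1) * (d * (1 + L))"
              using B(3)[OF \<omega>] by (intro mult_mono) auto
            finally show "\<bar>cos (u \<bullet> Y n \<omega> + c) - cos (u \<bullet> W n \<omega> + c)\<bar> \<le> r / 4" unfolding dL .
          qed (use \<open>0 < r\<close> in auto)
          then show ?case using B(2) \<open>0 < r\<close> unfolding dist_real_def by linarith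
        qed
      qed
      from tendsto_add[OF this W_lim] show ?thesis by simp
    qed
    show "\<exists>L. \<forall>\<^sub>F n in sequentially. measure P {\<omega>\<in>space P. norm (Y n \<omega>) > L} \<le> e" if "0 < e" for e
    proof -
      obtain L where L: "0 < L" "\<forall>d>0. \<forall>\<^sub>F n in sequentially. \<exists>B\<in>sets P. measure P B \<le> e \<and>
          (\<forall>\<omega>\<in>space P - B. norm (W n \<omega>) \<le> L \<and> norm (Y n \<omega> - W n \<omega>) \<le> d * (1 + L))"
        using main[OF \<open>0 < e\<close>] by blast
      from L(2)[rule_format, OF zero_less_one] have "\<forall>\<^sub>F n in sequentially. measure P {\<omega>\<in>space P. norm (Y n \<omega>) > L + 1 * (1 + L)} \<le> e"
      proof eventually_elim
        case (elim n)
        then obtain B where B: "B \<in> sets P" "measure P B \<le> e"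
          "\<And>\<omega>. \<omega> \<in> space P - B \<Longrightarrow> norm (W n \<omega>) \<le> L \<and> norm (Y n \<omega> - W n \<omega>) \<le> 1 * (1 + L)" by blast
        have "\<omega> \<in> B" if "\<omega> \<in> space P" "norm (Y n \<omega>) > L + 1 * (1 + L)" for \<omega>
        proof (rule ccontr)
          assume "\<omega> \<notin> B"
          then have "norm (W n \<omega>) \<le> L \<and> norm (Y n \<omega> - W n \<omega>) \<le> 1 * (1 + L)" using B(3) that(1) by blast
          then show False using norm_triangle_sub[of "Y n \<omega>" "W n \<omega>"] that(2) by linarith
        qed
        then have "{\<omega>\<in>space P. norm (Y n \<omega>) > L + 1 * (1 + L)} \<subseteq> B" by blast
        then show ?case using finite_measure_mono[OF _ B(1)] B(2) by (meson order_trans)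
      qed
      then show ?thesis by blast
    qed
  qed
qed

section \<open>Weighted sums of the noise\<close>

text \<open>The noise increments \<open>D n i\<close> enter only through the row-sum bound on their covariances. The
  weights below have \<open>\<Sum> c\<^sub>i\<^sup>2 = O(a\<^sub>n)\<close>, so weighted sums have standard deviation of order
  \<open>(a\<^sub>n h\<^sub>n\<^bsup>\<alpha>\<^esup>)\<^bsup>1/2\<^esup>\<close>, which is \<open>o(a\<^sub>n h\<^sub>n)\<close> precisely because \<open>a\<^sub>n h\<^sub>n\<^bsup>2 - \<alpha>\<^esup> \<rightarrow> \<infinity>\<close>.\<close>

locale weighted_noise =
  fixes P :: "'w measure" and D :: "nat \<Rightarrow> nat \<Rightarrow> 'w \<Rightarrow> real" and h a :: "nat \<Rightarrow> real"
    and \<alpha> C :: real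
  assumes P: "prob_space P"
    and gauss: "\<And>n. gaussian_family P {1..n} (D n)"
    and row: "\<And>n i. i \<in> {1..n} \<Longrightarrow>
      (\<Sum>j\<in>{1..n}. \<bar>covariance P (D n i) (D n j)\<bar>) \<le> C * h n powr \<alpha>"
    and C: "0 < C" and h: "\<And>n. 0 < h n"
    and a: "\<forall>\<^sub>F n in sequentially. 0 < a n"
    and rate: "filterlim (\<lambda>n. a n * h n powr (2 - \<alpha>)) at_top sequentially"
begin

lemma variance_le:
  assumes "(\<Sum>i\<in>{1..n}. (c i)\<^sup>2) \<le> V"
  shows "(\<integral>\<omega>. (\<Sum>i\<in>{1..n}. c i * D n i \<omega>)\<^sup>2 \<partial>P) \<le> C * h n powr \<alpha> * V"
proof -
  have "(\<integral>\<omega>. (\<Sum>i\<in>{1..n}. c i * D n i \<omega>)\<^sup>2 \<partial>P) \<le> C * h n powr \<alpha> * (\<Sum>i\<in>{1..n}. (c i)\<^sup>2)"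
    by (rule gaussian_family_variance_le[OF P gauss row])
  also have "\<dots> \<le> C * h n powr \<alpha> * V"
    using C by (intro mult_left_mono assms) simp
  finally show ?thesis .
qed

lemma ratio_tendsto_0: "(\<lambda>n. 1 / (a n * h n powr (2 - \<alpha>))) \<longlonglongrightarrow> 0"
  using tendsto_inverse_0_at_top[OF rate] by (simp add: inverse_eq_divide)

lemma ratio_eq:
  assumes "0 < a n" "0 < e"
  shows "(C * h n powr \<alpha> * (K * a n)) ^ m / (e * (a n * h n)) ^ (2 * m) =
    (C * K / e\<^sup>2) ^ m * (1 / (a n * h n powr (2 - \<alpha>))) ^ m"
proof -
  have "h n powr 2 = (h n)\<^sup>2" using h[of n] by (simp add: powr_numeral)
  then have "h n powr \<alpha> * h n powr (2 - \<alpha>) = (h n)\<^sup>2"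
    by (simp add: powr_add[symmetric])
  then have "C * h n powr \<alpha> * (K * a n) * (a n * h n powr (2 - \<alpha>)) = C * K * (a n * h n)\<^sup>2"
    by (simp add: power2_eq_square algebra_simps)
  then have "C * h n powr \<alpha> * (K * a n) = C * K * (a n * h n)\<^sup>2 / (a n * h n powr (2 - \<alpha>))"
    using assms h[of n] by (simp add: eq_divide_eq)
  then have "C * h n powr \<alpha> * (K * a n) / (e * (a n * h n))\<^sup>2 = C * K / e\<^sup>2 * (1 / (a n * h n powr (2 - \<alpha>)))"
    using assms h[of n] by (simp add: power_mult_distrib)
  then show ?thesis
    by (simp only: power_mult power_divide[symmetric] power_mult_distrib[symmetric])
qed

lemma noise_small:
  assumes c: "\<forall>\<^sub>F n in sequentially. (\<Sum>i\<in>{1..n}. (c n i)\<^sup>2) \<le> K * a n" and e: "0 < e"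
  shows "whp P (\<lambda>n \<omega>. \<bar>\<Sum>i\<in>{1..n}. c n i * D n i \<omega>\<bar> \<le> e * (a n * h n))"
proof (rule whp_if_tail_tendsto_0)
  interpret prob_space P by (rule P)
  let ?f = "\<lambda>n. (C * K / e\<^sup>2) ^ 1 * (1 / (a n * h n powr (2 - \<alpha>))) ^ 1"
  show "\<forall>\<^sub>F n in sequentially. \<exists>B\<in>sets P. measure P B \<le> ?f n \<and>
      (\<forall>\<omega>\<in>space P - B. \<bar>\<Sum>i\<in>{1..n}. c n i * D n i \<omega>\<bar> \<le> e * (a n * h n))"
    using c a
  proof eventually_elim
    case (elim n)
    let ?Y = "\<lambda>\<omega>. \<Sum>i\<in>{1..n}. c n i * D n i \<omega>"
    have Ym: "?Y \<in> borel_measurable P"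
      using gauss[of n] by (auto simp: gaussian_family_def gaussian_rv_def)
    have pos: "0 < e * (a n * h n)" using e elim(2) h[of n] by simp
    have var: "(\<integral>\<omega>. (?Y \<omega>)\<^sup>2 \<partial>P) \<le> C * h n powr \<alpha> * (K * a n)" using elim(1) by (rule variance_le)
    have int: "integrable P (\<lambda>\<omega>. (?Y \<omega>) ^ (2 * 1))"
      by (rule gaussian_family_moment_le(1)[OF P gauss order_refl])
    have "measure P {\<omega>\<in>space P. e * (a n * h n) < \<bar>?Y \<omega>\<bar>} \<le>
        (C * h n powr \<alpha> * (K * a n)) / (e * (a n * h n)) ^ (2 * 1)"
      using var by (intro moment_tail[OF int _ Ym pos]) simp
    also have "\<dots> = ?f n" using ratio_eq[OF elim(2) e, of K 1] by simp
    finally have "measure P {\<omega>\<in>space P. e * (a n * h n) < \<bar>?Y \<omega>\<bar>} \<le> ?f n" .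
    moreover have "{\<omega>\<in>space P. e * (a n * h n) < \<bar>?Y \<omega>\<bar>} \<in> sets P" using Ym by measurable
    ultimately show ?case
      by (intro bexI[of _ "{\<omega>\<in>space P. e * (a n * h n) < \<bar>?Y \<omega>\<bar>}"]) auto
  qed
  have "?f \<longlonglongrightarrow> (C * K / e\<^sup>2) ^ 1 * 0 ^ 1" by (intro tendsto_intros ratio_tendsto_0)
  then show "?f \<longlonglongrightarrow> 0" by simp
qed

lemma noise_uniformly_small:
  fixes c :: "nat \<Rightarrow> nat \<Rightarrow> real ^ 'p \<Rightarrow> real"
  assumes S: "compact S" "convex S" "S \<noteq> {}" and \<rho>: "0 < \<rho>"
    and cont: "\<And>n i. continuous_on S (c n i)"
    and lip: "\<And>n i x y. x \<in> S \<Longrightarrow> y \<in> S \<Longrightarrow> \<bar>c n i x - c n i y\<bar> \<le> L n i * norm (x - y) powr \<rho>"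
    and L: "\<forall>\<^sub>F n in sequentially. (\<Sum>i\<in>{1..n}. (L n i)\<^sup>2) \<le> K * a n" and e: "0 < e"
  shows "whp P (\<lambda>n \<omega>. \<forall>x\<in>S. \<forall>y\<in>S. \<bar>\<Sum>i\<in>{1..n}. (c n i x - c n i y) * D n i \<omega>\<bar> \<le> e * (a n * h n))"
proof -
  define m where "m = nat \<lceil>(CARD('p) + 1) / \<rho>\<rceil>"
  have m: "CARD('p) + 1 \<le> real m * \<rho>"
  proof -
    have "(CARD('p) + 1) / \<rho> \<le> real m" unfolding m_def by (rule real_nat_ceiling_ge)
    then show ?thesis using \<rho> by (simp add: pos_divide_le_eq)
  qed
  have "m \<noteq> 0" using m by (intro notI) simp
  obtain c0 where c0: "0 \<le> c0" and chain: "\<And>G A \<delta>. 0 < \<delta> \<Longrightarrow> 0 \<le> A \<Longrightarrow> (\<forall>x\<in>S. G x \<in> borel_measurable P) \<Longrightarrow>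
    (\<forall>\<omega>\<in>space P. continuous_on S (\<lambda>x. G x \<omega>)) \<Longrightarrow>
    (\<forall>x\<in>S. \<forall>y\<in>S. integrable P (\<lambda>\<omega>. (G x \<omega> - G y \<omega>) ^ (2 * m)) \<and>
       (\<integral>\<omega>. (G x \<omega> - G y \<omega>) ^ (2 * m) \<partial>P) \<le> A * norm (x - y) powr (2 * real m * \<rho>)) \<Longrightarrow>
    (\<exists>B\<in>sets P. measure P B \<le> c0 * A / \<delta> ^ (2 * m) \<and>
       (\<forall>\<omega>\<in>space P - B. \<forall>x\<in>S. \<forall>y\<in>S. \<bar>G x \<omega> - G y \<omega>\<bar> \<le> \<delta>))"
    using chaining_convex[OF S P \<rho> m] by blast
  define \<kappa> :: real where "\<kappa> = fact (2 * m) / (2 ^ m * fact m)"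
  have \<kappa>: "0 \<le> \<kappa>" by (simp add: \<kappa>_def)
  let ?f = "\<lambda>n. c0 * \<kappa> * ((C * K / e\<^sup>2) ^ m * (1 / (a n * h n powr (2 - \<alpha>))) ^ m)"
  show ?thesis
  proof (rule whp_if_tail_tendsto_0)
    show "\<forall>\<^sub>F n in sequentially. \<exists>B\<in>sets P. measure P B \<le> ?f n \<and>
      (\<forall>\<omega>\<in>space P - B. \<forall>x\<in>S. \<forall>y\<in>S. \<bar>\<Sum>i\<in>{1..n}. (c n i x - c n i y) * D n i \<omega>\<bar> \<le> e * (a n * h n))"
      using L a
    proof eventually_elim
      case (elim n)
      define G where "G x \<omega> = (\<Sum>i\<in>{1..n}. c n i x * D n i \<omega>)" for x \<omega>
      have Gdiff: "G x \<omega> - G y \<omega> = (\<Sum>i\<in>{1..n}. (c n i x - c n i y) * D n i \<omega>)" for x y \<omega>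
        by (simp add: G_def sum_subtractf left_diff_distrib)
      define V where "V = C * h n powr \<alpha> * (K * a n)"
      have "0 \<le> K * a n" using elim(1) sum_nonneg[of "{1..n}" "\<lambda>i. (L n i)\<^sup>2"] by simp
      then have V: "0 \<le> V" using C by (simp add: V_def)
      have pos: "0 < e * (a n * h n)" using e elim(2) h[of n] by simp
      have "\<exists>B\<in>sets P. measure P B \<le> c0 * (\<kappa> * V ^ m) / (e * (a n * h n)) ^ (2 * m) \<and>
        (\<forall>\<omega>\<in>space P - B. \<forall>x\<in>S. \<forall>y\<in>S. \<bar>G x \<omega> - G y \<omega>\<bar> \<le> e * (a n * h n))"
      proof (rule chain[OF pos])
        show "0 \<le> \<kappa> * V ^ m" using \<kappa> V by simp
        show "\<forall>x\<in>S. G x \<in> borel_measurable P"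
          using gauss[of n] by (auto simp: G_def[abs_def] gaussian_family_def gaussian_rv_def)
        show "\<forall>\<omega>\<in>space P. continuous_on S (\<lambda>x. G x \<omega>)"
          unfolding G_def by (intro ballI continuous_intros cont)
        show "\<forall>x\<in>S. \<forall>y\<in>S. integrable P (\<lambda>\<omega>. (G x \<omega> - G y \<omega>) ^ (2 * m)) \<and>
          (\<integral>\<omega>. (G x \<omega> - G y \<omega>) ^ (2 * m) \<partial>P) \<le> \<kappa> * V ^ m * norm (x - y) powr (2 * real m * \<rho>)"
        proof (intro ballI)
          fix x y assume xy: "x \<in> S" "y \<in> S"
          define N where "N = norm (x - y) powr \<rho>"
          have N2: "N\<^sup>2 ^ m = norm (x - y) powr (2 * real m * \<rho>)"
          proof (cases "x = y")
            case True
            then show ?thesis using \<open>m \<noteq> 0\<close> by (simp add: N_def)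
          next
            case False
            then have "0 < N" by (simp add: N_def)
            have "N\<^sup>2 ^ m = N powr real (2 * m)"
              using \<open>0 < N\<close> by (simp only: powr_realpow power_mult)
            also have "\<dots> = norm (x - y) powr (2 * real m * \<rho>)"
              unfolding N_def powr_powr by (simp add: mult_ac)
            finally show ?thesis .
          qed
          have "(\<Sum>i\<in>{1..n}. (c n i x - c n i y)\<^sup>2) \<le> (\<Sum>i\<in>{1..n}. (L n i)\<^sup>2 * N\<^sup>2)"
          proof (rule sum_mono)
            fix i
            have "\<bar>c n i x - c n i y\<bar>\<^sup>2 \<le> (L n i * N)\<^sup>2"
              using lip[OF xy] by (intro power_mono) (auto simp: N_def)
            then show "(c n i x - c n i y)\<^sup>2 \<le> (L n i)\<^sup>2 * N\<^sup>2" by (simp add: power_mult_distrib)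
          qed
          also have "\<dots> = (\<Sum>i\<in>{1..n}. (L n i)\<^sup>2) * N\<^sup>2" by (simp add: sum_distrib_right)
          also have "\<dots> \<le> K * a n * N\<^sup>2" using elim(1) by (intro mult_right_mono) auto
          finally have "(\<integral>\<omega>. (\<Sum>i\<in>{1..n}. (c n i x - c n i y) * D n i \<omega>)\<^sup>2 \<partial>P) \<le> C * h n powr \<alpha> * (K * a n * N\<^sup>2)"
            by (rule variance_le)
          then have var: "(\<integral>\<omega>. (\<Sum>i\<in>{1..n}. (c n i x - c n i y) * D n i \<omega>)\<^sup>2 \<partial>P) \<le> V * N\<^sup>2"
            by (simp only: V_def mult.assoc)
          show "integrable P (\<lambda>\<omega>. (G x \<omega> - G y \<omega>) ^ (2 * m)) \<and>
            (\<integral>\<omega>. (G x \<omega> - G y \<omega>) ^ (2 * m) \<partial>P) \<le> \<kappa> * V ^ m * norm (x - y) powr (2 * real m * \<rho>)"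
            using gaussian_family_moment_le[OF P gauss var, of m]
            unfolding Gdiff \<kappa>_def[symmetric] power_mult_distrib N2 mult.assoc by simp
        qed
      qed
      moreover have "c0 * (\<kappa> * V ^ m) / (e * (a n * h n)) ^ (2 * m) = ?f n"
        using ratio_eq[OF elim(2) e, of K m] by (simp only: V_def times_divide_eq_right[symmetric] mult.assoc)
      ultimately show ?case unfolding Gdiff by simp
    qed
    have "?f \<longlonglongrightarrow> c0 * \<kappa> * ((C * K / e\<^sup>2) ^ m * 0 ^ m)" by (intro tendsto_intros ratio_tendsto_0)
    then show "?f \<longlonglongrightarrow> 0" using \<open>m \<noteq> 0\<close> by (simp add: power_0_left)
  qed
qed

end

section \<open>Deterministic estimates\<close>

lemma norm_matrix_vector_mult_le: "norm (A *v x) \<le> norm A * norm (x :: real ^ 'n)" for A :: "real ^ 'n ^ 'm"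
proof -
  have "norm (A *v x) = L2_set (\<lambda>i. \<bar>A $ i \<bullet> x\<bar>) UNIV"
    by (simp add: norm_vec_def matrix_vector_mul_component)
  also have "\<dots> \<le> L2_set (\<lambda>i. norm (A $ i) * norm x) UNIV"
    by (intro L2_set_mono Cauchy_Schwarz_ineq2) auto
  also have "\<dots> = norm A * norm x"
    by (simp add: norm_vec_def L2_set_left_distrib)
  finally show ?thesis .
qed

lemma matrix_vector_mult_outer: "outer u v *v x = (v \<bullet> x) *\<^sub>R u"
  by (simp add: outer_def matrix_vector_mult_def inner_vec_def vec_eq_iff sum_distrib_left mult_ac)

lemma matrix_vector_mult_sum_left:
  fixes A :: "'i \<Rightarrow> real ^ 'n ^ 'm"
  assumes "finite I"
  shows "(\<Sum>i\<in>I. A i) *v x = (\<Sum>i\<in>I. A i *v x)"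
  using assms by (induction rule: finite_induct) (auto simp: matrix_vector_mult_add_rdistrib)

lemma lipschitz_of_derivative_bound:
  assumes der: "\<And>t. 0 \<le> t \<Longrightarrow> \<exists>d. (f has_real_derivative d) (at t within {0..}) \<and> \<bar>d\<bar> \<le> C"
    and "0 \<le> s" "0 \<le> t"
  shows "\<bar>f t - f s\<bar> \<le> C * \<bar>t - s\<bar>"
proof -
  obtain f' where f': "\<And>t. 0 \<le> t \<Longrightarrow> (f has_real_derivative f' t) (at t within {0..}) \<and> \<bar>f' t\<bar> \<le> C"
    using der by metis
  have "norm (f t - f s) \<le> C * norm (t - s)"
    by (rule field_differentiable_bound[of "{0..}" f f']) (use f' assms(2,3) in auto)
  then show ?thesis by simp
qed

lemma drift_increment_error:
  assumes der: "\<And>t. 0 \<le> t \<Longrightarrow> \<exists>d. (f has_real_derivative d) (at t within {0..}) \<and> \<bar>d\<bar> \<le> C"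
    and int: "set_integrable lborel {0..t} f" and "0 \<le> s" "s \<le> t"
  shows "\<bar>set_lebesgue_integral lborel {0..t} f - set_lebesgue_integral lborel {0..s} f - f s * (t - s)\<bar>
    \<le> C * (t - s)\<^sup>2"
proof -
  have int1: "set_integrable lborel {0..s} f" "set_integrable lborel {s<..t} f"
    using assms(3,4) by (auto intro: set_integrable_subset[OF int])
  have disj: "{0..s} \<inter> {s<..t} = {}" by auto
  have "{0..t} = {0..s} \<union> {s<..t}" using assms(3,4) by auto
  then have 1: "set_lebesgue_integral lborel {0..t} f =
      set_lebesgue_integral lborel {0..s} f + set_lebesgue_integral lborel {s<..t} f"
    using set_integral_Un[OF disj int1] by simp
  have const: "set_integrable lborel {s<..t} (\<lambda>_. k)" "set_lebesgue_integral lborel {s<..t} (\<lambda>_. k) = k * (t - s)"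
    for k :: real
    using assms(4) by (simp_all add: set_integrable_def set_lebesgue_integral_def)
  have "set_lebesgue_integral lborel {s<..t} f - f s * (t - s) = set_lebesgue_integral lborel {s<..t} (\<lambda>x. f x - f s)"
    using int1(2) const[of "f s"] by (subst set_integral_diff(2)) auto
  moreover have "\<bar>set_lebesgue_integral lborel {s<..t} (\<lambda>x. f x - f s)\<bar> \<le> set_lebesgue_integral lborel {s<..t} (\<lambda>x. \<bar>f x - f s\<bar>)"
    using set_integral_norm_bound[OF set_integral_diff(1)[OF int1(2) const(1)[of "f s"]]] by simp
  moreover have "\<dots> \<le> set_lebesgue_integral lborel {s<..t} (\<lambda>_. C * (t - s))"
  proof (rule set_integral_mono)
    show "set_integrable lborel {s<..t} (\<lambda>x. \<bar>f x - f s\<bar>)"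
      using set_integral_diff(1)[OF int1(2) const(1)] by (rule set_integrable_abs)
    show "set_integrable lborel {s<..t} (\<lambda>_. C * (t - s))" by (rule const)
    fix x assume x: "x \<in> {s<..t}"
    have "0 \<le> C" using der[of 0] abs_ge_zero order_trans by blast
    have "\<bar>f x - f s\<bar> \<le> C * \<bar>x - s\<bar>"
      by (rule lipschitz_of_derivative_bound[OF der]) (use x assms(3) in auto)
    also have "\<dots> \<le> C * (t - s)" using x \<open>0 \<le> C\<close> by (intro mult_left_mono) auto
    finally show "\<bar>f x - f s\<bar> \<le> C * (t - s)" .
  qed
  ultimately show ?thesis unfolding 1 const(2) by (simp add: power2_eq_square)
qed

text \<open>The contrast at a minimiser does not exceed its value at the true parameter. Written out,
  this bounds the squared distance of the regression functions by the noise they pick up.\<close>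

lemma minimal_contrast_inequality:
  fixes d D r :: "'i \<Rightarrow> real" and h \<kappa> R :: real
  assumes "finite I" and h: "0 < h"
    and min: "(\<Sum>i\<in>I. (D i + r i - h * d i)\<^sup>2) \<le> (\<Sum>i\<in>I. (D i + r i)\<^sup>2)"
    and noise: "\<bar>\<Sum>i\<in>I. d i * D i\<bar> \<le> \<kappa>" and r: "\<And>i. i \<in> I \<Longrightarrow> \<bar>r i\<bar> \<le> R"
  shows "(\<Sum>i\<in>I. (d i)\<^sup>2) \<le> 4 * \<kappa> / h + 4 * (card I * R\<^sup>2) / h\<^sup>2"
proof -
  have "(\<Sum>i\<in>I. (D i + r i - h * d i)\<^sup>2) =
      (\<Sum>i\<in>I. (D i + r i)\<^sup>2) - 2 * h * (\<Sum>i\<in>I. d i * D i) - 2 * h * (\<Sum>i\<in>I. d i * r i) + h\<^sup>2 * (\<Sum>i\<in>I. (d i)\<^sup>2)"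
    by (simp add: sum_distrib_left sum_subtractf[symmetric] sum.distrib[symmetric] power2_eq_square algebra_simps)
  with min have "h * (h * (\<Sum>i\<in>I. (d i)\<^sup>2)) \<le> h * (2 * (\<Sum>i\<in>I. d i * D i) + 2 * (\<Sum>i\<in>I. d i * r i))"
    by (simp add: power2_eq_square algebra_simps)
  then have 1: "h * (\<Sum>i\<in>I. (d i)\<^sup>2) \<le> 2 * (\<Sum>i\<in>I. d i * D i) + 2 * (\<Sum>i\<in>I. d i * r i)"
    using h by simp
  \<comment> \<open>Young's inequality, weighted so that half of \<open>h \<Sum> d\<^sub>i\<^sup>2\<close> is absorbed on the left.\<close>
  have "2 * (\<Sum>i\<in>I. d i * r i) \<le> (\<Sum>i\<in>I. h / 2 * (d i)\<^sup>2 + 2 / h * R\<^sup>2)"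
    unfolding sum_distrib_left
  proof (rule sum_mono)
    fix i assume i: "i \<in> I"
    have "0 \<le> (h * d i - 2 * r i)\<^sup>2" by simp
    then have "h * (2 * (d i * r i)) \<le> h * (h / 2 * (d i)\<^sup>2) + 2 * (r i)\<^sup>2"
      by (simp add: power2_eq_square algebra_simps)
    moreover have "(r i)\<^sup>2 \<le> R\<^sup>2" using power_mono[OF r[OF i], of 2] by simp
    moreover have "h * (2 / h * R\<^sup>2) = 2 * R\<^sup>2" using h by simp
    ultimately have "h * (2 * (d i * r i)) \<le> h * (h / 2 * (d i)\<^sup>2 + 2 / h * R\<^sup>2)"
      unfolding distrib_left by linarith
    then show "2 * (d i * r i) \<le> h / 2 * (d i)\<^sup>2 + 2 / h * R\<^sup>2" using h by simp
  qed
  also have "\<dots> = h / 2 * (\<Sum>i\<in>I. (d i)\<^sup>2) + card I * (2 / h * R\<^sup>2)"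
    by (simp add: sum.distrib sum_distrib_left)
  finally have "h / 2 * (\<Sum>i\<in>I. (d i)\<^sup>2) \<le> 2 * \<kappa> + card I * (2 / h * R\<^sup>2)"
    using 1 noise by linarith
  then have "2 / h * (h / 2 * (\<Sum>i\<in>I. (d i)\<^sup>2)) \<le> 2 / h * (2 * \<kappa> + card I * (2 / h * R\<^sup>2))"
    using h by (intro mult_left_mono) auto
  also have "2 / h * (h / 2 * (\<Sum>i\<in>I. (d i)\<^sup>2)) = (\<Sum>i\<in>I. (d i)\<^sup>2)" using h by simp
  also have "2 / h * (2 * \<kappa> + card I * (2 / h * R\<^sup>2)) = 4 * \<kappa> / h + 4 * (card I * R\<^sup>2) / h\<^sup>2"
    by (simp add: power2_eq_square distrib_left)
  finally show ?thesis .
qed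

lemma gradient_lipschitz:
  fixes g :: "real ^ 'p \<Rightarrow> real ^ 'p"
  assumes B: "convex B" and g: "\<And>x. x \<in> B \<Longrightarrow> (g has_derivative (\<lambda>v. H x *v v)) (at x within B)"
    and H: "\<And>x. x \<in> B \<Longrightarrow> norm (H x) \<le> N" and "x \<in> B" "y \<in> B"
  shows "norm (g x - g y) \<le> N * norm (x - y)"
proof (rule differentiable_bound[OF B g _ assms(4,5)])
  fix x assume x: "x \<in> B"
  have "norm (H x *v v) \<le> N * norm v" for v
    using norm_matrix_vector_mult_le[of "H x" v] H[OF x] mult_right_mono[OF H[OF x], of "norm v"] by simp
  then show "onorm (\<lambda>v. H x *v v) \<le> N" by (rule onorm_le)
qed

lemma second_order_bound:
  fixes f :: "real ^ 'p \<Rightarrow> real"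
  assumes B: "convex B" and f: "\<And>x. x \<in> B \<Longrightarrow> (f has_derivative (\<lambda>v. g x \<bullet> v)) (at x within B)"
    and g: "\<And>x y. x \<in> B \<Longrightarrow> y \<in> B \<Longrightarrow> norm (g x - g y) \<le> N * norm (x - y)"
    and xy: "x \<in> B" "y \<in> B" and "0 \<le> N"
  shows "\<bar>f x - f y - g y \<bullet> (x - y)\<bar> \<le> N * (norm (x - y))\<^sup>2"
proof -
  define T where "T = closed_segment y x"
  have T: "convex T" "T \<subseteq> B" "x \<in> T" "y \<in> T"
    using xy B by (auto simp: T_def closed_segment_subset)
  have "norm ((f x - g y \<bullet> x) - (f y - g y \<bullet> y)) \<le> (N * norm (x - y)) * norm (x - y)"
  proof (rule differentiable_bound[OF T(1) _ _ T(3,4)])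
    fix z assume z: "z \<in> T"
    show "((\<lambda>z. f z - g y \<bullet> z) has_derivative (\<lambda>v. (g z - g y) \<bullet> v)) (at z within T)"
      using has_derivative_subset[OF f T(2)] z T(2)
      by (auto intro!: derivative_eq_intros simp: inner_diff_left)
    have "norm (z - y) \<le> norm (x - y)"
      using segment_bound1[of z y x] z by (simp add: T_def norm_minus_commute)
    then have "norm (g z - g y) \<le> N * norm (x - y)"
      using g[of z y] z T(2) xy(2) \<open>0 \<le> N\<close> by (meson mult_left_mono order_trans subsetD)
    then have "\<bar>(g z - g y) \<bullet> v\<bar> \<le> N * norm (x - y) * norm v" for v
      using Cauchy_Schwarz_ineq2[of "g z - g y" v] mult_right_mono[of "norm (g z - g y)" "N * norm (x - y)" "norm v"]
      by simp
    then show "onorm (\<lambda>v. (g z - g y) \<bullet> v) \<le> N * norm (x - y)"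
      by (intro onorm_le) simp
  qed
  then show ?thesis by (simp add: inner_diff_right power2_eq_square algebra_simps)
qed

lemma contrast_first_order_condition:
  fixes m :: "'i \<Rightarrow> real ^ 'p \<Rightarrow> real"
  assumes "finite I" and \<Xi>: "open \<Xi>" "x \<in> \<Xi>" and h: "0 < h"
    and m: "\<And>i. i \<in> I \<Longrightarrow> (m i has_derivative (\<lambda>v. g i \<bullet> v)) (at x within closure \<Xi>)"
    and min: "\<And>y. y \<in> closure \<Xi> \<Longrightarrow> (\<Sum>i\<in>I. (c i - m i x * h)\<^sup>2) \<le> (\<Sum>i\<in>I. (c i - m i y * h)\<^sup>2)"
  shows "(\<Sum>i\<in>I. (c i - m i x * h) *\<^sub>R g i) = 0"
proof -
  let ?q = "\<lambda>y. \<Sum>i\<in>I. (c i - m i y * h)\<^sup>2"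
  let ?w = "\<Sum>i\<in>I. (c i - m i x * h) *\<^sub>R g i"
  have m': "(m i has_derivative (\<lambda>v. g i \<bullet> v)) (at x)" if "i \<in> I" for i
    using has_derivative_subset[OF m[OF that] closure_subset] at_within_open[OF \<Xi>(2,1)] by simp
  have "(?q has_derivative (\<lambda>v. \<Sum>i\<in>I. 2 * (c i - m i x * h) * (- ((g i \<bullet> v) * h)))) (at x)"
    by (rule has_derivative_sum) (auto intro!: derivative_eq_intros m')
  moreover have "\<forall>y\<in>\<Xi>. ?q x \<le> ?q y" using min closure_subset by blast
  ultimately have "(\<lambda>v. \<Sum>i\<in>I. 2 * (c i - m i x * h) * (- ((g i \<bullet> v) * h))) = (\<lambda>v. 0)"
    using differential_zero_maxmin[OF \<Xi>(2,1)] by blast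
  then have "(\<Sum>i\<in>I. 2 * (c i - m i x * h) * (- ((g i \<bullet> ?w) * h))) = 0" by (rule fun_cong)
  moreover have "(\<Sum>i\<in>I. 2 * (c i - m i x * h) * (- ((g i \<bullet> v) * h))) = - 2 * h * (?w \<bullet> v)" for v
    by (simp add: inner_sum_left sum_distrib_left sum_negf mult_ac)
  ultimately have "- 2 * h * (?w \<bullet> ?w) = 0" by metis
  then show ?thesis using h by simp
qed

text \<open>The normal equation, expanded around the true parameter. The noise term
  \<open>\<Sum> D\<^sub>i (g\<^sub>i - g0\<^sub>i)\<close> is only bounded by \<open>|\<theta>|\<close> times a quantity \<open>o(a h)\<close>, so it is absorbed by
  the linear term \<open>a h I \<theta>\<close>.\<close>

lemma normal_equation_expansion:
  fixes g g0 :: "'i \<Rightarrow> real ^ 'p" and I0 :: "real ^ 'p ^ 'p" and \<theta> :: "real ^ 'p"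
    and D r d N M :: "'i \<Rightarrow> real" and a h K R \<kappa> \<eta> :: real
  assumes I: "finite I" and a: "0 < a" and h: "0 < h" and K: "0 \<le> K" and R: "0 \<le> R"
    and eq: "(\<Sum>i\<in>I. (D i + r i - h * d i) *\<^sub>R g i) = 0"
    and g: "\<And>i. i \<in> I \<Longrightarrow> norm (g i - g0 i) \<le> N i * norm \<theta>"
    and d: "\<And>i. i \<in> I \<Longrightarrow> \<bar>d i - g0 i \<bullet> \<theta>\<bar> \<le> N i * (norm \<theta>)\<^sup>2"
    and M: "\<And>i. i \<in> I \<Longrightarrow> norm (g i) \<le> M i" "\<And>i. i \<in> I \<Longrightarrow> norm (g0 i) \<le> M i"
    and r: "\<And>i. i \<in> I \<Longrightarrow> \<bar>r i\<bar> \<le> R"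
    and noise: "norm (\<Sum>i\<in>I. D i *\<^sub>R (g i - g0 i)) \<le> \<kappa> * (a * h) * norm \<theta>"
    and NK: "(\<Sum>i\<in>I. (N i)\<^sup>2) \<le> K * a" and MK: "(\<Sum>i\<in>I. (M i)\<^sup>2) \<le> K * a"
    and I0: "norm ((1 / a) *\<^sub>R (\<Sum>i\<in>I. outer (g0 i) (g0 i)) - I0) \<le> \<eta>"
  shows "norm ((a * h) *\<^sub>R (I0 *v \<theta>) - (\<Sum>i\<in>I. D i *\<^sub>R g0 i)) \<le>
    a * h * norm \<theta> * (\<eta> + 2 * K * norm \<theta> + \<kappa>) + R * sqrt (card I * (K * a))"
proof -
  \<comment> \<open>The errors from \<open>I0\<close>, from linearising the regression, from the noise weighted with
    \<open>g - g0\<close>, and from the Euler scheme.\<close>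
  define T1 where "T1 = (a * h) *\<^sub>R ((I0 - (1 / a) *\<^sub>R (\<Sum>i\<in>I. outer (g0 i) (g0 i))) *v \<theta>)"
  define T2 where "T2 = h *\<^sub>R (\<Sum>i\<in>I. (g0 i \<bullet> \<theta>) *\<^sub>R g0 i - d i *\<^sub>R g i)"
  define T3 where "T3 = (\<Sum>i\<in>I. D i *\<^sub>R (g i - g0 i))"
  define T4 where "T4 = (\<Sum>i\<in>I. r i *\<^sub>R g i)"
  have e1: "T1 = (a * h) *\<^sub>R (I0 *v \<theta>) - h *\<^sub>R (\<Sum>i\<in>I. (g0 i \<bullet> \<theta>) *\<^sub>R g0 i)"
    using a by (simp add: T1_def matrix_vector_mult_diff_rdistrib scaleR_matrix_vector_assoc[symmetric]
        matrix_vector_mult_sum_left[OF I] matrix_vector_mult_outer scaleR_diff_right)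
  have e2: "T2 = h *\<^sub>R (\<Sum>i\<in>I. (g0 i \<bullet> \<theta>) *\<^sub>R g0 i) - (\<Sum>i\<in>I. (h * d i) *\<^sub>R g i)"
    by (simp add: T2_def sum_subtractf scaleR_diff_right scaleR_sum_right)
  have e3: "T3 = (\<Sum>i\<in>I. D i *\<^sub>R g i) - (\<Sum>i\<in>I. D i *\<^sub>R g0 i)"
    by (simp add: T3_def scaleR_diff_right sum_subtractf)
  have e4: "(\<Sum>i\<in>I. D i *\<^sub>R g i) + T4 - (\<Sum>i\<in>I. (h * d i) *\<^sub>R g i) = 0"
    using eq by (simp add: T4_def scaleR_left_diff_distrib scaleR_add_left sum.distrib sum_subtractf)
  have split: "(a * h) *\<^sub>R (I0 *v \<theta>) - (\<Sum>i\<in>I. D i *\<^sub>R g0 i) = T1 + T2 + T3 + T4"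
    using e4 unfolding e1 e2 e3 by (simp add: algebra_simps)
  have "norm (T1 + T2 + T3 + T4) \<le> norm T1 + norm T2 + norm T3 + norm T4"
    by (intro norm_triangle_le add_mono order_refl)
  moreover have "norm T1 \<le> a * h * (\<eta> * norm \<theta>)"
  proof -
    have "norm ((I0 - (1 / a) *\<^sub>R (\<Sum>i\<in>I. outer (g0 i) (g0 i))) *v \<theta>) \<le> \<eta> * norm \<theta>"
      using I0 by (intro order_trans[OF norm_matrix_vector_mult_le] mult_right_mono)
        (simp_all add: norm_minus_commute)
    then show ?thesis using a h by (simp add: T1_def)
  qed
  moreover have "norm T2 \<le> h * (2 * (K * a) * (norm \<theta>)\<^sup>2)"
  proof -
    have "norm (\<Sum>i\<in>I. (g0 i \<bullet> \<theta>) *\<^sub>R g0 i - d i *\<^sub>R g i) \<le> (\<Sum>i\<in>I. ((N i)\<^sup>2 + (M i)\<^sup>2) * (norm \<theta>)\<^sup>2)"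
    proof (rule sum_norm_le)
      fix i assume i: "i \<in> I"
      have M0: "0 \<le> M i" using M(1)[OF i] norm_ge_zero order_trans by blast
      have "(g0 i \<bullet> \<theta>) *\<^sub>R g0 i - d i *\<^sub>R g i = (g0 i \<bullet> \<theta> - d i) *\<^sub>R g i - (g0 i \<bullet> \<theta>) *\<^sub>R (g i - g0 i)"
        by (simp add: algebra_simps)
      then have "norm ((g0 i \<bullet> \<theta>) *\<^sub>R g0 i - d i *\<^sub>R g i) \<le>
          \<bar>g0 i \<bullet> \<theta> - d i\<bar> * norm (g i) + \<bar>g0 i \<bullet> \<theta>\<bar> * norm (g i - g0 i)"
        using norm_triangle_ineq4[of "(g0 i \<bullet> \<theta> - d i) *\<^sub>R g i" "(g0 i \<bullet> \<theta>) *\<^sub>R (g i - g0 i)"] by simp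
      also have "\<dots> \<le> (N i * (norm \<theta>)\<^sup>2) * M i + (M i * norm \<theta>) * (N i * norm \<theta>)"
      proof (intro add_mono mult_mono)
        show "\<bar>g0 i \<bullet> \<theta> - d i\<bar> \<le> N i * (norm \<theta>)\<^sup>2" using d[OF i] by (simp add: abs_minus_commute)
        then show "0 \<le> N i * (norm \<theta>)\<^sup>2" by (rule order_trans[OF abs_ge_zero])
        show "\<bar>g0 i \<bullet> \<theta>\<bar> \<le> M i * norm \<theta>"
          using Cauchy_Schwarz_ineq2[of "g0 i" \<theta>] mult_right_mono[OF M(2)[OF i], of "norm \<theta>"] by simp
        then show "0 \<le> M i * norm \<theta>" by (rule order_trans[OF abs_ge_zero])
      qed (use M(1)[OF i] g[OF i] in auto)
      also have "\<dots> = (2 * N i * M i) * (norm \<theta>)\<^sup>2" by (simp add: power2_eq_square)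
      also have "\<dots> \<le> ((N i)\<^sup>2 + (M i)\<^sup>2) * (norm \<theta>)\<^sup>2"
        by (intro mult_right_mono sum_squares_bound) simp
      finally show "norm ((g0 i \<bullet> \<theta>) *\<^sub>R g0 i - d i *\<^sub>R g i) \<le> ((N i)\<^sup>2 + (M i)\<^sup>2) * (norm \<theta>)\<^sup>2" .
    qed
    also have "\<dots> = ((\<Sum>i\<in>I. (N i)\<^sup>2) + (\<Sum>i\<in>I. (M i)\<^sup>2)) * (norm \<theta>)\<^sup>2"
      by (simp add: sum_distrib_right[symmetric] sum.distrib)
    also have "\<dots> \<le> (2 * (K * a)) * (norm \<theta>)\<^sup>2"
      using NK MK by (intro mult_right_mono) auto
    finally show ?thesis using h by (simp add: T2_def)
  qed
  moreover have "norm T4 \<le> R * sqrt (card I * (K * a))"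
  proof -
    have "norm T4 \<le> (\<Sum>i\<in>I. R * M i)"
      unfolding T4_def
    proof (rule sum_norm_le)
      fix i assume i: "i \<in> I"
      show "norm (r i *\<^sub>R g i) \<le> R * M i" using r[OF i] M(1)[OF i] R by (auto intro: mult_mono)
    qed
    also have "\<dots> = R * (\<Sum>i\<in>I. M i)" by (simp add: sum_distrib_left)
    also have "(\<Sum>i\<in>I. M i) \<le> sqrt (card I * (K * a))"
    proof (rule real_le_rsqrt)
      have "(\<Sum>i\<in>I. M i)\<^sup>2 \<le> card I * (\<Sum>i\<in>I. (M i)\<^sup>2)"
        using sum_squared_le_sum_of_squares[of M I] by (simp add: mult.commute)
      also have "\<dots> \<le> card I * (K * a)" using MK by (intro mult_left_mono) auto
      finally show "(\<Sum>i\<in>I. M i)\<^sup>2 \<le> card I * (K * a)" .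
    qed
    finally show ?thesis using R by (simp add: mult_left_mono)
  qed
  ultimately have "norm ((a * h) *\<^sub>R (I0 *v \<theta>) - (\<Sum>i\<in>I. D i *\<^sub>R g0 i)) \<le>
     a * h * (\<eta> * norm \<theta>) + h * (2 * (K * a) * (norm \<theta>)\<^sup>2) + \<kappa> * (a * h) * norm \<theta> + R * sqrt (card I * (K * a))"
    using noise unfolding split T3_def by linarith
  also have "\<dots> = a * h * norm \<theta> * (\<eta> + 2 * K * norm \<theta> + \<kappa>) + R * sqrt (card I * (K * a))"
    by (simp add: power2_eq_square algebra_simps)
  finally show ?thesis .
qed

text \<open>An error proportional to the unknown \<open>Y\<close> is converted into one proportional to the
  approximate solution \<open>J *v T\<close>, by absorbing half of \<open>norm (Y - J *v T)\<close> on the left.\<close>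

lemma relative_error_of_linear_equation:
  fixes Y T :: "real ^ 'p" and J I0 :: "real ^ 'p ^ 'p"
  assumes J: "J ** I0 = mat 1" and k: "0 \<le> k" "k \<le> 1 / 2"
    and eq: "norm (I0 *v Y - T) \<le> \<epsilon> * norm Y + \<delta>"
    and small: "norm J * \<epsilon> \<le> k" "norm J * \<delta> \<le> k"
  shows "norm (Y - J *v T) \<le> 2 * k * (1 + norm (J *v T))"
proof -
  have "Y - J *v T = J *v (I0 *v Y - T)"
    by (simp add: matrix_vector_mult_diff_distrib matrix_vector_mul_assoc J)
  then have "norm (Y - J *v T) \<le> norm J * norm (I0 *v Y - T)"
    using norm_matrix_vector_mult_le[of J "I0 *v Y - T"] by simp
  also have "\<dots> \<le> norm J * (\<epsilon> * norm Y + \<delta>)" using eq by (intro mult_left_mono) auto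
  also have "\<dots> = (norm J * \<epsilon>) * norm Y + norm J * \<delta>" by (simp add: algebra_simps)
  also have "\<dots> \<le> k * norm Y + k" using small by (intro add_mono mult_right_mono) auto
  also have "\<dots> \<le> k * (norm (J *v T) + norm (Y - J *v T)) + k"
    using norm_triangle_sub[of Y "J *v T"] k(1) by (intro add_right_mono mult_left_mono) auto
  finally have "norm (Y - J *v T) \<le> k * (1 + norm (J *v T)) + k * norm (Y - J *v T)"
    by (simp add: algebra_simps)
  moreover have "k * norm (Y - J *v T) \<le> 1 / 2 * norm (Y - J *v T)"
    using k(2) by (intro mult_right_mono) auto
  ultimately have "norm (Y - J *v T) \<le> 2 * (k * (1 + norm (J *v T)))" by linarith
  then show ?thesis by (simp add: mult.assoc)
qed

section \<open>The least squares estimator\<close>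

text \<open>The regression model behind the contrast function: \<open>m n i \<xi>\<close> is the drift at the \<open>i\<close>-th
  observation time, \<open>g\<close> and \<open>H\<close> are its gradient and Hessian, \<open>x\<close> are the observed increments
  and \<open>r\<close> is the error of the Euler approximation of the drift integral.\<close>

locale drift_estimation = weighted_noise P D h a \<alpha> C
  for P :: "'w measure" and D h a \<alpha> C +
  fixes \<Xi> :: "(real ^ 'p) set" and \<xi>0 :: "real ^ 'p"
    and m :: "nat \<Rightarrow> nat \<Rightarrow> real ^ 'p \<Rightarrow> real"
    and g :: "nat \<Rightarrow> nat \<Rightarrow> real ^ 'p \<Rightarrow> real ^ 'p"
    and H :: "nat \<Rightarrow> nat \<Rightarrow> real ^ 'p \<Rightarrow> real ^ 'p ^ 'p"
    and x :: "nat \<Rightarrow> nat \<Rightarrow> 'w \<Rightarrow> real" and r M :: "nat \<Rightarrow> nat \<Rightarrow> real"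
    and \<xi>hat :: "nat \<Rightarrow> 'w \<Rightarrow> real ^ 'p" and K Cr :: real
  assumes \<Xi>: "open \<Xi>" "bounded \<Xi>" "convex \<Xi>" "\<xi>0 \<in> \<Xi>"
    and obs: "\<And>n i \<omega>. \<omega> \<in> space P \<Longrightarrow> i \<in> {1..n} \<Longrightarrow> x n i \<omega> = D n i \<omega> + r n i + m n i \<xi>0 * h n"
    and r: "\<And>n i. i \<in> {1..n} \<Longrightarrow> \<bar>r n i\<bar> \<le> Cr * (h n)\<^sup>2" and Cr: "0 \<le> Cr"
    and \<xi>hat_in: "\<And>n \<omega>. \<omega> \<in> space P \<Longrightarrow> \<xi>hat n \<omega> \<in> closure \<Xi>"
    and \<xi>hat_min: "\<And>n \<omega> \<eta>. \<omega> \<in> space P \<Longrightarrow> \<eta> \<in> closure \<Xi> \<Longrightarrow>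
      (\<Sum>i\<in>{1..n}. (x n i \<omega> - m n i (\<xi>hat n \<omega>) * h n)\<^sup>2) \<le> (\<Sum>i\<in>{1..n}. (x n i \<omega> - m n i \<eta> * h n)\<^sup>2)"
    and m_der: "\<And>n i \<xi>. \<xi> \<in> closure \<Xi> \<Longrightarrow> (m n i has_derivative (\<lambda>v. g n i \<xi> \<bullet> v)) (at \<xi> within closure \<Xi>)"
    and g_der: "\<And>n i \<xi>. \<xi> \<in> closure \<Xi> \<Longrightarrow> (g n i has_derivative (\<lambda>v. H n i \<xi> *v v)) (at \<xi> within closure \<Xi>)"
    and H_cont: "\<And>n i. continuous_on (closure \<Xi>) (H n i)"
    and M: "\<And>n i \<xi>. \<xi> \<in> closure \<Xi> \<Longrightarrow> norm (g n i \<xi>) \<le> M n i"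
    and K: "0 \<le> K" and MK: "\<forall>\<^sub>F n in sequentially. (\<Sum>i\<in>{1..n}. (M n i)\<^sup>2) \<le> K * a n"
begin

lemma closure_facts: "compact (closure \<Xi>)" "convex (closure \<Xi>)" "\<xi>0 \<in> closure \<Xi>"
  using \<Xi> by (auto simp: compact_closure convex_closure intro: closure_subset[THEN subsetD])

text \<open>The minimal contrast inequality controls the mean square distance of the drifts at
  \<open>\<xi>hat\<close> and \<open>\<xi>0\<close> by the noise, uniformly small by chaining, and identifiability turns this
  into a bound on \<open>\<xi>hat - \<xi>0\<close>.\<close>

lemma consistent:
  assumes Q: "continuous_on (closure \<Xi>) Q" "\<And>\<xi>. \<xi> \<in> closure \<Xi> \<Longrightarrow> 0 \<le> Q \<xi>"
      "\<And>\<xi>. \<xi> \<in> closure \<Xi> \<Longrightarrow> Q \<xi> = 0 \<longleftrightarrow> \<xi> = \<xi>0"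
    and lim: "uniform_limit (closure \<Xi>) (\<lambda>n \<xi>. 1 / a n * (\<Sum>i\<in>{1..n}. (m n i \<xi> - m n i \<xi>0)\<^sup>2)) Q sequentially"
    and nh: "(\<lambda>n. real n * (h n)\<^sup>2 / a n) \<longlonglongrightarrow> 0" and \<delta>: "0 < \<delta>"
  shows "whp P (\<lambda>n \<omega>. norm (\<xi>hat n \<omega> - \<xi>0) < \<delta>)"
proof -
  let ?S = "closure \<Xi>"
  define T where "T = ?S \<inter> {\<xi>. \<delta> \<le> norm (\<xi> - \<xi>0)}"
  have T: "compact T"
    unfolding T_def using closure_facts(1)
    by (intro compact_Int_closed closed_Collect_le continuous_intros)
  have "\<exists>q>0. \<forall>\<xi>\<in>T. q \<le> Q \<xi>"
  proof (cases "T = {}")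
    case False
    have "continuous_on T Q" using Q(1) by (rule continuous_on_subset) (auto simp: T_def)
    then obtain \<eta> where \<eta>: "\<eta> \<in> T" "\<forall>\<xi>\<in>T. Q \<eta> \<le> Q \<xi>"
      using continuous_attains_inf[OF T False] by blast
    then have "\<eta> \<in> ?S" "\<eta> \<noteq> \<xi>0" using \<delta> by (auto simp: T_def)
    then have "0 < Q \<eta>" using Q(2,3)[of \<eta>] by (simp add: order_less_le)
    with \<eta> show ?thesis by blast
  qed (auto intro: exI[of _ 1])
  then obtain q where q: "0 < q" "\<And>\<xi>. \<xi> \<in> T \<Longrightarrow> q \<le> Q \<xi>" by blast
  have noise: "whp P (\<lambda>n \<omega>. \<forall>\<xi>\<in>?S. \<forall>\<eta>\<in>?S.
      \<bar>\<Sum>i\<in>{1..n}. (m n i \<xi> - m n i \<eta>) * D n i \<omega>\<bar> \<le> q / 32 * (a n * h n))"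
  proof (rule noise_uniformly_small[OF closure_facts(1,2) _ zero_less_one _ _ MK])
    show "?S \<noteq> {}" using closure_facts(3) by auto
    show "0 < q / 32" using q by simp
    show "continuous_on ?S (m n i)" for n i
      using m_der by (rule has_derivative_continuous_on)
    show "\<bar>m n i \<xi> - m n i \<eta>\<bar> \<le> M n i * norm (\<xi> - \<eta>) powr 1" if "\<xi> \<in> ?S" "\<eta> \<in> ?S" for n i \<xi> \<eta>
    proof -
      have "norm (m n i \<xi> - m n i \<eta>) \<le> M n i * norm (\<xi> - \<eta>)"
      proof (rule differentiable_bound[OF closure_facts(2) m_der _ that])
        fix \<zeta> assume \<zeta>: "\<zeta> \<in> ?S"
        have "\<bar>g n i \<zeta> \<bullet> v\<bar> \<le> M n i * norm v" for v
          using Cauchy_Schwarz_ineq2[of "g n i \<zeta>" v] mult_right_mono[OF M[OF \<zeta>], of "norm v" n i] by simp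
        then show "onorm (\<lambda>v. g n i \<zeta> \<bullet> v) \<le> M n i" by (intro onorm_le) simp
      qed
      then show ?thesis by simp
    qed
  qed
  have "(\<lambda>n. 4 * Cr\<^sup>2 * (real n * (h n)\<^sup>2 / a n)) \<longlonglongrightarrow> 4 * Cr\<^sup>2 * 0"
    by (intro tendsto_intros nh)
  then have ev1: "\<forall>\<^sub>F n in sequentially. 4 * Cr\<^sup>2 * (real n * (h n)\<^sup>2 / a n) < q / 4"
    using q(1) by (intro order_tendstoD(2)) auto
  have "0 < q / 2" using q by simp
  then have ev2: "\<forall>\<^sub>F n in sequentially. \<forall>\<xi>\<in>?S.
      dist (1 / a n * (\<Sum>i\<in>{1..n}. (m n i \<xi> - m n i \<xi>0)\<^sup>2)) (Q \<xi>) < q / 2"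
    using lim unfolding uniform_limit_iff by blast
  show ?thesis
  proof (rule whp_mono[OF noise], use ev1 ev2 a in eventually_elim, intro ballI impI, rule ccontr)
    fix n \<omega>
    assume e1: "4 * Cr\<^sup>2 * (real n * (h n)\<^sup>2 / a n) < q / 4"
      and e2: "\<forall>\<xi>\<in>?S. dist (1 / a n * (\<Sum>i\<in>{1..n}. (m n i \<xi> - m n i \<xi>0)\<^sup>2)) (Q \<xi>) < q / 2"
      and an: "0 < a n" and \<omega>: "\<omega> \<in> space P"
      and ns: "\<forall>\<xi>\<in>?S. \<forall>\<eta>\<in>?S. \<bar>\<Sum>i\<in>{1..n}. (m n i \<xi> - m n i \<eta>) * D n i \<omega>\<bar> \<le> q / 32 * (a n * h n)"
      and far: "\<not> norm (\<xi>hat n \<omega> - \<xi>0) < \<delta>"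
    let ?d = "\<lambda>i. m n i (\<xi>hat n \<omega>) - m n i \<xi>0"
    have hat: "\<xi>hat n \<omega> \<in> ?S" by (rule \<xi>hat_in[OF \<omega>])
    then have "\<xi>hat n \<omega> \<in> T" using far by (simp add: T_def)
    then have "q / 2 < 1 / a n * (\<Sum>i\<in>{1..n}. (?d i)\<^sup>2)"
      using q(2)[of "\<xi>hat n \<omega>"] e2[rule_format, OF hat] unfolding dist_real_def by linarith
    moreover have "(\<Sum>i\<in>{1..n}. (?d i)\<^sup>2) \<le> 4 * (q / 32 * (a n * h n)) / h n + 4 * (card {1..n} * (Cr * (h n)\<^sup>2)\<^sup>2) / (h n)\<^sup>2"
    proof (rule minimal_contrast_inequality[OF _ h])
      have xr: "x n i \<omega> - m n i \<eta> * h n = D n i \<omega> + r n i - h n * (m n i \<eta> - m n i \<xi>0)" if "i \<in> {1..n}" for i \<eta>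
        using obs[OF \<omega> that] by (simp add: algebra_simps)
      show "(\<Sum>i\<in>{1..n}. (D n i \<omega> + r n i - h n * ?d i)\<^sup>2) \<le> (\<Sum>i\<in>{1..n}. (D n i \<omega> + r n i)\<^sup>2)"
        using \<xi>hat_min[OF \<omega> closure_facts(3), of n] by (simp add: xr cong: sum.cong_simp)
      show "\<bar>\<Sum>i\<in>{1..n}. ?d i * D n i \<omega>\<bar> \<le> q / 32 * (a n * h n)" using ns hat closure_facts(3) by blast
    qed (use r in auto)
    moreover have "4 * (q / 32 * (a n * h n)) / h n = a n * (q / 8)" using h[of n] by simp
    moreover have "4 * (card {1..n} * (Cr * (h n)\<^sup>2)\<^sup>2) / (h n)\<^sup>2 = a n * (4 * Cr\<^sup>2 * (real n * (h n)\<^sup>2 / a n))"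
      using h[of n] an by (simp add: power_mult_distrib power2_eq_square)
    moreover have "a n * (4 * Cr\<^sup>2 * (real n * (h n)\<^sup>2 / a n)) \<le> a n * (q / 4)"
      using e1 an by (intro mult_left_mono) auto
    ultimately have "q / 2 < 1 / a n * (\<Sum>i\<in>{1..n}. (?d i)\<^sup>2)" "(\<Sum>i\<in>{1..n}. (?d i)\<^sup>2) \<le> a n * (q / 8) + a n * (q / 4)"
      by linarith+
    then have "a n * (q / 2) < a n * (q / 8) + a n * (q / 4)" using an by (simp add: field_simps)
    also have "\<dots> = a n * (q * 3 / 8)" by (simp add: algebra_simps)
    finally show False using an q(1) by simp
  qed
qed

end

lemma norm_matrix_le_sum: "norm A \<le> (\<Sum>j\<in>UNIV. \<Sum>k\<in>UNIV. \<bar>A $ j $ k\<bar>)" for A :: "real ^ 'n ^ 'm"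
proof -
  have "norm A \<le> (\<Sum>j\<in>UNIV. norm (A $ j))"
    unfolding norm_vec_def[of A] by (rule L2_set_le_sum) simp
  also have "\<dots> \<le> (\<Sum>j\<in>UNIV. \<Sum>k\<in>UNIV. \<bar>A $ j $ k\<bar>)"
    by (intro sum_mono norm_le_l1_cart)
  finally show ?thesis .
qed

locale smooth_drift_estimation = drift_estimation P D h a \<alpha> C \<Xi> \<xi>0 m g H x r M \<xi>hat K Cr
  for P :: "'w measure" and D h a \<alpha> C and \<Xi> :: "(real ^ 'p) set" and \<xi>0 m g H x r M \<xi>hat K Cr +
  fixes B :: "(real ^ 'p) set" and N L :: "nat \<Rightarrow> nat \<Rightarrow> real" and \<rho> :: real and I0 :: "real ^ 'p ^ 'p"
  assumes B: "compact B" "convex B" "\<xi>0 \<in> interior B" "B \<subseteq> \<Xi>"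
    and N: "\<And>n i \<xi>. \<xi> \<in> B \<Longrightarrow> norm (H n i \<xi>) \<le> N n i"
    and L: "\<And>n i \<xi> \<eta>. \<xi> \<in> B \<Longrightarrow> \<eta> \<in> B \<Longrightarrow> norm (H n i \<xi> - H n i \<eta>) \<le> L n i * norm (\<xi> - \<eta>) powr \<rho>"
    and \<rho>: "0 < \<rho>"
    and NK: "\<forall>\<^sub>F n in sequentially. (\<Sum>i\<in>{1..n}. (N n i)\<^sup>2) \<le> K * a n"
    and LK: "\<forall>\<^sub>F n in sequentially. (\<Sum>i\<in>{1..n}. (L n i)\<^sup>2) \<le> K * a n"
    and I0: "(\<lambda>n. (1 / a n) *\<^sub>R (\<Sum>i\<in>{1..n}. outer (g n i \<xi>0) (g n i \<xi>0))) \<longlonglongrightarrow> I0"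
    and consistency: "\<And>\<delta>. 0 < \<delta> \<Longrightarrow> whp P (\<lambda>n \<omega>. norm (\<xi>hat n \<omega> - \<xi>0) < \<delta>)"
begin

lemma \<xi>0_in_B: "\<xi>0 \<in> B" using B(3) interior_subset by blast

lemma B_closure: "B \<subseteq> closure \<Xi>" using B(4) closure_subset by blast

text \<open>The noise weighted with the Hessian is \<open>o(a h)\<close> uniformly near \<open>\<xi>0\<close>: chaining handles its
  increments, with the Hoelder exponent of the Hessian, and its value at \<open>\<xi>0\<close> is a single
  Gaussian variable per matrix entry.\<close>

lemma hessian_noise_small:
  assumes "0 < e"
  shows "whp P (\<lambda>n \<omega>. \<forall>\<xi>\<in>B. norm (\<Sum>i\<in>{1..n}. D n i \<omega> *\<^sub>R H n i \<xi>) \<le> e * (a n * h n))"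
proof -
  define \<epsilon> where "\<epsilon> = e / (2 * (CARD('p) * CARD('p)))"
  have \<epsilon>: "0 < \<epsilon>" using assms by (simp add: \<epsilon>_def)
  have entry: "\<bar>A $ j $ k\<bar> \<le> norm A" for A :: "real ^ 'p ^ 'p" and j k
    using component_le_norm_cart[of "A $ j" k] Finite_Cartesian_Product.norm_nth_le[of A j] by linarith
  have B_ne: "B \<noteq> {}" using \<xi>0_in_B by auto
  have inc: "whp P (\<lambda>n \<omega>. \<forall>\<xi>\<in>B. \<forall>\<eta>\<in>B.
      \<bar>\<Sum>i\<in>{1..n}. (H n i \<xi> $ j $ k - H n i \<eta> $ j $ k) * D n i \<omega>\<bar> \<le> \<epsilon> * (a n * h n))" for j k
  proof (rule noise_uniformly_small[OF B(1,2) B_ne \<rho> _ _ LK \<epsilon>])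
    show "continuous_on B (\<lambda>\<xi>. H n i \<xi> $ j $ k)" for n i
      by (intro continuous_intros continuous_on_subset[OF H_cont B_closure])
    show "\<bar>H n i \<xi> $ j $ k - H n i \<eta> $ j $ k\<bar> \<le> L n i * norm (\<xi> - \<eta>) powr \<rho>" if "\<xi> \<in> B" "\<eta> \<in> B" for n i \<xi> \<eta>
      using entry[of "H n i \<xi> - H n i \<eta>" j k] L[OF that, of n i] by simp
  qed
  have base: "whp P (\<lambda>n \<omega>. \<bar>\<Sum>i\<in>{1..n}. H n i \<xi>0 $ j $ k * D n i \<omega>\<bar> \<le> \<epsilon> * (a n * h n))" for j k
  proof (rule noise_small[OF _ \<epsilon>])
    show "\<forall>\<^sub>F n in sequentially. (\<Sum>i\<in>{1..n}. (H n i \<xi>0 $ j $ k)\<^sup>2) \<le> K * a n"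
      using NK
    proof eventually_elim
      case (elim n)
      have "(\<Sum>i\<in>{1..n}. (H n i \<xi>0 $ j $ k)\<^sup>2) \<le> (\<Sum>i\<in>{1..n}. (N n i)\<^sup>2)"
      proof (rule sum_mono)
        fix i
        have "\<bar>H n i \<xi>0 $ j $ k\<bar> \<le> N n i" using entry[of "H n i \<xi>0" j k] N[OF \<xi>0_in_B, of n i] by linarith
        then show "(H n i \<xi>0 $ j $ k)\<^sup>2 \<le> (N n i)\<^sup>2" by (metis abs_ge_zero power2_abs power_mono)
      qed
      then show ?case using elim by linarith
    qed
  qed
  have "whp P (\<lambda>n \<omega>. \<forall>jk\<in>UNIV \<times> UNIV.
      (\<forall>\<xi>\<in>B. \<forall>\<eta>\<in>B. \<bar>\<Sum>i\<in>{1..n}. (H n i \<xi> $ fst jk $ snd jk - H n i \<eta> $ fst jk $ snd jk) * D n i \<omega>\<bar> \<le> \<epsilon> * (a n * h n)) \<and>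
      \<bar>\<Sum>i\<in>{1..n}. H n i \<xi>0 $ fst jk $ snd jk * D n i \<omega>\<bar> \<le> \<epsilon> * (a n * h n))"
    by (intro whp_ball_finite[OF P] whp_conj[OF P] inc base) simp
  then show ?thesis
  proof (rule whp_mono, intro always_eventually allI ballI impI)
    fix n \<omega> \<xi>
    assume ev: "\<forall>jk\<in>UNIV \<times> UNIV.
      (\<forall>\<xi>\<in>B. \<forall>\<eta>\<in>B. \<bar>\<Sum>i\<in>{1..n}. (H n i \<xi> $ fst jk $ snd jk - H n i \<eta> $ fst jk $ snd jk) * D n i \<omega>\<bar> \<le> \<epsilon> * (a n * h n)) \<and>
      \<bar>\<Sum>i\<in>{1..n}. H n i \<xi>0 $ fst jk $ snd jk * D n i \<omega>\<bar> \<le> \<epsilon> * (a n * h n)" and \<xi>: "\<xi> \<in> B"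
    have "\<bar>(\<Sum>i\<in>{1..n}. D n i \<omega> *\<^sub>R H n i \<xi>) $ j $ k\<bar> \<le> 2 * \<epsilon> * (a n * h n)" for j k
    proof -
      have "(\<Sum>i\<in>{1..n}. D n i \<omega> *\<^sub>R H n i \<xi>) $ j $ k =
          (\<Sum>i\<in>{1..n}. (H n i \<xi> $ j $ k - H n i \<xi>0 $ j $ k) * D n i \<omega>) + (\<Sum>i\<in>{1..n}. H n i \<xi>0 $ j $ k * D n i \<omega>)"
        by (simp add: sum.distrib[symmetric] algebra_simps)
      then show ?thesis using ev[rule_format, of "(j, k)"] \<xi> \<xi>0_in_B by fastforce
    qed
    then have "(\<Sum>j\<in>UNIV. \<Sum>k\<in>UNIV. \<bar>(\<Sum>i\<in>{1..n}. D n i \<omega> *\<^sub>R H n i \<xi>) $ j $ k\<bar>) \<le>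
        (\<Sum>j\<in>(UNIV :: 'p set). \<Sum>k\<in>(UNIV :: 'p set). 2 * \<epsilon> * (a n * h n))"
      by (intro sum_mono)
    also have "\<dots> = e * (a n * h n)" by (simp add: \<epsilon>_def)
    finally show "norm (\<Sum>i\<in>{1..n}. D n i \<omega> *\<^sub>R H n i \<xi>) \<le> e * (a n * h n)"
      using norm_matrix_le_sum order_trans by blast
  qed
qed

lemma expansion:
  assumes "0 < e"
  shows "whp P (\<lambda>n \<omega>. norm ((a n * h n) *\<^sub>R (I0 *v (\<xi>hat n \<omega> - \<xi>0)) - (\<Sum>i\<in>{1..n}. D n i \<omega> *\<^sub>R g n i \<xi>0)) \<le>
    a n * h n * norm (\<xi>hat n \<omega> - \<xi>0) * e + Cr * (h n)\<^sup>2 * sqrt (real n * (K * a n)))"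
proof -
  obtain \<delta>0 where \<delta>0: "0 < \<delta>0" "ball \<xi>0 \<delta>0 \<subseteq> B" using B(3) by (auto simp: mem_interior)
  define \<delta> where "\<delta> = min \<delta>0 (e / (6 * (K + 1)))"
  have \<delta>: "0 < \<delta>" using \<delta>0 assms K by (simp add: \<delta>_def)
  have \<delta>K: "2 * K * \<delta> \<le> e / 3"
  proof -
    have "2 * K * \<delta> \<le> 2 * (K + 1) * (e / (6 * (K + 1)))"
      using K \<delta> by (intro mult_mono) (auto simp: \<delta>_def)
    also have "\<dots> = e / 3" using K by (simp add: divide_simps)
    finally show ?thesis .
  qed
  have e3: "0 < e / 3" using assms by simp
  have ev: "\<forall>\<^sub>F n in sequentially. norm ((1 / a n) *\<^sub>R (\<Sum>i\<in>{1..n}. outer (g n i \<xi>0) (g n i \<xi>0)) - I0) < e / 3"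
    using tendstoD[OF I0 e3] by (simp add: dist_norm)
  show ?thesis
  proof (rule whp_mono[OF whp_conj[OF P consistency[OF \<delta>] hessian_noise_small[OF e3]]],
      use ev a MK NK in eventually_elim, intro ballI impI)
    fix n \<omega>
    assume In: "norm ((1 / a n) *\<^sub>R (\<Sum>i\<in>{1..n}. outer (g n i \<xi>0) (g n i \<xi>0)) - I0) < e / 3"
      and an: "0 < a n" and MKn: "(\<Sum>i\<in>{1..n}. (M n i)\<^sup>2) \<le> K * a n"
      and NKn: "(\<Sum>i\<in>{1..n}. (N n i)\<^sup>2) \<le> K * a n" and \<omega>: "\<omega> \<in> space P"
      and good: "norm (\<xi>hat n \<omega> - \<xi>0) < \<delta> \<and> (\<forall>\<xi>\<in>B. norm (\<Sum>i\<in>{1..n}. D n i \<omega> *\<^sub>R H n i \<xi>) \<le> e / 3 * (a n * h n))"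
    define \<theta> where "\<theta> = \<xi>hat n \<omega> - \<xi>0"
    have hatB: "\<xi>hat n \<omega> \<in> B"
      using good \<delta>0(2) by (auto simp: \<delta>_def dist_norm norm_minus_commute)
    have hat: "\<xi>hat n \<omega> \<in> \<Xi>" using hatB B(4) by blast
    have m_B: "(m n i has_derivative (\<lambda>v. g n i \<xi> \<bullet> v)) (at \<xi> within B)" if "\<xi> \<in> B" for i \<xi>
      using has_derivative_subset[OF m_der B_closure] that B_closure by blast
    have g_B: "(g n i has_derivative (\<lambda>v. H n i \<xi> *v v)) (at \<xi> within B)" if "\<xi> \<in> B" for i \<xi>
      using has_derivative_subset[OF g_der B_closure] that B_closure by blast
    have N0: "0 \<le> N n i" for i using N[OF \<xi>0_in_B, of n i] norm_ge_zero order_trans by blast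
    have g_lip: "norm (g n i \<xi> - g n i \<eta>) \<le> N n i * norm (\<xi> - \<eta>)" if "\<xi> \<in> B" "\<eta> \<in> B" for i \<xi> \<eta>
      by (rule gradient_lipschitz[OF B(2) g_B N that])
    define G where "G \<xi> = (\<Sum>i\<in>{1..n}. D n i \<omega> *\<^sub>R g n i \<xi>)" for \<xi>
    have "norm (G (\<xi>hat n \<omega>) - G \<xi>0) \<le> e / 3 * (a n * h n) * norm (\<xi>hat n \<omega> - \<xi>0)"
    proof (rule gradient_lipschitz[OF B(2) _ _ hatB \<xi>0_in_B])
      fix \<xi> assume \<xi>: "\<xi> \<in> B"
      have "(G has_derivative (\<lambda>v. \<Sum>i\<in>{1..n}. D n i \<omega> *\<^sub>R (H n i \<xi> *v v))) (at \<xi> within B)"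
        unfolding G_def[abs_def] by (intro has_derivative_sum has_derivative_scaleR_right g_B \<xi>)
      moreover have "(\<Sum>i\<in>{1..n}. D n i \<omega> *\<^sub>R (H n i \<xi> *v v)) = (\<Sum>i\<in>{1..n}. D n i \<omega> *\<^sub>R H n i \<xi>) *v v" for v
        by (simp add: matrix_vector_mult_sum_left scaleR_matrix_vector_assoc)
      ultimately show "(G has_derivative (\<lambda>v. (\<Sum>i\<in>{1..n}. D n i \<omega> *\<^sub>R H n i \<xi>) *v v)) (at \<xi> within B)" by simp
      show "norm (\<Sum>i\<in>{1..n}. D n i \<omega> *\<^sub>R H n i \<xi>) \<le> e / 3 * (a n * h n)" using good \<xi> by blast
    qed
    then have noise: "norm (\<Sum>i\<in>{1..n}. D n i \<omega> *\<^sub>R (g n i (\<xi>hat n \<omega>) - g n i \<xi>0)) \<le> e / 3 * (a n * h n) * norm \<theta>"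
      by (simp add: G_def \<theta>_def scaleR_diff_right sum_subtractf)
    have "(\<Sum>i\<in>{1..n}. (x n i \<omega> - m n i (\<xi>hat n \<omega>) * h n) *\<^sub>R g n i (\<xi>hat n \<omega>)) = 0"
      by (rule contrast_first_order_condition[OF _ \<Xi>(1) hat h m_der \<xi>hat_min[OF \<omega>]])
        (use \<xi>hat_in[OF \<omega>] in auto)
    then have eq: "(\<Sum>i\<in>{1..n}. (D n i \<omega> + r n i - h n * (m n i (\<xi>hat n \<omega>) - m n i \<xi>0)) *\<^sub>R g n i (\<xi>hat n \<omega>)) = 0"
      using obs[OF \<omega>] by (simp add: algebra_simps cong: sum.cong_simp)
    have "norm ((a n * h n) *\<^sub>R (I0 *v \<theta>) - (\<Sum>i\<in>{1..n}. D n i \<omega> *\<^sub>R g n i \<xi>0)) \<le>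
      a n * h n * norm \<theta> * (e / 3 + 2 * K * norm \<theta> + e / 3) + Cr * (h n)\<^sup>2 * sqrt (card {1..n} * (K * a n))"
    proof (rule normal_equation_expansion[OF _ an h K _ eq _ _ _ _ r noise NKn MKn less_imp_le[OF In]])
      show "0 \<le> Cr * (h n)\<^sup>2" using Cr by simp
      show "norm (g n i (\<xi>hat n \<omega>) - g n i \<xi>0) \<le> N n i * norm \<theta>" for i
        unfolding \<theta>_def by (rule g_lip[OF hatB \<xi>0_in_B])
      show "\<bar>m n i (\<xi>hat n \<omega>) - m n i \<xi>0 - g n i \<xi>0 \<bullet> \<theta>\<bar> \<le> N n i * (norm \<theta>)\<^sup>2" for i
        unfolding \<theta>_def by (rule second_order_bound[OF B(2) m_B g_lip hatB \<xi>0_in_B N0])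
      show "norm (g n i (\<xi>hat n \<omega>)) \<le> M n i" for i by (rule M[OF \<xi>hat_in[OF \<omega>]])
      show "norm (g n i \<xi>0) \<le> M n i" for i by (rule M[OF closure_facts(3)])
    qed simp_all
    moreover have "a n * h n * norm \<theta> * (e / 3 + 2 * K * norm \<theta> + e / 3) \<le> a n * h n * norm \<theta> * e"
    proof (rule mult_left_mono)
      have "2 * K * norm \<theta> \<le> 2 * K * \<delta>" using good K by (intro mult_left_mono) (auto simp: \<theta>_def)
      then show "e / 3 + 2 * K * norm \<theta> + e / 3 \<le> e" using \<delta>K by linarith
      show "0 \<le> a n * h n * norm \<theta>" using an h[of n] by simp
    qed
    ultimately show "norm ((a n * h n) *\<^sub>R (I0 *v (\<xi>hat n \<omega> - \<xi>0)) - (\<Sum>i\<in>{1..n}. D n i \<omega> *\<^sub>R g n i \<xi>0)) \<le>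
      a n * h n * norm (\<xi>hat n \<omega> - \<xi>0) * e + Cr * (h n)\<^sup>2 * sqrt (real n * (K * a n))"
      by (simp add: \<theta>_def)
  qed
qed

end

lemma pos_def_matrix_sandwich:
  fixes I0 \<Gamma> :: "real ^ 'p ^ 'p"
  assumes I0: "pos_def_matrix I0" and \<Gamma>: "pos_def_matrix \<Gamma>"
  shows "pos_def_matrix (matrix_inv I0 ** \<Gamma> ** matrix_inv I0)"
    "u \<bullet> ((matrix_inv I0 ** \<Gamma> ** matrix_inv I0) *v u) = (matrix_inv I0 *v u) \<bullet> (\<Gamma> *v (matrix_inv I0 *v u))"
proof -
  define J where "J = matrix_inv I0"
  have J: "I0 ** J = mat 1" "transpose J = J"
    using pos_def_matrix_inv[OF I0] by (auto simp: J_def pos_def_matrix_def)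
  have \<Gamma>': "transpose \<Gamma> = \<Gamma>" "\<And>y. y \<noteq> 0 \<Longrightarrow> 0 < y \<bullet> (\<Gamma> *v y)" using \<Gamma> by (auto simp: pos_def_matrix_def)
  have adj: "u \<bullet> (J *v y) = (J *v u) \<bullet> y" for u y
  proof -
    have "u v* J = J *v u" using transpose_matrix_vector[of J u] by (simp add: J(2))
    then show ?thesis using dot_lmul_matrix[of u J y] by simp
  qed
  have form: "u \<bullet> ((J ** \<Gamma> ** J) *v u) = (J *v u) \<bullet> (\<Gamma> *v (J *v u))" for u
    unfolding matrix_vector_mul_assoc[symmetric] by (rule adj)
  then show "u \<bullet> ((matrix_inv I0 ** \<Gamma> ** matrix_inv I0) *v u) = (matrix_inv I0 *v u) \<bullet> (\<Gamma> *v (matrix_inv I0 *v u))"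
    unfolding J_def .
  have "0 < u \<bullet> ((J ** \<Gamma> ** J) *v u)" if "u \<noteq> 0" for u
  proof -
    have "I0 *v (J *v u) = u" unfolding matrix_vector_mul_assoc J(1) by simp
    then have "J *v u \<noteq> 0" using that by auto
    then show ?thesis unfolding form by (rule \<Gamma>'(2))
  qed
  moreover have "transpose (J ** \<Gamma> ** J) = J ** \<Gamma> ** J"
    unfolding matrix_transpose_mul J(2) \<Gamma>'(1) by (rule matrix_mul_assoc)
  ultimately show "pos_def_matrix (matrix_inv I0 ** \<Gamma> ** matrix_inv I0)"
    unfolding pos_def_matrix_def J_def by blast
qed

lemma quadratic_form_tendsto:
  fixes A :: "nat \<Rightarrow> real ^ 'n ^ 'n"
  assumes "A \<longlonglongrightarrow> B"
  shows "(\<lambda>n. y \<bullet> (A n *v y)) \<longlonglongrightarrow> y \<bullet> (B *v y)"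
proof -
  have "linear (\<lambda>A :: real ^ 'n ^ 'n. A *v y)"
    by (rule linearI) (simp_all add: matrix_vector_mult_add_rdistrib scaleR_matrix_vector_assoc)
  then have "bounded_linear (\<lambda>A :: real ^ 'n ^ 'n. A *v y)" by (simp only: linear_conv_bounded_linear)
  then have "(\<lambda>n. A n *v y) \<longlonglongrightarrow> B *v y" using assms by (rule bounded_linear.tendsto)
  then show ?thesis by (intro tendsto_intros)
qed

context smooth_drift_estimation
begin

text \<open>Multiplying the normal equation by the inverse of \<open>I0\<close> exhibits the normalised error as
  a Gaussian vector plus a relative error that vanishes in probability. The Euler error enters
  through \<open>(n h\<^bsup>4 - \<beta>\<^esup>)\<^bsup>1/2\<^esup>\<close>.\<close>

theorem asymptotic_normality:
  assumes pd: "pos_def_matrix I0" "pos_def_matrix \<Gamma>"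
    and \<Gamma>: "(\<lambda>n. (1 / (a n * h n powr \<beta>)) *\<^sub>R (\<Sum>i\<in>{1..n}. \<Sum>j\<in>{1..n}.
        covariance P (D n i) (D n j) *\<^sub>R outer (g n i \<xi>0) (g n j \<xi>0))) \<longlonglongrightarrow> \<Gamma>"
    and nh: "(\<lambda>n. real n * h n powr (4 - \<beta>)) \<longlonglongrightarrow> 0"
    and meas: "\<And>n. \<xi>hat n \<in> borel_measurable P"
  shows "converges_in_distribution P (\<lambda>n \<omega>. sqrt (a n * h n powr (2 - \<beta>)) *\<^sub>R (\<xi>hat n \<omega> - \<xi>0))
    (multivariate_normal 0 (matrix_inv I0 ** \<Gamma> ** matrix_inv I0))"
proof -
  define J where "J = matrix_inv I0"
  have J: "J ** I0 = mat 1" "transpose J = J"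
    using pos_def_matrix_inv[OF pd(1)] by (auto simp: J_def pos_def_matrix_def)
  have adj: "u \<bullet> (J *v y) = (J *v u) \<bullet> y" for u y
  proof -
    have "u v* J = J *v u" using transpose_matrix_vector[of J u] by (simp add: J(2))
    then show ?thesis using dot_lmul_matrix[of u J y] by simp
  qed
  define s where "s n = sqrt (a n * h n powr (2 - \<beta>))" for n
  define w where "w n = sqrt (a n * h n powr \<beta>)" for n
  define Y where "Y n \<omega> = s n *\<^sub>R (\<xi>hat n \<omega> - \<xi>0)" for n \<omega>
  define T where "T n \<omega> = (\<Sum>i\<in>{1..n}. D n i \<omega> *\<^sub>R g n i \<xi>0)" for n \<omega>
  define W where "W n \<omega> = J *v ((1 / w n) *\<^sub>R T n \<omega>)" for n \<omega>
  define c where "c n u i = (1 / w n) * ((J *v u) \<bullet> g n i \<xi>0)" for n u i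
  define v where "v n u = (\<Sum>i\<in>{1..n}. \<Sum>j\<in>{1..n}. c n u i * c n u j * covariance P (D n i) (D n j))" for n u
  have uW: "u \<bullet> W n \<omega> = (\<Sum>i\<in>{1..n}. c n u i * D n i \<omega>)" for u n \<omega>
    by (simp add: W_def adj T_def c_def inner_sum_right sum_distrib_left mult_ac)
  have Dm [measurable]: "D n i \<in> borel_measurable P" if "i \<in> {1..n}" for n i
    by (rule gaussian_family_measurable[OF P gauss that])
  have Ym: "Y n \<in> borel_measurable P" for n
    using meas[of n] unfolding Y_def[abs_def] by measurable
  have Wm: "W n \<in> borel_measurable P" for n
  proof -
    have "(\<lambda>\<omega>. axis j 1 \<bullet> W n \<omega>) \<in> borel_measurable P" for j
      unfolding uW by measurable
    then have "(\<lambda>\<omega>. W n \<omega> \<bullet> b) \<in> borel_measurable P" if "b \<in> Basis" for b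
      using that by (auto simp: Basis_vec_def inner_commute)
    then show ?thesis by (subst borel_measurable_euclidean_space) blast
  qed
  have v_lim: "(\<lambda>n. v n u) \<longlonglongrightarrow> u \<bullet> ((J ** \<Gamma> ** J) *v u)" for u
  proof -
    let ?A = "\<lambda>n. (1 / (a n * h n powr \<beta>)) *\<^sub>R (\<Sum>i\<in>{1..n}. \<Sum>j\<in>{1..n}.
        covariance P (D n i) (D n j) *\<^sub>R outer (g n i \<xi>0) (g n j \<xi>0))"
    let ?y = "J *v u"
    have "(\<lambda>n. ?y \<bullet> (?A n *v ?y)) \<longlonglongrightarrow> ?y \<bullet> (\<Gamma> *v ?y)" by (rule quadratic_form_tendsto[OF \<Gamma>])
    moreover have "\<forall>\<^sub>F n in sequentially. ?y \<bullet> (?A n *v ?y) = v n u"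
      using a
    proof eventually_elim
      case (elim n)
      have w2: "(1 / w n) * (1 / w n) = 1 / (a n * h n powr \<beta>)"
        using elim by (simp add: w_def)
      have cc: "c n u i * c n u j = (1 / (a n * h n powr \<beta>)) * ((?y \<bullet> g n i \<xi>0) * (?y \<bullet> g n j \<xi>0))" for i j
        unfolding w2[symmetric] c_def by (simp only: mult_ac)
      have "?y \<bullet> (?A n *v ?y) = (1 / (a n * h n powr \<beta>)) * (\<Sum>i\<in>{1..n}. \<Sum>j\<in>{1..n}.
          covariance P (D n i) (D n j) * ((g n j \<xi>0 \<bullet> ?y) * (?y \<bullet> g n i \<xi>0)))"
        by (simp add: scaleR_matrix_vector_assoc[symmetric] matrix_vector_mult_sum_left
            matrix_vector_mult_outer inner_sum_right mult.assoc)
      also have "\<dots> = v n u"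
        unfolding v_def cc sum_distrib_left by (intro sum.cong refl) (simp add: inner_commute mult_ac)
      finally show ?case .
    qed
    ultimately have "(\<lambda>n. v n u) \<longlonglongrightarrow> ?y \<bullet> (\<Gamma> *v ?y)" by (rule Lim_transform_eventually)
    then show ?thesis unfolding J_def pos_def_matrix_sandwich(2)[OF pd] .
  qed
  have close: "whp P (\<lambda>n \<omega>. norm (Y n \<omega> - W n \<omega>) \<le> e * (1 + norm (W n \<omega>)))" if "0 < e" for e
  proof -
    define k where "k = min (1 / 2) (e / 2)"
    have k: "0 < k" "k \<le> 1 / 2" "2 * k \<le> e" using that by (auto simp: k_def)
    define \<epsilon> where "\<epsilon> = k / (norm J + 1)"
    have J1: "0 < norm J + 1" using norm_ge_zero[of J] by linarith
    have \<epsilon>: "0 < \<epsilon>" using k J1 by (simp add: \<epsilon>_def)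
    have J\<epsilon>: "norm J * \<epsilon> \<le> k"
    proof -
      have "norm J * \<epsilon> \<le> (norm J + 1) * \<epsilon>" using \<epsilon> by (intro mult_right_mono) auto
      also have "\<dots> = k" using J1 by (simp add: \<epsilon>_def)
      finally show ?thesis .
    qed
    define \<delta> where "\<delta> n = Cr * sqrt K * sqrt (real n * h n powr (4 - \<beta>))" for n
    have "\<delta> \<longlonglongrightarrow> Cr * sqrt K * sqrt 0" unfolding \<delta>_def by (intro tendsto_intros nh)
    then have "\<forall>\<^sub>F n in sequentially. \<delta> n < \<epsilon>" using \<epsilon> by (intro order_tendstoD(2)) auto
    with a have ev: "\<forall>\<^sub>F n in sequentially. 0 < a n \<and> \<delta> n < \<epsilon>" by eventually_elim simp
    have step: "norm (Y n \<omega> - W n \<omega>) \<le> e * (1 + norm (W n \<omega>))"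
      if an: "0 < a n" and \<delta>n: "\<delta> n < \<epsilon>" and exp: "norm ((a n * h n) *\<^sub>R (I0 *v (\<xi>hat n \<omega> - \<xi>0)) - T n \<omega>) \<le>
        a n * h n * norm (\<xi>hat n \<omega> - \<xi>0) * \<epsilon> + Cr * (h n)\<^sup>2 * sqrt (real n * (K * a n))" for n \<omega>
    proof -
      have hp: "0 < h n powr z" for z using h[of n] by simp
      have w: "0 < w n" using an hp by (simp add: w_def)
      have s: "0 < s n" using an hp by (simp add: s_def)
      have sw: "s n * w n = a n * h n"
      proof -
        have "s n * w n = sqrt ((a n * h n powr (2 - \<beta>)) * (a n * h n powr \<beta>))"
          by (simp only: s_def w_def real_sqrt_mult)
        also have "(a n * h n powr (2 - \<beta>)) * (a n * h n powr \<beta>) = (a n)\<^sup>2 * (h n powr (2 - \<beta>) * h n powr \<beta>)"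
          by (simp only: power2_eq_square mult_ac)
        also have "h n powr (2 - \<beta>) * h n powr \<beta> = (h n)\<^sup>2"
          using h[of n] by (simp add: powr_add[symmetric] powr_numeral)
        also have "sqrt ((a n)\<^sup>2 * (h n)\<^sup>2) = a n * h n"
          using an h[of n] by (simp add: real_sqrt_mult)
        finally show ?thesis .
      qed
      have euler: "(1 / w n) * (Cr * (h n)\<^sup>2 * sqrt (real n * (K * a n))) = \<delta> n"
      proof -
        have "(h n)\<^sup>2 * sqrt (real n * (K * a n)) = sqrt ((h n)\<^sup>2 * (h n)\<^sup>2 * (real n * (K * a n)))"
          by (subst real_sqrt_mult[of "(h n)\<^sup>2 * (h n)\<^sup>2"]) (simp only: real_sqrt_abs2 abs_power2)
        also have "(h n)\<^sup>2 * (h n)\<^sup>2 = h n powr (4 - \<beta>) * h n powr \<beta>"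
        proof -
          have "h n powr (4 - \<beta>) * h n powr \<beta> = (h n) ^ 4"
            using h[of n] by (simp add: powr_add[symmetric] powr_numeral)
          then show ?thesis by (simp only: power_add[symmetric]) simp
        qed
        also have "h n powr (4 - \<beta>) * h n powr \<beta> * (real n * (K * a n)) =
            K * (real n * h n powr (4 - \<beta>)) * (a n * h n powr \<beta>)" by (simp only: mult_ac)
        also have "sqrt \<dots> = sqrt K * sqrt (real n * h n powr (4 - \<beta>)) * w n"
          by (simp only: real_sqrt_mult w_def)
        finally have "(1 / w n) * (Cr * ((h n)\<^sup>2 * sqrt (real n * (K * a n)))) =
            (1 / w n) * (Cr * (sqrt K * sqrt (real n * h n powr (4 - \<beta>)) * w n))" by (simp only:)
        also have "\<dots> = \<delta> n" using w by (simp add: \<delta>_def)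
        finally show ?thesis by (simp only: mult.assoc)
      qed
      have IY: "I0 *v Y n \<omega> = s n *\<^sub>R (I0 *v (\<xi>hat n \<omega> - \<xi>0))"
        unfolding Y_def by (rule matrix_vector_mult_scaleR)
      have "I0 *v Y n \<omega> - (1 / w n) *\<^sub>R T n \<omega> =
          (1 / w n) *\<^sub>R ((a n * h n) *\<^sub>R (I0 *v (\<xi>hat n \<omega> - \<xi>0)) - T n \<omega>)"
        using w unfolding sw[symmetric] IY by (simp add: scaleR_diff_right)
      then have "norm (I0 *v Y n \<omega> - (1 / w n) *\<^sub>R T n \<omega>) =
          (1 / w n) * norm ((a n * h n) *\<^sub>R (I0 *v (\<xi>hat n \<omega> - \<xi>0)) - T n \<omega>)"
        using w by simp
      also have "\<dots> \<le> (1 / w n) * (a n * h n * norm (\<xi>hat n \<omega> - \<xi>0) * \<epsilon> + Cr * (h n)\<^sup>2 * sqrt (real n * (K * a n)))"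
        using w exp by (intro mult_left_mono) auto
      also have "\<dots> = (1 / w n) * (s n * w n * norm (\<xi>hat n \<omega> - \<xi>0) * \<epsilon>) + \<delta> n"
        unfolding distrib_left euler sw ..
      also have "(1 / w n) * (s n * w n * norm (\<xi>hat n \<omega> - \<xi>0) * \<epsilon>) = \<epsilon> * norm (Y n \<omega>)"
        using w s by (simp add: Y_def)
      finally have eq: "norm (I0 *v Y n \<omega> - (1 / w n) *\<^sub>R T n \<omega>) \<le> \<epsilon> * norm (Y n \<omega>) + \<delta> n" .
      have "norm J * \<delta> n \<le> norm J * \<epsilon>" using \<delta>n by (intro mult_left_mono) auto
      then have "norm J * \<delta> n \<le> k" using J\<epsilon> by linarith
      from relative_error_of_linear_equation[OF J(1) less_imp_le[OF k(1)] k(2) eq J\<epsilon> this]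
      have "norm (Y n \<omega> - W n \<omega>) \<le> 2 * k * (1 + norm (W n \<omega>))" unfolding W_def .
      also have "\<dots> \<le> e * (1 + norm (W n \<omega>))" using k(3) by (intro mult_right_mono) auto
      finally show ?thesis .
    qed
    show ?thesis
    proof (rule whp_mono[OF expansion[OF \<epsilon>]])
      show "\<forall>\<^sub>F n in sequentially. \<forall>\<omega>\<in>space P.
        norm ((a n * h n) *\<^sub>R (I0 *v (\<xi>hat n \<omega> - \<xi>0)) - (\<Sum>i\<in>{1..n}. D n i \<omega> *\<^sub>R g n i \<xi>0)) \<le>
          a n * h n * norm (\<xi>hat n \<omega> - \<xi>0) * \<epsilon> + Cr * (h n)\<^sup>2 * sqrt (real n * (K * a n)) \<longrightarrow>
        norm (Y n \<omega> - W n \<omega>) \<le> e * (1 + norm (W n \<omega>))"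
        using ev step[unfolded T_def] by (auto elim!: eventually_mono)
    qed
  qed
  have "converges_in_distribution P Y (multivariate_normal 0 (J ** \<Gamma> ** J))"
  proof (rule converges_in_distribution_to_normal[OF P _ Ym Wm _ _ _ v_lim close])
    show "pos_def_matrix (J ** \<Gamma> ** J)" unfolding J_def by (rule pos_def_matrix_sandwich(1)[OF pd])
    show "(\<integral>\<omega>. cos (u \<bullet> W n \<omega> + q) \<partial>P) = cos q * exp (- v n u / 2)" for n u q
      unfolding uW v_def by (rule gaussian_family_wave[OF P gauss])
    show "integrable P (\<lambda>\<omega>. (u \<bullet> W n \<omega>)\<^sup>2)" for n u
      using gaussian_family_moment_le(1)[OF P gauss order_refl, where k = 1 and c = "c n u"] unfolding uW by simp
    show "(\<integral>\<omega>. (u \<bullet> W n \<omega>)\<^sup>2 \<partial>P) = v n u" for n u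
      unfolding uW v_def by (rule gaussian_family_variance[OF P gauss])
  qed
  then show ?thesis unfolding Y_def[abs_def] s_def J_def .
qed

end

section \<open>Asymptotic normality of the drift estimator\<close>

lemma le_mult_if_average_bigo:
  fixes F c :: "nat \<Rightarrow> real"
  assumes c: "filterlim c at_top sequentially" and O: "(\<lambda>n. 1 / c n * F n) \<in> O(\<lambda>_. 1)"
  shows "\<exists>k\<ge>0. \<forall>\<^sub>F n in sequentially. F n \<le> k * c n"
proof -
  obtain k where k: "0 < k" "\<forall>\<^sub>F n in sequentially. norm (1 / c n * F n) \<le> k * norm (1 :: real)"
    using landau_o.bigE[OF O] by blast
  have "\<forall>\<^sub>F n in sequentially. 0 < c n" using c by (simp add: filterlim_at_top_dense)
  with k(2) have "\<forall>\<^sub>F n in sequentially. F n \<le> k * c n"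
  proof eventually_elim
    case (elim n)
    have "1 / c n * F n \<le> norm (1 / c n * F n)" by (simp only: real_norm_def abs_ge_self)
    also have "\<dots> \<le> k" using elim(1) by (simp only: norm_one mult_1_right)
    finally have "1 / c n * F n \<le> k" .
    then show ?case using elim(2) by (simp add: pos_divide_le_eq)
  qed
  with k(1) show ?thesis by (intro exI[of _ k]) auto
qed

theorem theorem3p2:
  fixes P :: "'w measure"
    and \<Xi> :: "(real ^ 'p) set" and \<xi>\<^sub>0 :: "real ^ 'p"
    and \<mu> :: "real ^ 'p \<Rightarrow> real \<Rightarrow> real"
    and D\<mu> :: "real ^ 'p \<Rightarrow> real \<Rightarrow> real ^ 'p"
    and D2\<mu> :: "real ^ 'p \<Rightarrow> real \<Rightarrow> real ^ 'p ^ 'p"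
    and Z X :: "real \<Rightarrow> 'w \<Rightarrow> real" and K :: "real \<Rightarrow> real"
    and h a b :: "nat \<Rightarrow> real"
    and \<xi>hat :: "nat \<Rightarrow> 'w \<Rightarrow> real ^ 'p"
    and \<alpha> \<beta> c\<^sub>K :: real
    and I\<^sub>0 \<Gamma>\<^sub>0 :: "real ^ 'p ^ 'p"
  assumes "prob_space P"
    and "open \<Xi>" "bounded \<Xi>" "convex \<Xi>" "\<xi>\<^sub>0 \<in> \<Xi>"
    and "\<forall>\<xi>\<in>closure \<Xi>. \<forall>t>0. set_integrable lborel {0..t} (\<mu> \<xi>)"
    and "centered_stationary_gaussian_process P Z K"
    and "\<forall>t\<ge>0. \<forall>\<omega>\<in>space P. X t \<omega> = Z t \<omega> + set_lebesgue_integral lborel {0..t} (\<mu> \<xi>\<^sub>0)"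
    and "\<forall>n. 0 < h n" "h \<longlonglongrightarrow> 0" "filterlim (\<lambda>n. real n * h n) at_top sequentially"
    and "\<forall>n. \<xi>hat n \<in> borel_measurable P"
    and "\<forall>n. \<forall>\<omega>\<in>space P. is_arg_min (contrast h X \<mu> n \<omega>) (\<lambda>\<xi>. \<xi> \<in> closure \<Xi>) (\<xi>hat n \<omega>)"
    and A1: "0 < \<alpha>" "\<alpha> \<le> 2"
      "\<exists>C>0. \<forall>n. \<forall>i\<in>{1..n}.
         (\<Sum>j=1..n. \<bar>covariance P (increment h Z n i) (increment h Z n j)\<bar>) \<le> C * h n powr \<alpha>"
    and A2: "0 < \<beta>" "\<beta> \<le> 2" "0 < c\<^sub>K"
      "(\<lambda>t. K 0 - K t - c\<^sub>K * t powr \<beta>) \<in> o[at_right 0](\<lambda>t. t powr \<beta>)"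
    and B1: "\<forall>t\<ge>0. continuous_on (closure \<Xi>) (\<lambda>\<xi>. \<mu> \<xi> t)"
    and B2: "\<forall>t\<ge>0. twice_continuously_differentiable_on (closure \<Xi>)
               (\<lambda>\<xi>. \<mu> \<xi> t) (\<lambda>\<xi>. D\<mu> \<xi> t) (\<lambda>\<xi>. D2\<mu> \<xi> t)"
    and B3: "\<exists>C>0. \<forall>\<xi>\<in>closure \<Xi>. \<forall>t\<ge>0. \<exists>d.
               (\<mu> \<xi> has_real_derivative d) (at t within {0..}) \<and> \<bar>d\<bar> \<le> C"
    and B4: "filterlim a at_top sequentially"
      "\<exists>Q. continuous_on (closure \<Xi> \<times> closure \<Xi>) (\<lambda>(\<xi>, \<eta>). Q \<xi> \<eta>) \<and>
           (\<forall>\<xi>\<in>closure \<Xi>. \<forall>\<eta>\<in>closure \<Xi>. 0 \<le> Q \<xi> \<eta>) \<and>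
           uniform_limit (closure \<Xi>)
             (\<lambda>n \<xi>. 1 / a n * (\<Sum>i=1..n. (\<mu> \<xi> (grid h n (i - 1)) - \<mu> \<xi>\<^sub>0 (grid h n (i - 1)))\<^sup>2))
             (\<lambda>\<xi>. Q \<xi> \<xi>\<^sub>0) sequentially \<and>
           (\<forall>\<xi>\<in>closure \<Xi>. Q \<xi> \<xi>\<^sub>0 = 0 \<longleftrightarrow> \<xi> = \<xi>\<^sub>0)"
    and B5: "filterlim b at_top sequentially"
      "\<exists>M :: real \<Rightarrow> real. M \<in> borel_measurable (restrict_space borel {0..}) \<and> (\<forall>t\<ge>0. 0 \<le> M t) \<and>
           (\<forall>t\<ge>0. \<forall>\<xi>\<in>closure \<Xi>. norm (D\<mu> \<xi> t) \<le> M t) \<and>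
           (\<lambda>n. 1 / b n * (\<Sum>i=1..n. (M (grid h n (i - 1)))\<^sup>2)) \<in> O(\<lambda>_. 1)"
    and B6: "pos_def_matrix I\<^sub>0"
      "(\<lambda>n. (1 / a n) *\<^sub>R
          (\<Sum>i=1..n. outer (D\<mu> \<xi>\<^sub>0 (grid h n (i - 1))) (D\<mu> \<xi>\<^sub>0 (grid h n (i - 1))))) \<longlonglongrightarrow> I\<^sub>0"
    and B7: "pos_def_matrix \<Gamma>\<^sub>0"
      "(\<lambda>n. (1 / (a n * h n powr \<beta>)) *\<^sub>R
          (\<Sum>i=1..n. \<Sum>j=1..n. covariance P (increment h Z n i) (increment h Z n j) *\<^sub>R
             outer (D\<mu> \<xi>\<^sub>0 (grid h n (i - 1))) (D\<mu> \<xi>\<^sub>0 (grid h n (j - 1))))) \<longlonglongrightarrow> \<Gamma>\<^sub>0"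
    and B8: "\<exists>U N L \<rho>. U \<subseteq> \<Xi> \<and> bounded U \<and> convex U \<and> \<xi>\<^sub>0 \<in> interior U \<and> 0 < \<rho> \<and> \<rho> \<le> 1 \<and>
           (N :: real \<Rightarrow> real) \<in> borel_measurable (restrict_space borel {0..}) \<and>
           (\<forall>t\<ge>0. 0 \<le> N t) \<and> (\<forall>t\<ge>0. 0 \<le> L t) \<and>
           (\<forall>t\<ge>0. \<forall>\<xi>\<in>U. norm (D2\<mu> \<xi> t) \<le> N t) \<and>
           (\<forall>t\<ge>0. \<forall>\<xi>\<in>U. \<forall>\<eta>\<in>U. norm (D2\<mu> \<xi> t - D2\<mu> \<eta> t) \<le> L t * norm (\<xi> - \<eta>) powr \<rho>) \<and>
           (\<lambda>n. 1 / a n * (\<Sum>i=1..n. (N (grid h n (i - 1)))\<^sup>2)) \<in> O(\<lambda>_. 1) \<and>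
           (\<lambda>n. 1 / a n * (\<Sum>i=1..n. (L (grid h n (i - 1)))\<^sup>2)) \<in> O(\<lambda>_. 1)"
    and "b \<in> O(a)"
    and "filterlim (\<lambda>n. a n * h n powr (2 - min \<alpha> \<beta>)) at_top sequentially"
    and "(\<lambda>n. real n * (h n)\<^sup>2 / a n) \<longlonglongrightarrow> 0"
    and "(\<lambda>n. real n * h n powr (4 - \<beta>)) \<longlonglongrightarrow> 0"
  shows "converges_in_distribution P
           (\<lambda>n \<omega>. sqrt (a n * h n powr (2 - \<beta>)) *\<^sub>R (\<xi>hat n \<omega> - \<xi>\<^sub>0))
           (multivariate_normal 0 (matrix_inv I\<^sub>0 ** \<Gamma>\<^sub>0 ** matrix_inv I\<^sub>0))"
proof -
  define D where "D n i = increment h Z n i" for n i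
  define t where "t n i = grid h n (i - 1)" for n i
  define m where "m n i \<xi> = \<mu> \<xi> (t n i)" for n i \<xi>
  define g where "g n i \<xi> = D\<mu> \<xi> (t n i)" for n i \<xi>
  define H where "H n i \<xi> = D2\<mu> \<xi> (t n i)" for n i \<xi>
  define x where "x n i = increment h X n i" for n i
  define drift where "drift s = set_lebesgue_integral lborel {0..s} (\<mu> \<xi>\<^sub>0)" for s :: real
  define r where "r n i = drift (grid h n i) - drift (t n i) - m n i \<xi>\<^sub>0 * h n" for n i

  have P: "prob_space P" and \<Xi>: "open \<Xi>" "bounded \<Xi>" "convex \<Xi>" "\<xi>\<^sub>0 \<in> \<Xi>" by fact+
  have h0: "0 < h n" for n using assms(9) by blast
  have t0: "0 \<le> t n i" for n i using h0[of n] by (simp add: t_def grid_def)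
  have \<xi>0_cl: "\<xi>\<^sub>0 \<in> closure \<Xi>" using \<Xi>(4) closure_subset by blast
  have a_pos: "\<forall>\<^sub>F n in sequentially. 0 < a n"
    using B4(1) by (simp add: filterlim_at_top_dense)
  have h_le: "\<forall>\<^sub>F n in sequentially. h n < 1" using order_tendstoD(2)[OF assms(10), of 1] by simp

  \<comment> \<open>\<open>h\<^sub>n < 1\<close> eventually, so the exponent \<open>2 - \<alpha> \<and> \<beta>\<close> may be lowered to \<open>2 - \<alpha>\<close>.\<close>
  have rate: "filterlim (\<lambda>n. a n * h n powr (2 - \<alpha>)) at_top sequentially"
  proof (rule filterlim_at_top_mono)
    show "filterlim (\<lambda>n. a n * h n powr (2 - min \<alpha> \<beta>)) at_top sequentially" by fact
    show "\<forall>\<^sub>F n in sequentially. a n * h n powr (2 - min \<alpha> \<beta>) \<le> a n * h n powr (2 - \<alpha>)"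
      using a_pos h_le
    proof eventually_elim
      case (elim n)
      have "h n powr (2 - min \<alpha> \<beta>) \<le> h n powr (2 - \<alpha>)"
        using h0[of n] elim(2) by (intro powr_mono') auto
      then show ?case using elim(1) by (intro mult_left_mono) auto
    qed
  qed

  obtain C where C: "0 < C" "\<And>n i. i \<in> {1..n} \<Longrightarrow>
      (\<Sum>j=1..n. \<bar>covariance P (increment h Z n i) (increment h Z n j)\<bar>) \<le> C * h n powr \<alpha>"
    using A1(3) by blast
  obtain Cr where Cr: "0 < Cr" "\<And>\<xi> t. \<xi> \<in> closure \<Xi> \<Longrightarrow> 0 \<le> t \<Longrightarrow> \<exists>d.
      (\<mu> \<xi> has_real_derivative d) (at t within {0..}) \<and> \<bar>d\<bar> \<le> Cr"
    using B3 by blast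
  obtain Mf where Mf: "\<And>t \<xi>. 0 \<le> t \<Longrightarrow> \<xi> \<in> closure \<Xi> \<Longrightarrow> norm (D\<mu> \<xi> t) \<le> Mf t"
    "(\<lambda>n. 1 / b n * (\<Sum>i=1..n. (Mf (grid h n (i - 1)))\<^sup>2)) \<in> O(\<lambda>_. 1)"
    using B5(2) by blast
  obtain U Nf Lf \<rho> where B8': "U \<subseteq> \<Xi> \<and> bounded U \<and> convex U \<and> \<xi>\<^sub>0 \<in> interior U \<and> 0 < \<rho> \<and> \<rho> \<le> 1 \<and>
           (Nf :: real \<Rightarrow> real) \<in> borel_measurable (restrict_space borel {0..}) \<and>
           (\<forall>t\<ge>0. 0 \<le> Nf t) \<and> (\<forall>t\<ge>0. 0 \<le> Lf t) \<and>
           (\<forall>t\<ge>0. \<forall>\<xi>\<in>U. norm (D2\<mu> \<xi> t) \<le> Nf t) \<and>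
           (\<forall>t\<ge>0. \<forall>\<xi>\<in>U. \<forall>\<eta>\<in>U. norm (D2\<mu> \<xi> t - D2\<mu> \<eta> t) \<le> Lf t * norm (\<xi> - \<eta>) powr \<rho>) \<and>
           (\<lambda>n. 1 / a n * (\<Sum>i=1..n. (Nf (grid h n (i - 1)))\<^sup>2)) \<in> O(\<lambda>_. 1) \<and>
           (\<lambda>n. 1 / a n * (\<Sum>i=1..n. (Lf (grid h n (i - 1)))\<^sup>2)) \<in> O(\<lambda>_. 1)"
    using B8 by (elim exE) (rule that)
  have U1: "U \<subseteq> \<Xi>" using B8' by (elim conjE)
  have U2: "\<xi>\<^sub>0 \<in> interior U" using B8' by (elim conjE)
  note U = U1 U2
  have \<rho>: "0 < \<rho>" using B8' by (elim conjE)
  have N1: "\<forall>t\<ge>0. \<forall>\<xi>\<in>U. norm (D2\<mu> \<xi> t) \<le> Nf t" using B8' by (elim conjE)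
  have L1: "\<forall>t\<ge>0. \<forall>\<xi>\<in>U. \<forall>\<eta>\<in>U. norm (D2\<mu> \<xi> t - D2\<mu> \<eta> t) \<le> Lf t * norm (\<xi> - \<eta>) powr \<rho>"
    using B8' by (elim conjE)
  have Nf: "norm (D2\<mu> \<xi> t) \<le> Nf t" if "0 \<le> t" "\<xi> \<in> U" for t \<xi>
    using N1[rule_format, OF that] .
  have Lf: "norm (D2\<mu> \<xi> t - D2\<mu> \<eta> t) \<le> Lf t * norm (\<xi> - \<eta>) powr \<rho>"
    if "0 \<le> t" "\<xi> \<in> U" "\<eta> \<in> U" for t \<xi> \<eta>
    using L1[rule_format, OF that] .
  have NO: "(\<lambda>n. 1 / a n * (\<Sum>i=1..n. (Nf (grid h n (i - 1)))\<^sup>2)) \<in> O(\<lambda>_. 1)"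
    using B8' by (elim conjE)
  have LO: "(\<lambda>n. 1 / a n * (\<Sum>i=1..n. (Lf (grid h n (i - 1)))\<^sup>2)) \<in> O(\<lambda>_. 1)"
    using B8' by (elim conjE)
  obtain KM where KM: "0 \<le> KM" "\<forall>\<^sub>F n in sequentially. (\<Sum>i=1..n. (Mf (grid h n (i - 1)))\<^sup>2) \<le> KM * a n"
  proof -
    obtain k1 where k1: "0 \<le> k1" "\<forall>\<^sub>F n in sequentially. (\<Sum>i=1..n. (Mf (grid h n (i - 1)))\<^sup>2) \<le> k1 * b n"
      using le_mult_if_average_bigo[OF B5(1) Mf(2)] by blast
    obtain k2 where k2: "0 < k2" "\<forall>\<^sub>F n in sequentially. norm (b n) \<le> k2 * norm (a n)"
      using landau_o.bigE[OF \<open>b \<in> O(a)\<close>] by blast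
    have "\<forall>\<^sub>F n in sequentially. (\<Sum>i=1..n. (Mf (grid h n (i - 1)))\<^sup>2) \<le> (k1 * k2) * a n"
      using k1(2) k2(2) a_pos
    proof eventually_elim
      case (elim n)
      have "k1 * b n \<le> k1 * (k2 * a n)" using elim k1(1) by (intro mult_left_mono) auto
      then show ?case using elim(1) by simp
    qed
    then show ?thesis using that[of "k1 * k2"] k1(1) k2(1) by simp
  qed
  obtain KN where KN: "0 \<le> KN" "\<forall>\<^sub>F n in sequentially. (\<Sum>i=1..n. (Nf (grid h n (i - 1)))\<^sup>2) \<le> KN * a n"
    using le_mult_if_average_bigo[OF B4(1) NO] by blast
  obtain KL where KL: "0 \<le> KL" "\<forall>\<^sub>F n in sequentially. (\<Sum>i=1..n. (Lf (grid h n (i - 1)))\<^sup>2) \<le> KL * a n"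
    using le_mult_if_average_bigo[OF B4(1) LO] by blast
  define K0 where "K0 = KM + KN + KL"
  have K0: "0 \<le> K0" "KM \<le> K0" "KN \<le> K0" "KL \<le> K0" using KM(1) KN(1) KL(1) by (auto simp: K0_def)
  have enlarge: "\<forall>\<^sub>F n in sequentially. F n \<le> K0 * a n"
    if "\<forall>\<^sub>F n in sequentially. F n \<le> k * a n" "k \<le> K0" for F k
    using that(1) a_pos
  proof eventually_elim
    case (elim n)
    have "k * a n \<le> K0 * a n" using that(2) elim(2) by (intro mult_right_mono) auto
    then show ?case using elim(1) by linarith
  qed

  interpret weighted_noise P D h a \<alpha> C
  proof (rule weighted_noise.intro)
    show "gaussian_family P {1..n} (D n)" for n
      using gaussian_family_increments[OF P \<open>centered_stationary_gaussian_process P Z K\<close> h0, of n]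
      by (simp add: D_def[abs_def])
    show "(\<Sum>j\<in>{1..n}. \<bar>covariance P (D n i) (D n j)\<bar>) \<le> C * h n powr \<alpha>" if "i \<in> {1..n}" for n i
      using C(2)[OF that] by (simp add: D_def[abs_def])
    show "prob_space P" by (rule P)
    show "0 < C" by (rule C(1))
    show "0 < h n" for n by (rule h0)
    show "\<forall>\<^sub>F n in sequentially. 0 < a n" by (rule a_pos)
    show "filterlim (\<lambda>n. a n * h n powr (2 - \<alpha>)) at_top sequentially" by (rule rate)
  qed

  have C2: "twice_continuously_differentiable_on (closure \<Xi>) (m n i) (g n i) (H n i)" for n i
    using B2[rule_format, OF t0[of n i]] unfolding m_def[abs_def] g_def[abs_def] H_def[abs_def] .

  interpret drift_estimation P D h a \<alpha> C \<Xi> "\<xi>\<^sub>0" m g H x r "\<lambda>n i. Mf (t n i)" \<xi>hat K0 Cr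
  proof
    show "open \<Xi>" "bounded \<Xi>" "convex \<Xi>" "\<xi>\<^sub>0 \<in> \<Xi>" by (fact \<Xi>)+
    show "x n i \<omega> = D n i \<omega> + r n i + m n i \<xi>\<^sub>0 * h n" if \<omega>: "\<omega> \<in> space P" and "i \<in> {1..n}" for n i \<omega>
    proof -
      have "X s \<omega> = Z s \<omega> + drift s" if "0 \<le> s" for s
        using assms(8) that \<omega> by (simp add: drift_def)
      moreover have "0 \<le> grid h n i" "0 \<le> grid h n (i - 1)" using h0[of n] by (auto simp: grid_def)
      ultimately show ?thesis by (simp add: x_def D_def r_def t_def increment_def)
    qed
    show "\<bar>r n i\<bar> \<le> Cr * (h n)\<^sup>2" if i: "i \<in> {1..n}" for n i
    proof -
      have step: "grid h n i - t n i = h n"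
        using i by (simp add: t_def grid_def of_nat_diff algebra_simps)
      have "0 < grid h n i" using i h0[of n] by (simp add: grid_def)
      then have "set_integrable lborel {0..grid h n i} (\<mu> \<xi>\<^sub>0)" using assms(6) \<xi>0_cl by blast
      from drift_increment_error[OF Cr(2)[OF \<xi>0_cl] this t0, of n i] step h0[of n]
      show ?thesis by (simp add: r_def drift_def m_def)
    qed
    show "0 \<le> Cr" using Cr(1) by simp
    have arg: "is_arg_min (contrast h X \<mu> n \<omega>) (\<lambda>\<xi>. \<xi> \<in> closure \<Xi>) (\<xi>hat n \<omega>)" if "\<omega> \<in> space P" for n \<omega>
      using assms(13) that by blast
    show "\<xi>hat n \<omega> \<in> closure \<Xi>" if "\<omega> \<in> space P" for n \<omega>
      using arg[OF that] by (simp add: is_arg_min_def)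
    show "(\<Sum>i\<in>{1..n}. (x n i \<omega> - m n i (\<xi>hat n \<omega>) * h n)\<^sup>2) \<le> (\<Sum>i\<in>{1..n}. (x n i \<omega> - m n i \<eta> * h n)\<^sup>2)"
      if "\<omega> \<in> space P" "\<eta> \<in> closure \<Xi>" for n \<omega> \<eta>
    proof -
      have "contrast h X \<mu> n \<omega> (\<xi>hat n \<omega>) \<le> contrast h X \<mu> n \<omega> \<eta>"
        using arg[OF that(1), of n] that(2) by (auto simp: is_arg_min_def not_less)
      then show ?thesis by (simp add: contrast_def x_def m_def t_def)
    qed
    show "(m n i has_derivative (\<lambda>v. g n i \<xi> \<bullet> v)) (at \<xi> within closure \<Xi>)"
      "(g n i has_derivative (\<lambda>v. H n i \<xi> *v v)) (at \<xi> within closure \<Xi>)" if "\<xi> \<in> closure \<Xi>" for n i \<xi>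
      using C2[of n i] that by (simp_all add: twice_continuously_differentiable_on_def)
    show "continuous_on (closure \<Xi>) (H n i)" for n i
      using C2[of n i] by (simp add: twice_continuously_differentiable_on_def)
    show "norm (g n i \<xi>) \<le> Mf (t n i)" if "\<xi> \<in> closure \<Xi>" for n i \<xi>
      unfolding g_def by (rule Mf(1)[OF t0 that])
    show "0 \<le> K0" by (rule K0)
    show "\<forall>\<^sub>F n in sequentially. (\<Sum>i\<in>{1..n}. (Mf (t n i))\<^sup>2) \<le> K0 * a n"
      using enlarge[OF KM(2) K0(2)] by (simp add: t_def)
  qed

  obtain e where e: "0 < e" "cball \<xi>\<^sub>0 e \<subseteq> U" using U(2) by (auto simp: mem_interior_cball)
  obtain Q where Q: "continuous_on (closure \<Xi> \<times> closure \<Xi>) (\<lambda>(\<xi>, \<eta>). Q \<xi> \<eta>)"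
      "\<forall>\<xi>\<in>closure \<Xi>. \<forall>\<eta>\<in>closure \<Xi>. 0 \<le> Q \<xi> \<eta>"
      "uniform_limit (closure \<Xi>)
         (\<lambda>n \<xi>. 1 / a n * (\<Sum>i=1..n. (\<mu> \<xi> (grid h n (i - 1)) - \<mu> \<xi>\<^sub>0 (grid h n (i - 1)))\<^sup>2))
         (\<lambda>\<xi>. Q \<xi> \<xi>\<^sub>0) sequentially"
      "\<forall>\<xi>\<in>closure \<Xi>. Q \<xi> \<xi>\<^sub>0 = 0 \<longleftrightarrow> \<xi> = \<xi>\<^sub>0"
    using B4(2) by blast

  interpret smooth_drift_estimation P D h a \<alpha> C \<Xi> "\<xi>\<^sub>0" m g H x r "\<lambda>n i. Mf (t n i)" \<xi>hat K0 Cr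
    "cball \<xi>\<^sub>0 e" "\<lambda>n i. Nf (t n i)" "\<lambda>n i. Lf (t n i)" \<rho> I\<^sub>0
  proof
    show "compact (cball \<xi>\<^sub>0 e)" "convex (cball \<xi>\<^sub>0 e)" by auto
    show "\<xi>\<^sub>0 \<in> interior (cball \<xi>\<^sub>0 e)" using e(1) by simp
    show "cball \<xi>\<^sub>0 e \<subseteq> \<Xi>" using e(2) U(1) by blast
    show "norm (H n i \<xi>) \<le> Nf (t n i)" if "\<xi> \<in> cball \<xi>\<^sub>0 e" for n i \<xi>
      unfolding H_def using Nf[OF t0] e(2) that by blast
    show "norm (H n i \<xi> - H n i \<eta>) \<le> Lf (t n i) * norm (\<xi> - \<eta>) powr \<rho>"
      if "\<xi> \<in> cball \<xi>\<^sub>0 e" "\<eta> \<in> cball \<xi>\<^sub>0 e" for n i \<xi> \<eta>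
      unfolding H_def using Lf[OF t0] e(2) that by blast
    show "0 < \<rho>" by (rule \<rho>)
    show "\<forall>\<^sub>F n in sequentially. (\<Sum>i\<in>{1..n}. (Nf (t n i))\<^sup>2) \<le> K0 * a n"
      using enlarge[OF KN(2) K0(3)] by (simp add: t_def)
    show "\<forall>\<^sub>F n in sequentially. (\<Sum>i\<in>{1..n}. (Lf (t n i))\<^sup>2) \<le> K0 * a n"
      using enlarge[OF KL(2) K0(4)] by (simp add: t_def)
    show "(\<lambda>n. (1 / a n) *\<^sub>R (\<Sum>i\<in>{1..n}. outer (g n i \<xi>\<^sub>0) (g n i \<xi>\<^sub>0))) \<longlonglongrightarrow> I\<^sub>0"
      using B6(2) by (simp add: g_def t_def)
    show "whp P (\<lambda>n \<omega>. norm (\<xi>hat n \<omega> - \<xi>\<^sub>0) < \<delta>)" if "0 < \<delta>" for \<delta>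
    proof (rule consistent[OF _ _ _ _ _ that])
      have "continuous_on (closure \<Xi>) (\<lambda>\<xi>. (\<lambda>(\<xi>, \<eta>). Q \<xi> \<eta>) (\<xi>, \<xi>\<^sub>0))"
        by (rule continuous_on_compose2[OF Q(1)]) (auto intro!: continuous_intros simp: \<xi>0_cl)
      then show "continuous_on (closure \<Xi>) (\<lambda>\<xi>. Q \<xi> \<xi>\<^sub>0)" by simp
      show "uniform_limit (closure \<Xi>) (\<lambda>n \<xi>. 1 / a n * (\<Sum>i\<in>{1..n}. (m n i \<xi> - m n i \<xi>\<^sub>0)\<^sup>2))
          (\<lambda>\<xi>. Q \<xi> \<xi>\<^sub>0) sequentially"
        using Q(3) by (simp add: m_def t_def)
      show "0 \<le> Q \<xi> \<xi>\<^sub>0" if "\<xi> \<in> closure \<Xi>" for \<xi> using Q(2) that \<xi>0_cl by blast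
      show "Q \<xi> \<xi>\<^sub>0 = 0 \<longleftrightarrow> \<xi> = \<xi>\<^sub>0" if "\<xi> \<in> closure \<Xi>" for \<xi> using Q(4) that by blast
      show "(\<lambda>n. real n * (h n)\<^sup>2 / a n) \<longlonglongrightarrow> 0" by fact
    qed
  qed

  show ?thesis
  proof (rule asymptotic_normality[OF B6(1) B7(1) _ \<open>(\<lambda>n. real n * h n powr (4 - \<beta>)) \<longlonglongrightarrow> 0\<close>])
    show "(\<lambda>n. (1 / (a n * h n powr \<beta>)) *\<^sub>R (\<Sum>i\<in>{1..n}. \<Sum>j\<in>{1..n}.
        covariance P (D n i) (D n j) *\<^sub>R outer (g n i \<xi>\<^sub>0) (g n j \<xi>\<^sub>0))) \<longlonglongrightarrow> \<Gamma>\<^sub>0"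
      using B7(2) by (simp add: D_def[abs_def] g_def t_def)
    show "\<xi>hat n \<in> borel_measurable P" for n using assms(12) by blast
  qed
qed

end
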